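(* Let $\xi\in c_o^*$, $\xi\neq0$. If $F\neq(\xi)=\widehat{(\xi)}$, then $(\xi)=(\xi)_a$.
   Context: $H$ is a separable infinite-dimensional complex Hilbert space. "Ideal" means a two-sided ideal of $B(H)$ contained in the compact operators; $F$ is the ideal of finite rank operators. $c_o^*$ is the set of nonnegative monotone nonincreasing sequences converging to $0$. $\Sigma(I):=\{s(X)\mid X\in I\}\subset c_o^*$, where $s(X)$ is the sequence of s-numbers (singular values) of $X$; an ideal is determined by $\Sigma(I)$. For $\xi\in c_o^*$, $(\xi)$ is the principal ideal generated by $\mathrm{diag}\,\xi$; $\eta\in\Sigma((\xi))$ iff $\eta=O(D_m\xi)$ for some $m\in\mathbb N$, where $(D_m\xi)_n:=\xi_{\lceil n/m\rceil}$. For $\xi\in c_o^*$ put $(\xi_a)_n:=\frac1n\sum_{j=1}^n\xi_j$. The arithmetic mean $I_a$ of an ideal $I$ is the ideal with $\Sigma(I_a)=\{\xi\in c_o^*\mid\xi=O(\eta_a)\text{ for some }\eta\in\Sigma(I)\}$. For an ideal $I$, $\widehat I:=\bigcap\{J\mid J\text{ an ideal},\ J_a\supset I_a\}$. *)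

theory Defs
  imports "HOL-Analysis.Analysis"
begin

(* Complex Hilbert spaces; the inner product is linear in its first argument.  Positive
   definiteness of cinner is contained in cinner_self together with the norm axioms. *)
class complex_hilbert_space = banach +
  fixes scaleC :: "complex \<Rightarrow> 'a \<Rightarrow> 'a" (infixr "*\<^sub>C" 75)
    and cinner :: "'a \<Rightarrow> 'a \<Rightarrow> complex"
  assumes scaleC_add_right: "c *\<^sub>C (x + y) = c *\<^sub>C x + c *\<^sub>C y"
    and scaleC_add_left: "(c + d) *\<^sub>C x = c *\<^sub>C x + d *\<^sub>C x"
    and scaleC_scaleC: "c *\<^sub>C d *\<^sub>C x = (c * d) *\<^sub>C x"
    and scaleC_one: "1 *\<^sub>C x = x"
    and scaleR_scaleC: "r *\<^sub>R x = complex_of_real r *\<^sub>C x"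
    and cinner_commute: "cinner x y = cnj (cinner y x)"
    and cinner_add_left: "cinner (x + y) z = cinner x z + cinner y z"
    and cinner_scaleC_left: "cinner (c *\<^sub>C x) y = c * cinner x y"
    and cinner_self: "cinner x x = complex_of_real ((norm x)\<^sup>2)"

interpretation complex_vector: vector_space "scaleC :: complex \<Rightarrow> 'a \<Rightarrow> 'a::complex_hilbert_space"
  by unfold_locales (simp_all add: scaleC_add_right scaleC_add_left scaleC_scaleC scaleC_one)

definition infinite_dimensional :: "'a::complex_hilbert_space itself \<Rightarrow> bool" where
  "infinite_dimensional _ \<longleftrightarrow> \<not> (\<exists>B :: 'a set. finite B \<and> complex_vector.span B = UNIV)"

definition orthonormal_basis :: "(nat \<Rightarrow> 'a::complex_hilbert_space) \<Rightarrow> bool" where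
  "orthonormal_basis e \<longleftrightarrow>
     (\<forall>i j. cinner (e i) (e j) = (if i = j then 1 else 0)) \<and>
     closure (complex_vector.span (range e)) = UNIV"


(* Elements of the blinfun type are only real-linear, so B(H) is a proper subset of it. *)
definition bounded_operators :: "('a::complex_hilbert_space \<Rightarrow>\<^sub>L 'a) set" where
  "bounded_operators = {T. \<forall>c x. blinfun_apply T (c *\<^sub>C x) = c *\<^sub>C blinfun_apply T x}"

definition compact_operators :: "('a::complex_hilbert_space \<Rightarrow>\<^sub>L 'a) set" where
  "compact_operators = {T \<in> bounded_operators. compact (closure (blinfun_apply T ` cball 0 1))}"

definition finite_rank_operators :: "('a::complex_hilbert_space \<Rightarrow>\<^sub>L 'a) set" where
  "finite_rank_operators =
     {T \<in> bounded_operators. \<exists>B. finite B \<and> range (blinfun_apply T) \<subseteq> complex_vector.span B}"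

definition operator_ideal :: "('a::complex_hilbert_space \<Rightarrow>\<^sub>L 'a) set \<Rightarrow> bool" where
  "operator_ideal I \<longleftrightarrow>
     I \<subseteq> compact_operators \<and> 0 \<in> I \<and>
     (\<forall>X\<in>I. \<forall>Y\<in>I. X + Y \<in> I) \<and>
     (\<forall>X\<in>I. \<forall>A\<in>bounded_operators. A o\<^sub>L X \<in> I \<and> X o\<^sub>L A \<in> I)"

definition hilbert_adjoint ::
    "('a::complex_hilbert_space \<Rightarrow>\<^sub>L 'a) \<Rightarrow> ('a \<Rightarrow>\<^sub>L 'a)" where
  "hilbert_adjoint X = (THE Y. Y \<in> bounded_operators \<and>
     (\<forall>x y. cinner (blinfun_apply X x) y = cinner x (blinfun_apply Y y)))"


(* Sequences are indexed from 0 here: the term of index n + 1 of a sequence of the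
   literature is the value at n. *)
definition c0_star :: "(nat \<Rightarrow> real) set" where
  "c0_star = {\<xi>. (\<forall>n. 0 \<le> \<xi> n) \<and> decseq \<xi> \<and> \<xi> \<longlonglongrightarrow> 0}"

definition arith_mean :: "(nat \<Rightarrow> real) \<Rightarrow> nat \<Rightarrow> real" where
  "arith_mean \<xi> n = (\<Sum>j\<le>n. \<xi> j) / real (n + 1)"

(* Singular values of a compact operator X: the square roots of the eigenvalues of X* X, in
   nonincreasing order and repeated according to multiplicity, followed by zeros if X has
   finite rank.  All eigenspaces occurring below (t > 0) are finite-dimensional. *)
definition s_numbers :: "('a::complex_hilbert_space \<Rightarrow>\<^sub>L 'a) \<Rightarrow> nat \<Rightarrow> real" where
  "s_numbers X = (THE s. s \<in> c0_star \<and>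
     (\<forall>t>0. card {n. s n = t} =
        complex_vector.dim {x. blinfun_apply (hilbert_adjoint X o\<^sub>L X) x = t\<^sup>2 *\<^sub>R x}))"

definition Sigma_set :: "('a::complex_hilbert_space \<Rightarrow>\<^sub>L 'a) set \<Rightarrow> (nat \<Rightarrow> real) set" where
  "Sigma_set I = s_numbers ` I"

definition diag_operator ::
    "(nat \<Rightarrow> 'a::complex_hilbert_space) \<Rightarrow> (nat \<Rightarrow> real) \<Rightarrow> ('a \<Rightarrow>\<^sub>L 'a)" where
  "diag_operator e \<xi> = Blinfun (\<lambda>x. \<Sum>n. \<xi> n *\<^sub>R cinner x (e n) *\<^sub>C e n)"

definition principal_ideal ::
    "(nat \<Rightarrow> 'a::complex_hilbert_space) \<Rightarrow> (nat \<Rightarrow> real) \<Rightarrow> ('a \<Rightarrow>\<^sub>L 'a) set" where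
  "principal_ideal e \<xi> = \<Inter>{J. operator_ideal J \<and> diag_operator e \<xi> \<in> J}"

(* An ideal is determined by its set of s-number sequences, hence the definite description.
   The O-relation is the bound for all indices.  It differs from the Landau symbol of the
   library, which is a bound for almost all indices, only when the right-hand side vanishes. *)
definition am_ideal :: "('a::complex_hilbert_space \<Rightarrow>\<^sub>L 'a) set \<Rightarrow> ('a \<Rightarrow>\<^sub>L 'a) set" where
  "am_ideal I = (THE J. operator_ideal J \<and>
     Sigma_set J = {\<xi> \<in> c0_star. \<exists>\<eta> \<in> Sigma_set I. \<exists>M. \<forall>n. \<xi> n \<le> M * arith_mean \<eta> n})"

definition hat_ideal :: "('a::complex_hilbert_space \<Rightarrow>\<^sub>L 'a) set \<Rightarrow> ('a \<Rightarrow>\<^sub>L 'a) set" where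
  "hat_ideal I = \<Inter>{J. operator_ideal J \<and> am_ideal I \<subseteq> am_ideal J}"

end

theory Submission
  imports Defs
begin

text \<open>
  Write \<open>\<xi>\<^sub>a\<close> for the arithmetic means of \<open>\<xi>\<close>. If \<open>\<eta>\<close> is a sequence with \<open>\<xi>\<^sub>a = O(\<eta>\<^sub>a)\<close>, then
  \<open>(\<eta>)\<^sub>a \<supseteq> (\<xi>)\<^sub>a\<close>, so the hypothesis \<open>(\<xi>) = \<close> hat \<open>(\<xi>)\<close> forces \<open>(\<xi>) \<subseteq> (\<eta>)\<close>, that is, \<open>\<xi>\<close> is dominated by
  a dilation of \<open>\<eta>\<close>. For summable \<open>\<xi>\<close> the choice \<open>\<eta> = (1, 0, 0, \<dots>)\<close> gives \<open>(\<xi>) = F\<close>. Otherwise let \<open>S\<close> be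
  the partial sums of \<open>\<xi>\<close>. The mass of \<open>\<xi>\<close> can be concentrated in steps: first \<open>S N / \<mu>\<close> terms equal to a
  constant \<open>\<mu>\<close>, then terms equal to the mean \<open>S N / N\<close>, and so on along a very sparse sequence of values
  of \<open>N\<close>. If \<open>\<xi>\<^sub>a\<close> is not \<open>O(\<xi>)\<close>, the values of \<open>N\<close> can be chosen such that no dilation of this \<open>\<eta>\<close>
  dominates \<open>\<xi>\<close>. Hence \<open>\<xi>\<^sub>a = O(\<xi>)\<close>, which is \<open>(\<xi>) = (\<xi>)\<^sub>a\<close>.

  The correspondence between ideals and sets of sequences rests on the singular value decomposition, which
  is obtained by repeatedly splitting off a vector at which a compact operator attains its norm, and on
  Ky Fan's inequality \<open>s\<^sub>m\<^sub>+\<^sub>n(X + Y) \<le> s\<^sub>m(X) + s\<^sub>n(Y)\<close>.\<close>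

section \<open>Inner products and orthonormal sequences\<close>

text \<open>The obstacle is the order of the quantifiers: one \<eta> has to defeat every constant
  and every dilation. This is a diagonal argument, in which stage \<open>k\<close> of the choice of
  \<open>N\<close> defeats the number \<open>Suc k\<close> in both roles. With \<mu> the current
  height, a stage can fail only if \<open>\<xi> (k * nat \<lceil>S N / \<mu>\<rceil>) \<le> k * S N
  / N\<close> for all large \<open>N\<close>. The index on the left is \<open>k\<close> times the
  place where the step of height \<mu> ends, and \<open>S N / N\<close> is the next height. This one
  family of inequalities already forces \<xi>_a = O(\<xi>).

  The means of \<eta> dominate those of \<xi> for two reasons. By the end of the step of height
  \<mu> the mass \<open>S N\<close> has been collected, which suffices for all partial sums up to
  \<open>N\<close>. From \<open>N\<close> on, the height \<open>S N / N\<close> bounds every average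
  of \<xi>, because averages of a nonincreasing sequence are nonincreasing.

  Adjoints, s-numbers and arithmetic means of ideals are definite descriptions, so existence and
  uniqueness have to be settled before any of them can be computed.\<close>

lemma cinner_add_right: "cinner x (y + z) = cinner x y + cinner x (z::'a::complex_hilbert_space)"
  by (metis cinner_add_left cinner_commute complex_cnj_add)

lemma cinner_scaleC_right: "cinner x (c *\<^sub>C y) = cnj c * cinner x (y::'a::complex_hilbert_space)"
  by (metis cinner_scaleC_left cinner_commute complex_cnj_mult)

lemma cinner_scaleR_left: "cinner (r *\<^sub>R x) y = of_real r * cinner x (y::'a::complex_hilbert_space)"
  by (simp add: scaleR_scaleC cinner_scaleC_left)

lemma cinner_scaleR_right: "cinner x (r *\<^sub>R y) = of_real r * cinner x (y::'a::complex_hilbert_space)"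
  by (simp add: scaleR_scaleC cinner_scaleC_right)

lemma cinner_zero_left [simp]: "cinner 0 y = 0" for y :: "'a::complex_hilbert_space"
  using cinner_scaleR_left[of 0 0 y] by simp

lemma cinner_zero_right [simp]: "cinner y 0 = 0" for y :: "'a::complex_hilbert_space"
  using cinner_scaleR_right[of y 0 0] by simp

lemma cinner_minus_left: "cinner (- x) y = - cinner x (y::'a::complex_hilbert_space)"
  using cinner_scaleR_left[of "-1" x y] by simp

lemma cinner_minus_right: "cinner x (- y) = - cinner x (y::'a::complex_hilbert_space)"
  using cinner_scaleR_right[of x "-1" y] by simp

lemma cinner_diff_left: "cinner (x - y) z = cinner x z - cinner y (z::'a::complex_hilbert_space)"
  using cinner_add_left[of x "-y" z] by (simp add: cinner_minus_left)

lemma cinner_diff_right: "cinner x (y - z) = cinner x y - cinner x (z::'a::complex_hilbert_space)"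
  using cinner_add_right[of x y "-z"] by (simp add: cinner_minus_right)

lemma cinner_sum_left: "cinner (\<Sum>i\<in>A. f i) y = (\<Sum>i\<in>A. cinner (f i) (y::'a::complex_hilbert_space))"
  by (induction A rule: infinite_finite_induct) (auto simp: cinner_add_left)

lemma cinner_sum_right: "cinner y (\<Sum>i\<in>A. f i) = (\<Sum>i\<in>A. cinner (y::'a::complex_hilbert_space) (f i))"
  by (induction A rule: infinite_finite_induct) (auto simp: cinner_add_right)

lemmas cinner_linear_simps = cinner_add_left cinner_add_right cinner_diff_left cinner_diff_right
  cinner_scaleC_left cinner_scaleC_right cinner_scaleR_left cinner_scaleR_right

lemma norm_sq_eq_cinner: "(norm x)\<^sup>2 = Re (cinner x (x::'a::complex_hilbert_space))"
  by (simp add: cinner_self)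

lemma norm_scaleC [simp]: "norm (c *\<^sub>C x) = cmod c * norm (x::'a::complex_hilbert_space)"
proof -
  have "complex_of_real ((norm (c *\<^sub>C x))\<^sup>2) = complex_of_real ((cmod c * norm x)\<^sup>2)"
    unfolding cinner_self[symmetric, of "c *\<^sub>C x"] cinner_linear_simps
    by (simp only: power_mult_distrib of_real_mult complex_norm_square[of c] cinner_self) (simp add: ac_simps)
  then have "(norm (c *\<^sub>C x))\<^sup>2 = (cmod c * norm x)\<^sup>2" using of_real_eq_iff by blast
  then show ?thesis by (simp add: power2_eq_iff_nonneg)
qed

lemma norm_add_sq_orthogonal:
  assumes "cinner x y = 0"
  shows "(norm (x + y))\<^sup>2 = (norm x)\<^sup>2 + (norm (y::'a::complex_hilbert_space))\<^sup>2"
proof -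
  have "cinner y x = 0" using assms by (metis cinner_commute complex_cnj_zero)
  then show ?thesis using assms by (simp add: norm_sq_eq_cinner cinner_linear_simps)
qed

lemma parallelogram_law:
  "(norm (x + y))\<^sup>2 + (norm (x - y))\<^sup>2 = 2 * (norm x)\<^sup>2 + 2 * (norm (y::'a::complex_hilbert_space))\<^sup>2"
  by (simp add: norm_sq_eq_cinner cinner_linear_simps)

lemma Cauchy_Schwarz: "cmod (cinner x y) \<le> norm x * norm (y::'a::complex_hilbert_space)"
proof (cases "y = 0")
  case False
  define c where "c = cinner x y / cinner y y"
  have yy: "cinner y y \<noteq> 0" using False by (simp add: cinner_self)
  define z where "z = x - c *\<^sub>C y"
  have "cinner z y = 0" using yy by (simp add: z_def c_def cinner_linear_simps)
  then have "cinner z (c *\<^sub>C y) = 0" by (simp add: cinner_linear_simps)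
  from norm_add_sq_orthogonal[OF this]
  have "(norm x)\<^sup>2 = (norm z)\<^sup>2 + (cmod c * norm y)\<^sup>2" by (simp add: z_def)
  then have "(cmod c * norm y)\<^sup>2 \<le> (norm x)\<^sup>2" by simp
  then have "cmod c * norm y \<le> norm x" by (rule power2_le_imp_le) simp
  moreover have "cmod (cinner x y) = cmod c * norm y * norm y"
    using False by (simp add: c_def norm_divide cinner_self power2_eq_square norm_mult)
  ultimately show ?thesis by (simp add: mult_right_mono)
qed simp

lemma bounded_bilinear_cinner: "bounded_bilinear (cinner :: 'a::complex_hilbert_space \<Rightarrow> 'a \<Rightarrow> complex)"
proof
  show "\<exists>K. \<forall>a b. norm (cinner a (b::'a)) \<le> norm a * norm b * K"
    using Cauchy_Schwarz by (intro exI[of _ 1]) auto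
qed (simp_all add: cinner_linear_simps scaleR_conv_of_real)

lemmas bounded_linear_cinner_left = bounded_bilinear.bounded_linear_left[OF bounded_bilinear_cinner]
lemmas bounded_linear_cinner_right = bounded_bilinear.bounded_linear_right[OF bounded_bilinear_cinner]

lemma bounded_linear_scaleC_left: "bounded_linear (\<lambda>c. c *\<^sub>C (x::'a::complex_hilbert_space))"
  by (rule bounded_linear_intro[where K="norm x"])
     (simp_all add: scaleC_add_left scaleR_scaleC scaleC_scaleC scaleR_conv_of_real)

lemma bounded_linear_scaleC_right: "bounded_linear (\<lambda>x. c *\<^sub>C (x::'a::complex_hilbert_space))"
  by (rule bounded_linear_intro[where K="cmod c"])
     (simp_all add: scaleC_add_right scaleR_scaleC scaleC_scaleC mult.commute)

lemma cinner_eqI: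
  assumes "\<And>z. cinner x z = cinner y z"
  shows "x = (y::'a::complex_hilbert_space)"
  using assms[of "x - y"] cinner_self[of "x - y"] by (simp add: cinner_diff_left)

text \<open>Singular vectors belonging to the singular value zero are taken to be the zero vector, so that
  finite-rank operators need no special treatment.\<close>
definition partial_orthonormal :: "(nat \<Rightarrow> 'a::complex_hilbert_space) \<Rightarrow> bool" where
  "partial_orthonormal v \<longleftrightarrow> (\<forall>i j. i \<noteq> j \<longrightarrow> cinner (v i) (v j) = 0) \<and> (\<forall>i. v i \<noteq> 0 \<longrightarrow> norm (v i) = 1)"

lemma partial_orthonormal_norm_le: "partial_orthonormal v \<Longrightarrow> norm (v i) \<le> 1"
  unfolding partial_orthonormal_def by (cases "v i = 0") auto

lemma cinner_partial_orthonormal: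
  "partial_orthonormal v \<Longrightarrow> cinner (v i) (v j) = (if i = j \<and> v i \<noteq> 0 then 1 else 0)"
  unfolding partial_orthonormal_def using cinner_self[of "v i"] by auto

lemma orthonormal_basis_partial_orthonormal: "orthonormal_basis e \<Longrightarrow> partial_orthonormal e"
proof -
  assume e: "orthonormal_basis e"
  then have "(norm (e i))\<^sup>2 = 1" for i
    by (simp add: norm_sq_eq_cinner orthonormal_basis_def)
  then have "norm (e i) = 1" for i
    by (metis norm_ge_zero one_power2 power2_eq_imp_eq zero_le_one)
  with e show ?thesis unfolding partial_orthonormal_def orthonormal_basis_def by auto
qed

lemma norm_sum_orthogonal_sq:
  assumes "partial_orthonormal u" "finite A"
  shows "(norm (\<Sum>i\<in>A. c i *\<^sub>C u i))\<^sup>2 = (\<Sum>i\<in>A. (cmod (c i))\<^sup>2 * (norm (u i))\<^sup>2)"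
  using assms(2)
proof (induction A rule: finite_induct)
  case (insert i A)
  have "cinner (c i *\<^sub>C u i) (\<Sum>i\<in>A. c i *\<^sub>C u i) = 0"
    unfolding cinner_sum_right
  proof (intro sum.neutral ballI)
    fix j assume "j \<in> A"
    then have "i \<noteq> j" using insert by auto
    then show "cinner (c i *\<^sub>C u i) (c j *\<^sub>C u j) = 0"
      using assms(1) by (simp add: cinner_linear_simps partial_orthonormal_def)
  qed
  from norm_add_sq_orthogonal[OF this] show ?case
    using insert by (simp add: power_mult_distrib)
qed simp

lemma Bessel_finite:
  assumes "partial_orthonormal v" "finite A"
  shows "(\<Sum>i\<in>A. (cmod (cinner x (v i)))\<^sup>2) \<le> (norm x)\<^sup>2"
proof -
  define y where "y = (\<Sum>i\<in>A. cinner x (v i) *\<^sub>C v i)"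
  have y: "cinner y (v j) = cinner x (v j)" if "j \<in> A" for j
  proof -
    have "cinner y (v j) = (\<Sum>i\<in>A. if i = j then cinner x (v i) * (if v i \<noteq> 0 then 1 else 0) else 0)"
      unfolding y_def cinner_sum_left
      by (intro sum.cong) (auto simp: cinner_linear_simps cinner_partial_orthonormal[OF assms(1)])
    also have "\<dots> = cinner x (v j)" using that assms(2) by (cases "v j = 0") simp_all
    finally show ?thesis .
  qed
  have "cinner (x - y) y = 0"
  proof -
    have "cinner (x - y) (v i) = 0" if "i \<in> A" for i using y[OF that] by (simp add: cinner_diff_left)
    then show ?thesis by (subst (2) y_def) (simp add: cinner_sum_right cinner_scaleC_right)
  qed
  from norm_add_sq_orthogonal[OF this] have "(norm y)\<^sup>2 \<le> (norm x)\<^sup>2" by simp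
  moreover have "(norm y)\<^sup>2 = (\<Sum>i\<in>A. (cmod (cinner x (v i)))\<^sup>2)"
    unfolding y_def norm_sum_orthogonal_sq[OF assms]
  proof (intro sum.cong refl)
    fix i show "(cmod (cinner x (v i)))\<^sup>2 * (norm (v i))\<^sup>2 = (cmod (cinner x (v i)))\<^sup>2"
      using assms(1) by (cases "v i = 0") (auto simp: partial_orthonormal_def)
  qed
  ultimately show ?thesis by simp
qed

lemma summable_Bessel:
  assumes "partial_orthonormal v"
  shows "summable (\<lambda>i. (cmod (cinner x (v i)))\<^sup>2)"
  by (rule bounded_imp_summable[where B="(norm x)\<^sup>2"]) (use Bessel_finite[OF assms, of "{.._}"] in auto)

lemma summable_orthogonal_series:
  assumes "partial_orthonormal u" "summable (\<lambda>i. (cmod (c i))\<^sup>2)"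
  shows "summable (\<lambda>i. c i *\<^sub>C u i)"
  unfolding summable_Cauchy
proof (intro allI impI)
  fix e :: real assume "e > 0"
  then have "e\<^sup>2 > 0" by simp
  with assms(2) obtain N where N: "\<And>m n. m \<ge> N \<Longrightarrow> norm (\<Sum>i\<in>{m..<n}. (cmod (c i))\<^sup>2) < e\<^sup>2"
    unfolding summable_Cauchy by blast
  show "\<exists>N. \<forall>m\<ge>N. \<forall>n. norm (\<Sum>i\<in>{m..<n}. c i *\<^sub>C u i) < e"
  proof (intro exI allI impI)
    fix m n assume "m \<ge> N"
    have "(norm (\<Sum>i\<in>{m..<n}. c i *\<^sub>C u i))\<^sup>2 \<le> (\<Sum>i\<in>{m..<n}. (cmod (c i))\<^sup>2)"
      unfolding norm_sum_orthogonal_sq[OF assms(1) finite_atLeastLessThan]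
    proof (intro sum_mono)
      fix i
      have "(norm (u i))\<^sup>2 \<le> 1"
        using partial_orthonormal_norm_le[OF assms(1), of i] by (simp add: power_le_one)
      then show "(cmod (c i))\<^sup>2 * (norm (u i))\<^sup>2 \<le> (cmod (c i))\<^sup>2" by (simp add: mult_left_le)
    qed
    also have "\<dots> < e\<^sup>2" using N[OF \<open>m \<ge> N\<close>, of n] by simp
    finally show "norm (\<Sum>i\<in>{m..<n}. c i *\<^sub>C u i) < e"
      using \<open>e > 0\<close> by (simp add: power_less_imp_less_base)
  qed
qed

section \<open>Operators given by weighted orthonormal sequences\<close>

lemma bounded_operators_scaleC: "T \<in> bounded_operators \<Longrightarrow> blinfun_apply T (c *\<^sub>C x) = c *\<^sub>C blinfun_apply T x"
  unfolding bounded_operators_def by auto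

lemma bounded_operators_add: "S \<in> bounded_operators \<Longrightarrow> T \<in> bounded_operators \<Longrightarrow> S + T \<in> bounded_operators"
  unfolding bounded_operators_def by (auto simp: blinfun.add_left scaleC_add_right)

lemma bounded_operators_zero: "0 \<in> bounded_operators"
  unfolding bounded_operators_def by simp

lemma bounded_operators_compose: "S \<in> bounded_operators \<Longrightarrow> T \<in> bounded_operators \<Longrightarrow> S o\<^sub>L T \<in> bounded_operators"
  unfolding bounded_operators_def by auto

text \<open>The operator with singular value decomposition given by \<^term>\<open>s\<close>, \<^term>\<open>v\<close>, \<^term>\<open>u\<close>; the
  diagonal operators are the case \<^term>\<open>v = u\<close>, partial isometries the case \<^term>\<open>s = (\<lambda>_. 1)\<close>.\<close>
definition weighted_operator ::
    "(nat \<Rightarrow> real) \<Rightarrow> (nat \<Rightarrow> 'a) \<Rightarrow> (nat \<Rightarrow> 'a) \<Rightarrow> ('a::complex_hilbert_space \<Rightarrow>\<^sub>L 'a)" where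
  "weighted_operator s v u = Blinfun (\<lambda>x. \<Sum>n. s n *\<^sub>R cinner x (v n) *\<^sub>C u n)"

lemma diag_operator_eq: "diag_operator e \<xi> = weighted_operator \<xi> e e"
  unfolding diag_operator_def weighted_operator_def ..

context
  fixes s :: "nat \<Rightarrow> real" and v u :: "nat \<Rightarrow> 'a::complex_hilbert_space" and B :: real
  assumes v: "partial_orthonormal v" and u: "partial_orthonormal u" and B: "\<forall>n. \<bar>s n\<bar> \<le> B"
begin

lemma summable_weighted_operator: "summable (\<lambda>n. s n *\<^sub>R cinner x (v n) *\<^sub>C u n)"
proof -
  have "summable (\<lambda>n. (cmod (of_real (s n) * cinner x (v n)))\<^sup>2)"
  proof (rule summable_comparison_test')
    show "summable (\<lambda>n. B\<^sup>2 * (cmod (cinner x (v n)))\<^sup>2)"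
      by (intro summable_mult summable_Bessel v)
    fix n
    have "(s n)\<^sup>2 \<le> B\<^sup>2" using B[rule_format, of n] by (metis abs_ge_zero power2_abs power_mono)
    then show "norm ((cmod (of_real (s n) * cinner x (v n)))\<^sup>2) \<le> B\<^sup>2 * (cmod (cinner x (v n)))\<^sup>2"
      by (simp add: norm_mult power_mult_distrib mult_right_mono)
  qed
  from summable_orthogonal_series[OF u this] show ?thesis
    by (simp add: scaleR_scaleC scaleC_scaleC)
qed

lemma norm_weighted_sum_le: "norm (\<Sum>n. s n *\<^sub>R cinner x (v n) *\<^sub>C u n) \<le> B * norm x"
proof -
  have "0 \<le> B" using B[rule_format, of 0] by simp
  have "norm (\<Sum>i<n. s i *\<^sub>R cinner x (v i) *\<^sub>C u i) \<le> B * norm x" for n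
  proof (rule power2_le_imp_le)
    have "(norm (\<Sum>i<n. s i *\<^sub>R cinner x (v i) *\<^sub>C u i))\<^sup>2
        = (\<Sum>i<n. (cmod (of_real (s i) * cinner x (v i)))\<^sup>2 * (norm (u i))\<^sup>2)"
      unfolding norm_sum_orthogonal_sq[OF u finite_lessThan, symmetric]
      by (simp add: scaleR_scaleC scaleC_scaleC)
    also have "\<dots> \<le> (\<Sum>i<n. B\<^sup>2 * (cmod (cinner x (v i)))\<^sup>2)"
    proof (intro sum_mono)
      fix i
      have "(s i)\<^sup>2 \<le> B\<^sup>2" using B[rule_format, of i] by (metis abs_ge_zero power2_abs power_mono)
      then have "(cmod (of_real (s i) * cinner x (v i)))\<^sup>2 \<le> B\<^sup>2 * (cmod (cinner x (v i)))\<^sup>2"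
        by (simp add: norm_mult power_mult_distrib mult_right_mono)
      moreover have "(norm (u i))\<^sup>2 \<le> 1"
        using partial_orthonormal_norm_le[OF u, of i] by (simp add: power_le_one)
      ultimately show "(cmod (of_real (s i) * cinner x (v i)))\<^sup>2 * (norm (u i))\<^sup>2 \<le> B\<^sup>2 * (cmod (cinner x (v i)))\<^sup>2"
        by (smt (verit) mult_left_le zero_le_power2)
    qed
    also have "\<dots> \<le> (B * norm x)\<^sup>2"
      unfolding sum_distrib_left[symmetric] power_mult_distrib
      by (intro mult_left_mono Bessel_finite v) auto
    finally show "(norm (\<Sum>i<n. s i *\<^sub>R cinner x (v i) *\<^sub>C u i))\<^sup>2 \<le> (B * norm x)\<^sup>2" .
  qed (use \<open>0 \<le> B\<close> in simp)
  then show ?thesis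
    by (intro LIMSEQ_le_const2[OF tendsto_norm[OF summable_LIMSEQ[OF summable_weighted_operator]]]) auto
qed

lemma weighted_operator_apply:
  "blinfun_apply (weighted_operator s v u) x = (\<Sum>n. s n *\<^sub>R cinner x (v n) *\<^sub>C u n)"
proof -
  note sm = summable_sums[OF summable_weighted_operator]
  have "bounded_linear (\<lambda>x. \<Sum>n. s n *\<^sub>R cinner x (v n) *\<^sub>C u n)"
  proof (rule bounded_linear_intro[where K=B])
    fix x y
    have "s n *\<^sub>R cinner (x + y) (v n) *\<^sub>C u n = s n *\<^sub>R cinner x (v n) *\<^sub>C u n + s n *\<^sub>R cinner y (v n) *\<^sub>C u n" for n
      by (simp only: cinner_add_left scaleC_add_left scaleR_add_right)
    then show "(\<Sum>n. s n *\<^sub>R cinner (x + y) (v n) *\<^sub>C u n)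
        = (\<Sum>n. s n *\<^sub>R cinner x (v n) *\<^sub>C u n) + (\<Sum>n. s n *\<^sub>R cinner y (v n) *\<^sub>C u n)"
      using sums_add[OF sm[of x] sm[of y]] by (simp only: sums_unique[symmetric])
  next
    fix r x
    have "s n *\<^sub>R cinner (r *\<^sub>R x) (v n) *\<^sub>C u n = r *\<^sub>R (s n *\<^sub>R cinner x (v n) *\<^sub>C u n)" for n
      by (simp add: cinner_scaleC_left scaleR_scaleC scaleC_scaleC mult.left_commute)
    then show "(\<Sum>n. s n *\<^sub>R cinner (r *\<^sub>R x) (v n) *\<^sub>C u n) = r *\<^sub>R (\<Sum>n. s n *\<^sub>R cinner x (v n) *\<^sub>C u n)"
      using sums_scaleR_right[OF sm[of x], of r] by (simp only: sums_unique[symmetric])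
  next
    fix x
    show "norm (\<Sum>n. s n *\<^sub>R cinner x (v n) *\<^sub>C u n) \<le> norm x * B"
      using norm_weighted_sum_le[of x] by (simp only: mult.commute)
  qed
  then show ?thesis unfolding weighted_operator_def by (rule bounded_linear_Blinfun_apply[THEN fun_cong])
qed

lemma weighted_operator_sums:
  "(\<lambda>n. s n *\<^sub>R cinner x (v n) *\<^sub>C u n) sums blinfun_apply (weighted_operator s v u) x"
  unfolding weighted_operator_apply using summable_weighted_operator by (rule summable_sums)

lemma norm_weighted_operator_le: "norm (blinfun_apply (weighted_operator s v u) x) \<le> B * norm x"
  unfolding weighted_operator_apply by (rule norm_weighted_sum_le)

lemma weighted_operator_bounded: "weighted_operator s v u \<in> bounded_operators"
proof -
  have "blinfun_apply (weighted_operator s v u) (c *\<^sub>C x) = c *\<^sub>C blinfun_apply (weighted_operator s v u) x" for c x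
  proof -
    have "s n *\<^sub>R cinner (c *\<^sub>C x) (v n) *\<^sub>C u n = c *\<^sub>C (s n *\<^sub>R cinner x (v n) *\<^sub>C u n)" for n
      by (simp add: cinner_scaleC_left scaleR_scaleC scaleC_scaleC mult.left_commute)
    then show ?thesis
      using bounded_linear.sums[OF bounded_linear_scaleC_right[of c] weighted_operator_sums[of x]]
        weighted_operator_sums[of "c *\<^sub>C x"] by (simp only: sums_unique2)
  qed
  then show ?thesis unfolding bounded_operators_def by blast
qed

lemma cinner_weighted_operator:
  "cinner (blinfun_apply (weighted_operator s v u) x) (u n) = (if u n = 0 then 0 else of_real (s n) * cinner x (v n))"
proof -
  have "(\<lambda>k. cinner (s k *\<^sub>R cinner x (v k) *\<^sub>C u k) (u n)) sums cinner (blinfun_apply (weighted_operator s v u) x) (u n)"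
    by (rule bounded_linear.sums[OF bounded_linear_cinner_left weighted_operator_sums])
  moreover have "(\<lambda>k. cinner (s k *\<^sub>R cinner x (v k) *\<^sub>C u k) (u n))
      = (\<lambda>k. if k = n then (if u n = 0 then 0 else of_real (s n) * cinner x (v n)) else 0)"
    by (auto simp: fun_eq_iff cinner_linear_simps cinner_partial_orthonormal[OF u])
  ultimately show ?thesis
    using sums_single[of n "\<lambda>_. if u n = 0 then 0 else of_real (s n) * cinner x (v n)"] by (simp only: sums_unique2)
qed

end

lemma weighted_operator_adjoint:
  assumes v: "partial_orthonormal v" and u: "partial_orthonormal u" and B: "\<forall>n. \<bar>s n\<bar> \<le> B"
  shows "cinner (blinfun_apply (weighted_operator s v u) x) y = cinner x (blinfun_apply (weighted_operator s u v) y)"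
proof -
  have "(\<lambda>n. cinner (s n *\<^sub>R cinner x (v n) *\<^sub>C u n) y) sums cinner (blinfun_apply (weighted_operator s v u) x) y"
    by (rule bounded_linear.sums[OF bounded_linear_cinner_left weighted_operator_sums[OF assms]])
  moreover have "(\<lambda>n. cinner x (s n *\<^sub>R cinner y (u n) *\<^sub>C v n)) sums cinner x (blinfun_apply (weighted_operator s u v) y)"
    by (rule bounded_linear.sums[OF bounded_linear_cinner_right weighted_operator_sums[OF u v B]])
  moreover have "cinner (s n *\<^sub>R cinner x (v n) *\<^sub>C u n) y = cinner x (s n *\<^sub>R cinner y (u n) *\<^sub>C v n)" for n
    by (simp add: cinner_linear_simps cinner_commute[of y])
  ultimately show ?thesis by (simp add: sums_unique2)
qed

text \<open>Exchanging the two families of vectors gives the adjoint. Through the singular value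
  decomposition this resolves the definite description for every compact operator, without an appeal
  to Riesz representation.\<close>

lemma hilbert_adjoint_weighted_operator:
  assumes v: "partial_orthonormal v" and u: "partial_orthonormal u" and B: "\<forall>n. \<bar>s n\<bar> \<le> B"
  shows "hilbert_adjoint (weighted_operator s v u) = weighted_operator s u v"
  unfolding hilbert_adjoint_def
proof (rule the_equality)
  show "weighted_operator s u v \<in> bounded_operators \<and>
     (\<forall>x y. cinner (blinfun_apply (weighted_operator s v u) x) y = cinner x (blinfun_apply (weighted_operator s u v) y))"
    using weighted_operator_bounded[OF u v B] weighted_operator_adjoint[OF assms] by blast
  fix Y assume Y: "Y \<in> bounded_operators \<and> (\<forall>x y. cinner (blinfun_apply (weighted_operator s v u) x) y = cinner x (blinfun_apply Y y))"
  show "Y = weighted_operator s u v"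
  proof (rule blinfun_eqI, rule cinner_eqI)
    fix y z
    show "cinner (blinfun_apply Y y) z = cinner (blinfun_apply (weighted_operator s u v) y) z"
      using Y weighted_operator_adjoint[OF assms, of z y] by (metis cinner_commute)
  qed
qed

text \<open>A zero vector \<open>v n\<close> in the middle annihilates the \<open>n\<close>-th term
  whatever the weights are, hence the two cases for \<open>r\<close>. With constant weights 1 on one
  side, the lemma moves a weighted operator from one family of vectors to another.\<close>

lemma weighted_operator_compose:
  assumes "partial_orthonormal v" "partial_orthonormal u" "partial_orthonormal w"
    and s: "\<forall>n. \<bar>s n\<bar> \<le> B" and t: "\<forall>n. \<bar>t n\<bar> \<le> C"
    and r: "\<And>n. v n = 0 \<Longrightarrow> r n = 0" "\<And>n. v n \<noteq> 0 \<Longrightarrow> r n = s n * t n"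
  shows "weighted_operator s v u o\<^sub>L weighted_operator t w v = weighted_operator r w u"
proof (rule blinfun_eqI)
  fix x
  have "\<bar>r n\<bar> \<le> B * C" for n
    using r[of n] s[rule_format, of n] t[rule_format, of n] by (cases "v n = 0") (auto simp: abs_mult intro!: mult_mono)
  then have "\<forall>n. \<bar>r n\<bar> \<le> B * C" ..
  note sums_r = weighted_operator_sums[OF assms(3,2) this]
  have "s n *\<^sub>R cinner (blinfun_apply (weighted_operator t w v) x) (v n) *\<^sub>C u n = r n *\<^sub>R cinner x (w n) *\<^sub>C u n" for n
    using r[of n] cinner_weighted_operator[OF assms(3,1) t, of x n]
    by (auto simp: scaleR_scaleC scaleC_scaleC ac_simps)
  with weighted_operator_sums[OF assms(1,2) s, of "blinfun_apply (weighted_operator t w v) x"] sums_r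
  show "blinfun_apply (weighted_operator s v u o\<^sub>L weighted_operator t w v) x = blinfun_apply (weighted_operator r w u) x"
    by (simp add: sums_unique2)
qed

section \<open>Compact operators: closure under sums, products and norm limits\<close>

lemma compact_operatorsI:
  assumes "T \<in> bounded_operators" "compact K" "\<And>x. norm x \<le> 1 \<Longrightarrow> blinfun_apply T x \<in> K"
  shows "T \<in> compact_operators"
proof -
  have "blinfun_apply T ` cball 0 1 \<subseteq> K" using assms(3) by auto
  then have "closure (blinfun_apply T ` cball 0 1) \<subseteq> K"
    using assms(2) by (simp add: closure_minimal compact_imp_closed)
  then have "compact (closure (blinfun_apply T ` cball 0 1))"
    using compact_Int_closed[OF assms(2) closed_closure, of "blinfun_apply T ` cball 0 1"] by (simp add: Int_absorb1)
  then show ?thesis unfolding compact_operators_def using assms(1) by simp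
qed

lemma compact_operatorsE:
  assumes "T \<in> compact_operators"
  obtains K where "compact K" "\<And>x. norm x \<le> 1 \<Longrightarrow> blinfun_apply T x \<in> K" "T \<in> bounded_operators"
proof
  show "compact (closure (blinfun_apply T ` cball 0 1))" "T \<in> bounded_operators"
    using assms unfolding compact_operators_def by auto
  show "blinfun_apply T x \<in> closure (blinfun_apply T ` cball 0 1)" if "norm x \<le> 1" for x
    using that closure_subset by fastforce
qed

lemma compact_operators_add:
  assumes "S \<in> compact_operators" "T \<in> compact_operators"
  shows "S + T \<in> compact_operators"
proof -
  obtain K where K: "compact K" "\<And>x. norm x \<le> 1 \<Longrightarrow> blinfun_apply S x \<in> K" "S \<in> bounded_operators"
    using assms(1) compact_operatorsE by blast
  obtain L where L: "compact L" "\<And>x. norm x \<le> 1 \<Longrightarrow> blinfun_apply T x \<in> L" "T \<in> bounded_operators"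
    using assms(2) compact_operatorsE by blast
  have "compact {x + y |x y. x \<in> K \<and> y \<in> L}" using compact_sums K(1) L(1) by auto
  then show ?thesis
    by (rule compact_operatorsI[rotated]) (use K L bounded_operators_add in \<open>auto simp: blinfun.add_left\<close>)
qed

lemma compact_operators_compose_left:
  assumes "A \<in> bounded_operators" "T \<in> compact_operators"
  shows "A o\<^sub>L T \<in> compact_operators"
proof -
  obtain K where K: "compact K" "\<And>x. norm x \<le> 1 \<Longrightarrow> blinfun_apply T x \<in> K" "T \<in> bounded_operators"
    using assms(2) compact_operatorsE by blast
  have "compact (blinfun_apply A ` K)"
    by (intro compact_continuous_image K) (simp add: linear_continuous_on bounded_linear_blinfun_apply bounded_linear_ident)
  then show ?thesis
    by (rule compact_operatorsI[rotated]) (use K assms bounded_operators_compose in auto)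
qed

lemma compact_operators_compose_right:
  assumes "A \<in> bounded_operators" "T \<in> compact_operators"
  shows "T o\<^sub>L A \<in> compact_operators"
proof -
  obtain K where K: "compact K" "\<And>x. norm x \<le> 1 \<Longrightarrow> blinfun_apply T x \<in> K" "T \<in> bounded_operators"
    using assms(2) compact_operatorsE by blast
  \<comment> \<open>Rescaling by \<open>r\<close> brings \<open>A x\<close> back into the unit ball;
    the summand 1 keeps \<open>r\<close> positive when \<open>A = 0\<close>.\<close>
  define r where "r = norm A + 1"
  have "r > 0" unfolding r_def by (simp add: add_nonneg_pos)
  have "compact ((\<lambda>x. r *\<^sub>R x) ` K)" using K(1) by (rule compact_scaling)
  moreover have "blinfun_apply (T o\<^sub>L A) x \<in> (\<lambda>x. r *\<^sub>R x) ` K" if "norm x \<le> 1" for x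
  proof
    have "norm (blinfun_apply A x) \<le> norm A * norm x" by (rule norm_blinfun)
    also have "\<dots> \<le> r" using that unfolding r_def
      by (metis add_increasing2 mult_left_le norm_ge_zero zero_le_one)
    finally have "norm ((1 / r) *\<^sub>R blinfun_apply A x) \<le> 1" using \<open>r > 0\<close> by simp
    then show "blinfun_apply T ((1 / r) *\<^sub>R blinfun_apply A x) \<in> K" by (rule K)
    show "blinfun_apply (T o\<^sub>L A) x = r *\<^sub>R blinfun_apply T ((1 / r) *\<^sub>R blinfun_apply A x)"
      using \<open>r > 0\<close> by (simp add: blinfun.scaleR_right)
  qed
  ultimately show ?thesis
    using compact_operatorsI K(3) assms(1) bounded_operators_compose by blast
qed

lemma compact_operators_limit:
  assumes T: "T \<in> bounded_operators"
    and approx: "\<And>\<epsilon>. 0 < \<epsilon> \<Longrightarrow> \<exists>S\<in>compact_operators. \<forall>x. norm x \<le> 1 \<longrightarrow> norm (blinfun_apply T x - blinfun_apply S x) \<le> \<epsilon>"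
  shows "T \<in> compact_operators"
proof -
  have "\<exists>F. finite F \<and> closure (blinfun_apply T ` cball 0 1) \<subseteq> (\<Union>x\<in>F. ball x \<epsilon>)" if "\<epsilon> > 0" for \<epsilon>
  proof -
    from that have "\<epsilon> / 4 > 0" by simp
    from approx[OF this] obtain S where S: "S \<in> compact_operators"
      "\<And>x. norm x \<le> 1 \<Longrightarrow> norm (blinfun_apply T x - blinfun_apply S x) \<le> \<epsilon> / 4" by blast
    obtain K where K: "compact K" "\<And>x. norm x \<le> 1 \<Longrightarrow> blinfun_apply S x \<in> K"
      using S(1) compact_operatorsE by blast
    obtain F where F: "finite F" "K \<subseteq> (\<Union>x\<in>F. ball x (\<epsilon> / 4))"
      using K(1) \<open>\<epsilon> / 4 > 0\<close> unfolding compact_eq_totally_bounded by blast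
    \<comment> \<open>Closed balls of half the radius let the covering pass to the closure before it
      is enlarged to open balls of radius \<epsilon>.\<close>
    have "blinfun_apply T ` cball 0 1 \<subseteq> (\<Union>x\<in>F. cball x (\<epsilon> / 2))"
    proof safe
      fix x :: 'a assume "x \<in> cball 0 1"
      then have x: "norm x \<le> 1" by simp
      then obtain y where y: "y \<in> F" "dist y (blinfun_apply S x) < \<epsilon> / 4" using K(2) F(2) by force
      have "dist y (blinfun_apply T x) \<le> dist y (blinfun_apply S x) + dist (blinfun_apply S x) (blinfun_apply T x)"
        by (rule dist_triangle)
      also have "\<dots> \<le> \<epsilon> / 2" using y(2) S(2)[OF x] by (simp add: dist_norm norm_minus_commute)
      finally show "blinfun_apply T x \<in> (\<Union>x\<in>F. cball x (\<epsilon> / 2))" using y(1) by auto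
    qed
    then have "closure (blinfun_apply T ` cball 0 1) \<subseteq> (\<Union>x\<in>F. cball x (\<epsilon> / 2))"
      by (rule closure_minimal) (intro closed_UN F(1) ballI closed_cball)
    also have "\<dots> \<subseteq> (\<Union>x\<in>F. ball x \<epsilon>)" using that by (intro UN_mono) auto
    finally show ?thesis using F(1) by blast
  qed
  then have "compact (closure (blinfun_apply T ` cball 0 1))"
    unfolding compact_eq_totally_bounded by (simp add: complete_eq_closed)
  then show ?thesis unfolding compact_operators_def using T by simp
qed

lemma zero_compact_operator: "0 \<in> compact_operators"
  by (rule compact_operatorsI[OF bounded_operators_zero, of "{0}"]) auto

lemma operator_ideal_compact_operators: "operator_ideal compact_operators"
  unfolding operator_ideal_def
  using zero_compact_operator compact_operators_add compact_operators_compose_left compact_operators_compose_right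
  by blast

section \<open>Rank-one operators and compactness of weighted operators\<close>

definition rank_one :: "'a \<Rightarrow> 'a \<Rightarrow> ('a::complex_hilbert_space \<Rightarrow>\<^sub>L 'a)" where
  "rank_one v u = Blinfun (\<lambda>x. cinner x v *\<^sub>C u)"

lemma rank_one_apply [simp]: "blinfun_apply (rank_one v u) x = cinner x v *\<^sub>C u"
  unfolding rank_one_def
  by (subst bounded_linear_Blinfun_apply)
     (rule bounded_linear_compose[OF bounded_linear_scaleC_left bounded_linear_cinner_left], rule refl)

lemma rank_one_bounded: "rank_one v u \<in> bounded_operators"
  unfolding bounded_operators_def by (simp add: cinner_scaleC_left scaleC_scaleC)

lemma rank_one_compact: "rank_one v u \<in> compact_operators"
proof (rule compact_operatorsI[OF rank_one_bounded])
  show "compact ((\<lambda>c. c *\<^sub>C u) ` cball 0 (norm v))"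
    by (intro compact_continuous_image compact_cball linear_continuous_on bounded_linear_scaleC_left)
  fix x :: 'a assume "norm x \<le> 1"
  then have "cmod (cinner x v) \<le> norm v"
    using Cauchy_Schwarz[of x v] by (smt (verit) mult_left_le_one_le norm_ge_zero)
  then show "blinfun_apply (rank_one v u) x \<in> (\<lambda>c. c *\<^sub>C u) ` cball 0 (norm v)"
    by (intro image_eqI[of _ _ "cinner x v"]) auto
qed

lemma weighted_operator_finite_compact:
  assumes "partial_orthonormal v" "partial_orthonormal u"
  shows "weighted_operator (\<lambda>n. if n < k then s n else 0) v u \<in> compact_operators"
proof (induction k)
  case 0
  have "weighted_operator (\<lambda>n. if n < 0 then s n else 0) v u = 0"
    by (rule blinfun_eqI) (simp add: weighted_operator_apply[OF assms, of _ 0])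
  then show ?case using zero_compact_operator by simp
next
  case (Suc k)
  let ?T = "\<lambda>k. weighted_operator (\<lambda>n. if n < k then s n else 0) v u"
  let ?R = "rank_one (v k) (s k *\<^sub>R u k)"
  have b: "\<forall>n. \<bar>if n < k then s n else 0\<bar> \<le> (\<Sum>i<k. \<bar>s i\<bar>)" for k
    using member_le_sum[of _ "{..<k}" "\<lambda>i. \<bar>s i\<bar>"] by (auto intro: sum_nonneg)
  have "?T (Suc k) = ?T k + ?R"
  proof (rule blinfun_eqI)
    fix x
    have "(\<lambda>n. (if n < k then s n else 0) *\<^sub>R cinner x (v n) *\<^sub>C u n + (if n = k then blinfun_apply ?R x else 0))
        sums (blinfun_apply (?T k) x + blinfun_apply ?R x)"
      using sums_add[OF weighted_operator_sums[OF assms b] sums_single[of k "\<lambda>_. blinfun_apply ?R x"]] by simp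
    moreover have "(\<lambda>n. (if n < k then s n else 0) *\<^sub>R cinner x (v n) *\<^sub>C u n + (if n = k then blinfun_apply ?R x else 0))
       = (\<lambda>n. (if n < Suc k then s n else 0) *\<^sub>R cinner x (v n) *\<^sub>C u n)"
      by (auto simp: scaleR_scaleC scaleC_scaleC mult.commute)
    ultimately show "blinfun_apply (?T (Suc k)) x = blinfun_apply (?T k + ?R) x"
      using weighted_operator_sums[OF assms b[of "Suc k"], of x] by (simp add: sums_unique2 blinfun.add_left)
  qed
  moreover have "?R \<in> compact_operators" by (rule rank_one_compact)
  ultimately show ?case using Suc compact_operators_add by simp
qed

lemma c0_star_le: "s \<in> c0_star \<Longrightarrow> \<forall>n. \<bar>s n\<bar> \<le> s 0"
  unfolding c0_star_def by (auto simp: decseq_def)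

text \<open>Cutting off after \<open>k\<close> terms leaves a weighted operator with weights at most
  \<open>s k\<close>, hence of norm at most \<open>s k\<close>. The operator is therefore a norm
  limit of finite sums of rank-one operators.\<close>

lemma weighted_operator_compact:
  assumes s: "s \<in> c0_star" and vu: "partial_orthonormal v" "partial_orthonormal u"
  shows "weighted_operator s v u \<in> compact_operators"
proof (rule compact_operators_limit)
  note sb = c0_star_le[OF s]
  show "weighted_operator s v u \<in> bounded_operators" by (rule weighted_operator_bounded[OF vu sb])
  fix \<epsilon> :: real assume "\<epsilon> > 0"
  then obtain k where k: "s k < \<epsilon>"
    using s unfolding c0_star_def by (metis (mono_tags, lifting) mem_Collect_eq order_tendstoD(2) eventually_happens' sequentially_bot)
  let ?S = "weighted_operator (\<lambda>n. if n < k then s n else 0) v u"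
  have b: "\<forall>n. \<bar>if n < k then s n else 0\<bar> \<le> s 0" using sb by auto
  have b': "\<forall>n. \<bar>if n < k then 0 else s n\<bar> \<le> s k" using s unfolding c0_star_def by (auto simp: decseq_def)
  have "norm (blinfun_apply (weighted_operator s v u) x - blinfun_apply ?S x) \<le> \<epsilon>" if "norm x \<le> 1" for x
  proof -
    have "(\<lambda>n. s n *\<^sub>R cinner x (v n) *\<^sub>C u n - (if n < k then s n else 0) *\<^sub>R cinner x (v n) *\<^sub>C u n)
       sums (blinfun_apply (weighted_operator s v u) x - blinfun_apply ?S x)"
      by (intro sums_diff weighted_operator_sums[OF vu sb] weighted_operator_sums[OF vu b])
    moreover have "(\<lambda>n. s n *\<^sub>R cinner x (v n) *\<^sub>C u n - (if n < k then s n else 0) *\<^sub>R cinner x (v n) *\<^sub>C u n)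
       = (\<lambda>n. (if n < k then 0 else s n) *\<^sub>R cinner x (v n) *\<^sub>C u n)" by auto
    ultimately have "blinfun_apply (weighted_operator s v u) x - blinfun_apply ?S x
       = blinfun_apply (weighted_operator (\<lambda>n. if n < k then 0 else s n) v u) x"
      using weighted_operator_sums[OF vu b', of x] by (simp add: sums_unique2)
    also have "norm \<dots> \<le> s k * norm x" by (rule norm_weighted_operator_le[OF vu b'])
    also have "\<dots> \<le> \<epsilon>" using k that sb[rule_format, of k] b' by (smt (verit) abs_ge_zero mult_left_le)
    finally show ?thesis .
  qed
  then show "\<exists>S\<in>compact_operators. \<forall>x. norm x \<le> 1 \<longrightarrow> norm (blinfun_apply (weighted_operator s v u) x - blinfun_apply S x) \<le> \<epsilon>"
    using weighted_operator_finite_compact[OF vu] by blast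
qed

section \<open>Singular value decomposition of compact operators\<close>

lemma compact_operator_bounded: "X \<in> compact_operators \<Longrightarrow> X \<in> bounded_operators"
  unfolding compact_operators_def by simp

lemma blinfun_norm_approx:
  fixes X :: "'a::real_normed_vector \<Rightarrow>\<^sub>L 'b::real_normed_vector"
  assumes "X \<noteq> 0" "\<delta> > 0"
  obtains x where "norm x = 1" "norm (blinfun_apply X x) > norm X - \<delta>"
proof -
  have "norm X > 0" using assms by simp
  then have "max 0 (norm X - \<delta>) < norm X" using assms(2) by simp
  then obtain x where x: "norm (blinfun_apply X x) > max 0 (norm X - \<delta>) * norm x"
    using norm_blinfun_bound[of "max 0 (norm X - \<delta>)" X] by (meson linorder_not_le max.cobounded1)
  then have "norm x > 0" by (cases "x = 0") auto
  show thesis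
  proof
    show "norm ((1 / norm x) *\<^sub>R x) = 1" using \<open>norm x > 0\<close> by simp
    have "max 0 (norm X - \<delta>) < norm (blinfun_apply X x) / norm x"
      using x \<open>norm x > 0\<close> by (simp only: pos_less_divide_eq)
    then have "norm X - \<delta> < norm (blinfun_apply X x) / norm x" by linarith
    then show "norm (blinfun_apply X ((1 / norm x) *\<^sub>R x)) > norm X - \<delta>"
      by (simp add: blinfun.scaleR_right)
  qed
qed

text \<open>If the images of a maximising sequence of unit vectors converge, the parallelogram law makes the
  sequence itself converge.\<close>
lemma compact_operator_norm_attained:
  assumes X: "X \<in> compact_operators" "X \<noteq> 0"
  shows "\<exists>v. norm v = 1 \<and> norm (blinfun_apply X v) = norm X"
proof -
  let ?N = "norm X"
  have N: "?N > 0" using X by simp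
  have "\<exists>x. norm x = 1 \<and> norm (blinfun_apply X x) > ?N - inverse (real (Suc n))" for n
    using blinfun_norm_approx[OF X(2), of "inverse (real (Suc n))"] by (metis inverse_positive_iff_positive of_nat_0_less_iff zero_less_Suc)
  then obtain x where x: "\<And>n. norm (x n) = 1" "\<And>n. norm (blinfun_apply X (x n)) > ?N - inverse (real (Suc n))"
    by metis
  have lim: "(\<lambda>n. norm (blinfun_apply X (x n))) \<longlonglongrightarrow> ?N"
  proof (rule tendsto_sandwich)
    show "\<forall>\<^sub>F n in sequentially. ?N - inverse (real (Suc n)) \<le> norm (blinfun_apply X (x n))"
      using x(2) by (simp add: less_imp_le)
    show "\<forall>\<^sub>F n in sequentially. norm (blinfun_apply X (x n)) \<le> ?N"
      using norm_blinfun[of X] x(1) by (metis (mono_tags, lifting) eventuallyI mult.right_neutral)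
    show "(\<lambda>n. ?N - inverse (real (Suc n))) \<longlonglongrightarrow> ?N"
      using tendsto_diff[OF tendsto_const LIMSEQ_inverse_real_of_nat] by simp
  qed simp
  obtain K where K: "compact K" "\<And>x. norm x \<le> 1 \<Longrightarrow> blinfun_apply X x \<in> K"
    using compact_operatorsE[OF X(1)] by blast
  then have "\<forall>n. blinfun_apply X (x n) \<in> K" using x(1) by simp
  then obtain y r where r: "strict_mono (r::nat\<Rightarrow>nat)" "((\<lambda>n. blinfun_apply X (x n)) \<circ> r) \<longlonglongrightarrow> y"
    using K(1) unfolding compact_def by meson
  define z where "z = x \<circ> r"
  have Xz: "(\<lambda>n. blinfun_apply X (z n)) \<longlonglongrightarrow> y" using r(2) by (simp add: z_def o_def)
  have z: "norm (z n) = 1" for n using x(1) by (simp add: z_def)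
  have "norm y = ?N"
    using tendsto_norm[OF Xz] LIMSEQ_subseq_LIMSEQ[OF lim r(1)] by (simp add: z_def o_def LIMSEQ_unique)
  have "Cauchy z"
  proof (rule metric_CauchyI)
    fix \<epsilon> :: real assume "\<epsilon> > 0"
    \<comment> \<open>If both images are within \<open>t * ?N\<close> of \<open>y\<close>, then
      \<open>norm (z m + z n)\<close> is at least \<open>2 - 2 * t\<close>, and the parallelogram
      law leaves at most \<open>8 * t\<close> for the square of \<open>norm (z m - z n)\<close>. The
      bound 1/2 keeps \<open>2 - 2 * t\<close> nonnegative when it is squared.\<close>
    define t where "t = min (1/2) (\<epsilon>\<^sup>2 / 16)"
    have t: "0 < t" "t \<le> 1/2" "t \<le> \<epsilon>\<^sup>2 / 16" using \<open>\<epsilon> > 0\<close> by (auto simp: t_def)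
    then have "t * ?N > 0" using N by simp
    then obtain M where M: "\<And>n. n \<ge> M \<Longrightarrow> norm (blinfun_apply X (z n) - y) < t * ?N"
      using LIMSEQ_D[OF Xz] by blast
    have "dist (z m) (z n) < \<epsilon>" if "m \<ge> M" "n \<ge> M" for m n
    proof -
      have "norm (2 *\<^sub>R y) \<le> norm (blinfun_apply X (z m + z n))
          + (norm (blinfun_apply X (z m) - y) + norm (blinfun_apply X (z n) - y))"
      proof -
        have "2 *\<^sub>R y = blinfun_apply X (z m + z n) - ((blinfun_apply X (z m) - y) + (blinfun_apply X (z n) - y))"
          by (simp add: blinfun.add_right scaleR_2)
        then show ?thesis by (metis (no_types, lifting) norm_triangle_ineq4 norm_triangle_ineq add_left_mono order_trans)
      qed
      moreover have "norm (blinfun_apply X (z m + z n)) \<le> ?N * norm (z m + z n)" by (rule norm_blinfun)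
      ultimately have "2 * ?N \<le> ?N * norm (z m + z n) + 2 * (t * ?N)"
        using M[OF that(1)] M[OF that(2)] \<open>norm y = ?N\<close> by simp
      then have "?N * (2 - 2 * t) \<le> ?N * norm (z m + z n)" by (simp add: algebra_simps)
      then have "2 - 2 * t \<le> norm (z m + z n)" using N by (simp only: mult_le_cancel_left_pos)
      then have "(2 - 2 * t)\<^sup>2 \<le> (norm (z m + z n))\<^sup>2" using t by (intro power_mono) auto
      moreover have "(norm (z m + z n))\<^sup>2 + (norm (z m - z n))\<^sup>2 = 4"
        using parallelogram_law[of "z m" "z n"] z by simp
      moreover have "(2 - 2 * t)\<^sup>2 \<ge> 4 - 8 * t" by (simp add: power2_eq_square algebra_simps)
      moreover have "8 * t < \<epsilon>\<^sup>2" using t(3) zero_less_power[OF \<open>\<epsilon> > 0\<close>, of 2] by linarith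
      ultimately have "(norm (z m - z n))\<^sup>2 < \<epsilon>\<^sup>2" by linarith
      then show ?thesis using \<open>\<epsilon> > 0\<close> unfolding dist_norm by (simp add: power_less_imp_less_base)
    qed
    then show "\<exists>M. \<forall>m\<ge>M. \<forall>n\<ge>M. dist (z m) (z n) < \<epsilon>" by blast
  qed
  then obtain v where v: "z \<longlonglongrightarrow> v" using Cauchy_convergent convergent_def by blast
  have "norm v = 1" using tendsto_norm[OF v] z by (simp add: LIMSEQ_const_iff)
  moreover have "(\<lambda>n. blinfun_apply X (z n)) \<longlonglongrightarrow> blinfun_apply X v"
    using v by (intro tendsto_intros)
  then have "blinfun_apply X v = y" using Xz LIMSEQ_unique by blast
  ultimately show ?thesis using \<open>norm y = ?N\<close> by blast
qed

text \<open>In terms of the adjoint: \<open>v\<close> is an eigenvector of X*X for the eigenvalue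
  \<open>(norm X)\<^sup>2\<close>. The argument is variational. If \<open>w\<close> is orthogonal to
  \<open>v\<close> but the images are not orthogonal, moving \<open>v\<close> slightly in the
  direction of \<open>w\<close> gains to first order in the image and costs only to second order in
  the norm.\<close>

lemma cinner_norm_attaining:
  assumes X: "X \<in> bounded_operators" and v: "norm v = 1" "norm (blinfun_apply X v) = norm X"
  shows "cinner (blinfun_apply X w) (blinfun_apply X v) = of_real ((norm X)\<^sup>2) * cinner w v"
proof -
  let ?s = "norm X"
  have orth: "cinner (blinfun_apply X w) (blinfun_apply X v) = 0" if "cinner w v = 0" for w
  proof (rule ccontr)
    define c where "c = cinner (blinfun_apply X w) (blinfun_apply X v)"
    assume "\<not> ?thesis"
    then have "c \<noteq> 0" by (simp add: c_def)
    \<comment> \<open>With this \<open>r\<close> the second-order cost is at most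
      \<open>r * (cmod c)\<^sup>2\<close>, half of the first-order gain
      \<open>2 * r * (cmod c)\<^sup>2\<close>. The factor \<open>cnj c\<close> in \<open>a\<close>
      makes \<open>a * c\<close> real and nonnegative.\<close>
    define r where "r = 1 / (?s\<^sup>2 * (norm w)\<^sup>2 + 1)"
    have "r > 0" unfolding r_def by (simp add: add_nonneg_pos)
    define a where "a = of_real r * cnj c"
    have "norm (blinfun_apply X (v + a *\<^sub>C w)) \<le> ?s * norm (v + a *\<^sub>C w)" by (rule norm_blinfun)
    then have "(norm (blinfun_apply X (v + a *\<^sub>C w)))\<^sup>2 \<le> ?s\<^sup>2 * (norm (v + a *\<^sub>C w))\<^sup>2"
      by (metis norm_ge_zero power_mono power_mult_distrib)
    also have "cinner v (a *\<^sub>C w) = 0"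
      using that by (metis cinner_commute cinner_scaleC_right complex_cnj_zero mult_zero_right)
    then have "(norm (v + a *\<^sub>C w))\<^sup>2 = 1 + (cmod a)\<^sup>2 * (norm w)\<^sup>2"
      by (simp add: norm_add_sq_orthogonal v power_mult_distrib)
    finally have "(norm (blinfun_apply X (v + a *\<^sub>C w)))\<^sup>2 \<le> ?s\<^sup>2 + (cmod a)\<^sup>2 * (?s\<^sup>2 * (norm w)\<^sup>2)"
      by (simp add: algebra_simps)
    moreover have "(norm (blinfun_apply X (v + a *\<^sub>C w)))\<^sup>2
        = ?s\<^sup>2 + (cmod a)\<^sup>2 * (norm (blinfun_apply X w))\<^sup>2 + 2 * Re (a * c)"
    proof -
      have "cinner (blinfun_apply X v) (blinfun_apply X w) = cnj c" unfolding c_def by (rule cinner_commute)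
      then have "(norm (blinfun_apply X v + a *\<^sub>C blinfun_apply X w))\<^sup>2
          = (norm (blinfun_apply X v))\<^sup>2 + (norm (a *\<^sub>C blinfun_apply X w))\<^sup>2 + 2 * Re (a * c)"
        unfolding norm_sq_eq_cinner
        by (simp add: cinner_linear_simps c_def[symmetric] algebra_simps)
      then show ?thesis
        by (simp add: blinfun.add_right bounded_operators_scaleC[OF X] v power_mult_distrib)
    qed
    moreover have "a * c = of_real (r * (cmod c)\<^sup>2)"
      unfolding a_def by (simp add: complex_norm_square mult.commute del: of_real_power)
    ultimately have "2 * (r * (cmod c)\<^sup>2) + (cmod a)\<^sup>2 * (norm (blinfun_apply X w))\<^sup>2 \<le> (cmod a)\<^sup>2 * (?s\<^sup>2 * (norm w)\<^sup>2)"
      by (simp del: of_real_mult of_real_power)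
    moreover have "(cmod a)\<^sup>2 = r * (r * (cmod c)\<^sup>2)"
      unfolding a_def by (simp add: norm_mult power_mult_distrib power2_eq_square)
    moreover have "(cmod a)\<^sup>2 * (norm (blinfun_apply X w))\<^sup>2 \<ge> 0" by simp
    ultimately have "2 * (r * (cmod c)\<^sup>2) \<le> (r * (cmod c)\<^sup>2) * (r * (?s\<^sup>2 * (norm w)\<^sup>2))"
      by (simp add: mult_ac)
    then have "2 * (r * (cmod c)\<^sup>2) \<le> (r * (cmod c)\<^sup>2) * 1"
    proof (rule order_trans)
      have "r * (?s\<^sup>2 * (norm w)\<^sup>2) \<le> 1" unfolding r_def by (simp add: divide_le_eq_1 add_nonneg_pos)
      then show "(r * (cmod c)\<^sup>2) * (r * (?s\<^sup>2 * (norm w)\<^sup>2)) \<le> (r * (cmod c)\<^sup>2) * 1"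
        using \<open>r > 0\<close> by (intro mult_left_mono) auto
    qed
    moreover have "r * (cmod c)\<^sup>2 > 0" using \<open>r > 0\<close> \<open>c \<noteq> 0\<close> by simp
    ultimately show False by linarith
  qed
  define w' where "w' = w - cinner w v *\<^sub>C v"
  have "cinner w' v = 0" by (simp add: w'_def cinner_linear_simps cinner_self v)
  moreover have "blinfun_apply X w' = blinfun_apply X w - cinner w v *\<^sub>C blinfun_apply X v"
    by (simp add: w'_def blinfun.diff_right bounded_operators_scaleC[OF X])
  ultimately have "cinner (blinfun_apply X w) (blinfun_apply X v)
      = cinner w v * cinner (blinfun_apply X v) (blinfun_apply X v)"
    using orth[of w'] by (simp add: cinner_linear_simps)
  then show ?thesis by (simp add: cinner_self v mult.commute)
qed

section \<open>Deflation: splitting off one singular value at a time\<close>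

definition top_right_vector :: "('a::complex_hilbert_space \<Rightarrow>\<^sub>L 'a) \<Rightarrow> 'a" where
  "top_right_vector X = (if X = 0 then 0 else (SOME v. norm v = 1 \<and> norm (blinfun_apply X v) = norm X))"

text \<open>For \<open>X = 0\<close> the right vector is zero by definition and this one is then
  zero as well. The iteration therefore continues past an exhausted operator with zero vectors, as
  \<open>partial_orthonormal\<close> permits.\<close>

definition top_left_vector :: "('a::complex_hilbert_space \<Rightarrow>\<^sub>L 'a) \<Rightarrow> 'a" where
  "top_left_vector X = (1 / norm X) *\<^sub>R blinfun_apply X (top_right_vector X)"

definition deflate :: "('a::complex_hilbert_space \<Rightarrow>\<^sub>L 'a) \<Rightarrow> ('a \<Rightarrow>\<^sub>L 'a)" where
  "deflate X = X - rank_one (top_right_vector X) (blinfun_apply X (top_right_vector X))"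

lemma top_right_vector_zero [simp]: "top_right_vector 0 = 0" by (simp add: top_right_vector_def)

lemma top_right_vector:
  assumes "X \<in> compact_operators" "X \<noteq> 0"
  shows "norm (top_right_vector X) = 1" "norm (blinfun_apply X (top_right_vector X)) = norm X"
  using someI_ex[OF compact_operator_norm_attained[OF assms]] assms(2) by (auto simp: top_right_vector_def)

lemma norm_scaleR_top_left: "norm X *\<^sub>R top_left_vector X = blinfun_apply X (top_right_vector X)"
  by (cases "X = 0") (auto simp: top_left_vector_def)

lemma norm_top_left: "X \<in> compact_operators \<Longrightarrow> X \<noteq> 0 \<Longrightarrow> norm (top_left_vector X) = 1"
  by (simp add: top_left_vector_def top_right_vector)

lemma deflate_apply: "blinfun_apply (deflate X) w = blinfun_apply X w - cinner w (top_right_vector X) *\<^sub>C blinfun_apply X (top_right_vector X)"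
  by (simp add: deflate_def blinfun.diff_left)

lemma deflate_zero: "deflate 0 = 0"
  by (rule blinfun_eqI) (simp add: deflate_apply)

lemma cinner_top_right_vector:
  assumes "X \<in> compact_operators"
  shows "cinner (blinfun_apply X w) (blinfun_apply X (top_right_vector X)) = of_real ((norm X)\<^sup>2) * cinner w (top_right_vector X)"
  using cinner_norm_attaining[OF compact_operator_bounded[OF assms] top_right_vector[OF assms]] by (cases "X = 0") auto

lemma deflate_compact:
  assumes "X \<in> compact_operators"
  shows "deflate X \<in> compact_operators"
proof -
  have "deflate X = X + rank_one (top_right_vector X) (- blinfun_apply X (top_right_vector X))"
    by (rule blinfun_eqI) (simp add: deflate_apply blinfun.add_left)
  then show ?thesis using compact_operators_add[OF assms rank_one_compact] by simp
qed

text \<open>The deflated operator is \<open>X\<close> after the orthogonal projection onto the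
  complement of the top right vector, and a projection does not increase norms.\<close>

lemma deflate_norm_le:
  assumes "X \<in> compact_operators"
  shows "norm (deflate X) \<le> norm X"
proof (cases "X = 0")
  case False
  let ?v = "top_right_vector X"
  note v = top_right_vector[OF assms False]
  show ?thesis
  proof (rule norm_blinfun_bound)
    fix w
    define w' where "w' = w - cinner w ?v *\<^sub>C ?v"
    have "cinner w' (cinner w ?v *\<^sub>C ?v) = 0" by (simp add: w'_def cinner_linear_simps cinner_self v)
    from norm_add_sq_orthogonal[OF this] have "(norm w')\<^sup>2 \<le> (norm w)\<^sup>2" by (simp add: w'_def)
    then have "norm w' \<le> norm w" by (rule power2_le_imp_le) simp
    have "blinfun_apply (deflate X) w = blinfun_apply X w'"
      by (simp add: deflate_apply w'_def blinfun.diff_right bounded_operators_scaleC[OF compact_operator_bounded[OF assms]])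
    then have "norm (blinfun_apply (deflate X) w) \<le> norm X * norm w'" by (simp add: norm_blinfun)
    also have "\<dots> \<le> norm X * norm w" using \<open>norm w' \<le> norm w\<close> by (simp add: mult_left_mono)
    finally show "norm (blinfun_apply (deflate X) w) \<le> norm X * norm w" .
  qed simp
qed (simp add: deflate_zero)

lemma deflate_top_right:
  assumes "X \<in> compact_operators"
  shows "blinfun_apply (deflate X) (top_right_vector X) = 0"
  using top_right_vector(1)[OF assms] by (cases "X = 0") (auto simp: deflate_apply cinner_self scaleC_one)

lemma deflate_orthogonal_top_left:
  assumes "X \<in> compact_operators"
  shows "cinner (blinfun_apply (deflate X) w) (top_left_vector X) = 0"
proof -
  have "cinner (blinfun_apply (deflate X) w) (blinfun_apply X (top_right_vector X)) = 0"
    using top_right_vector(2)[OF assms] cinner_top_right_vector[OF assms, of w]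
    by (cases "X = 0") (auto simp: deflate_apply cinner_linear_simps cinner_self)
  then show ?thesis by (simp add: top_left_vector_def cinner_scaleR_right)
qed

text \<open>For nonzero \<open>X\<close> the top right vector is an eigenvector of X*X for a nonzero
  eigenvalue, hence orthogonal to the kernel. Earlier right vectors lie in the kernel of every later
  deflation, and this makes the right vectors orthogonal to each other.\<close>

lemma kernel_orthogonal_top_right:
  assumes "X \<in> compact_operators" "blinfun_apply X a = 0"
  shows "cinner a (top_right_vector X) = 0"
  using cinner_top_right_vector[OF assms(1), of a] assms(2) by (cases "X = 0") auto

context
  fixes X :: "'a::complex_hilbert_space \<Rightarrow>\<^sub>L 'a"
  assumes X: "X \<in> compact_operators"
begin

abbreviation "deflation n \<equiv> (deflate ^^ n) X"

lemma deflation_compact: "deflation n \<in> compact_operators"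
  by (induction n) (auto simp: X deflate_compact)

text \<open>A vector that has been annihilated stays annihilated: it is orthogonal to the next top
  right vector, so the next rank-one correction does not see it.\<close>

lemma deflation_kernel: "i < j \<Longrightarrow> blinfun_apply (deflation j) (top_right_vector (deflation i)) = 0"
proof (induction j)
  case (Suc j)
  show ?case
  proof (cases "i = j")
    case True
    then show ?thesis by (simp add: deflate_top_right deflation_compact)
  next
    case False
    then have "blinfun_apply (deflation j) (top_right_vector (deflation i)) = 0" using Suc by simp
    then show ?thesis by (simp add: deflate_apply kernel_orthogonal_top_right[OF deflation_compact])
  qed
qed simp

lemma deflation_range: "i < j \<Longrightarrow> cinner (blinfun_apply (deflation j) w) (top_left_vector (deflation i)) = 0"
proof (induction j arbitrary: w)
  case (Suc j)
  show ?case
  proof (cases "i = j")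
    case True
    then show ?thesis by (simp add: deflate_orthogonal_top_left deflation_compact)
  next
    case False
    then show ?thesis using Suc by (simp add: deflate_apply cinner_linear_simps)
  qed
qed simp

lemma deflation_right_orthogonal: "i \<noteq> j \<Longrightarrow> cinner (top_right_vector (deflation i)) (top_right_vector (deflation j)) = 0"
proof -
  have *: "cinner (top_right_vector (deflation i)) (top_right_vector (deflation j)) = 0" if "i < j" for i j
    using deflation_kernel[OF that] by (rule kernel_orthogonal_top_right[OF deflation_compact])
  assume "i \<noteq> j"
  then show ?thesis using *[of i j] *[of j i] by (metis cinner_commute complex_cnj_zero linorder_neqE_nat)
qed

lemma deflation_left_orthogonal: "i \<noteq> j \<Longrightarrow> cinner (top_left_vector (deflation i)) (top_left_vector (deflation j)) = 0"
proof -
  have *: "cinner (top_left_vector (deflation j)) (top_left_vector (deflation i)) = 0" if "i < j" for i j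
    unfolding top_left_vector_def[of "deflation j"] using deflation_range[OF that] by (simp add: cinner_scaleR_left)
  assume "i \<noteq> j"
  then show ?thesis using *[of i j] *[of j i] by (metis cinner_commute complex_cnj_zero linorder_neqE_nat)
qed

lemma deflation_right_partial_orthonormal: "partial_orthonormal (\<lambda>n. top_right_vector (deflation n))"
  unfolding partial_orthonormal_def
  using deflation_right_orthogonal top_right_vector(1)[OF deflation_compact] top_right_vector_zero by metis

lemma deflation_left_partial_orthonormal: "partial_orthonormal (\<lambda>n. top_left_vector (deflation n))"
  unfolding partial_orthonormal_def
  using deflation_left_orthogonal norm_top_left[OF deflation_compact]
  by (metis blinfun.zero_left scaleR_zero_right top_left_vector_def)

lemma deflation_sum: "blinfun_apply X x - (\<Sum>i<n. norm (deflation i) *\<^sub>R cinner x (top_right_vector (deflation i)) *\<^sub>C top_left_vector (deflation i))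
   = blinfun_apply (deflation n) x"
proof (induction n)
  case (Suc n)
  have "norm (deflation n) *\<^sub>R cinner x (top_right_vector (deflation n)) *\<^sub>C top_left_vector (deflation n)
    = cinner x (top_right_vector (deflation n)) *\<^sub>C blinfun_apply (deflation n) (top_right_vector (deflation n))"
    unfolding norm_scaleR_top_left[symmetric] by (simp add: scaleR_scaleC scaleC_scaleC mult.commute)
  then show ?case using Suc by (simp add: deflate_apply algebra_simps)
qed simp

lemma deflation_norm_decseq: "decseq (\<lambda>n. norm (deflation n))"
  by (rule decseq_SucI) (simp add: deflate_norm_le deflation_compact)

lemma apply_deflation_right: "blinfun_apply X (top_right_vector (deflation n)) = norm (deflation n) *\<^sub>R top_left_vector (deflation n)"
proof -
  have "(\<Sum>i<n. norm (deflation i) *\<^sub>R cinner (top_right_vector (deflation n)) (top_right_vector (deflation i)) *\<^sub>C top_left_vector (deflation i)) = 0"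
    by (intro sum.neutral) (auto simp: deflation_right_orthogonal)
  then show ?thesis using deflation_sum[of "top_right_vector (deflation n)" n] by (simp add: norm_scaleR_top_left)
qed

text \<open>If the norms stayed above some \<open>L > 0\<close>, the images under \<open>X\<close>
  of the right vectors would be mutually orthogonal of norm at least \<open>L\<close>. Their
  pairwise distances would be at least \<open>L\<close>, so no subsequence could converge, against
  compactness.\<close>

lemma deflation_norm_c0: "(\<lambda>n. norm (deflation n)) \<in> c0_star"
proof -
  let ?s = "\<lambda>n. norm (deflation n)" and ?v = "\<lambda>n. top_right_vector (deflation n)" and ?u = "\<lambda>n. top_left_vector (deflation n)"
  obtain L where L: "?s \<longlonglongrightarrow> L" "\<And>n. L \<le> ?s n"
    using decseq_convergent[OF deflation_norm_decseq, of 0] by auto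
  have "L = 0"
  proof (rule ccontr)
    assume "L \<noteq> 0"
    moreover have "L \<ge> 0" using L(1) by (rule LIMSEQ_le_const) auto
    ultimately have "L > 0" by simp
    then have nz: "deflation n \<noteq> 0" for n using L(2)[of n] by (metis norm_zero not_le)
    obtain K where K: "compact K" "\<And>x. norm x \<le> 1 \<Longrightarrow> blinfun_apply X x \<in> K"
      using compact_operatorsE[OF X] by blast
    have "\<forall>n. blinfun_apply X (?v n) \<in> K"
      using top_right_vector(1)[OF deflation_compact nz] by (simp add: K(2))
    then obtain y r where r: "strict_mono (r::nat\<Rightarrow>nat)" "((\<lambda>n. blinfun_apply X (?v n)) \<circ> r) \<longlonglongrightarrow> y"
      using K(1) unfolding compact_def by meson
    then have "Cauchy ((\<lambda>n. blinfun_apply X (?v n)) \<circ> r)" using LIMSEQ_imp_Cauchy by blast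
    then obtain M where M: "\<And>m n. m \<ge> M \<Longrightarrow> n \<ge> M \<Longrightarrow> dist (blinfun_apply X (?v (r m))) (blinfun_apply X (?v (r n))) < L"
      using \<open>L > 0\<close> unfolding Cauchy_def o_def by meson
    define i where "i = r M" define j where "j = r (Suc M)"
    have "i \<noteq> j" using r(1) by (simp add: i_def j_def strict_mono_eq)
    then have "cinner (?s i *\<^sub>R ?u i) (- (?s j *\<^sub>R ?u j)) = 0"
      by (simp add: cinner_minus_right cinner_linear_simps deflation_left_orthogonal)
    from norm_add_sq_orthogonal[OF this] have "(norm (?s i *\<^sub>R ?u i - ?s j *\<^sub>R ?u j))\<^sup>2 = (?s i)\<^sup>2 + (?s j)\<^sup>2"
      by (simp add: norm_top_left deflation_compact nz)
    then have "(?s i)\<^sup>2 \<le> (norm (?s i *\<^sub>R ?u i - ?s j *\<^sub>R ?u j))\<^sup>2" by simp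
    then have "?s i \<le> norm (?s i *\<^sub>R ?u i - ?s j *\<^sub>R ?u j)" by (rule power2_le_imp_le) simp
    moreover have "norm (?s i *\<^sub>R ?u i - ?s j *\<^sub>R ?u j) < L"
      using M[of M "Suc M"] unfolding apply_deflation_right dist_norm i_def j_def by simp
    ultimately show False using L(2)[of i] by simp
  qed
  then show ?thesis using L deflation_norm_decseq unfolding c0_star_def by simp
qed

end

text \<open>Since the vectors vanish exactly where \<open>s\<close> does, the indices with
  \<open>s n = t > 0\<close> correspond to linearly independent vectors, and eigenspace dimensions
  can be read off by counting indices.\<close>

definition svd where
  "svd X s v u \<longleftrightarrow> s \<in> c0_star \<and> partial_orthonormal v \<and> partial_orthonormal u
     \<and> (\<forall>n. s n = 0 \<longleftrightarrow> v n = 0) \<and> (\<forall>n. s n = 0 \<longleftrightarrow> u n = 0) \<and> X = weighted_operator s v u"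

text \<open>The remainder after \<open>n\<close> terms of the series is the \<open>n\<close>-th
  deflation, whose norm is the \<open>n\<close>-th singular value and tends to zero.\<close>

lemma svd_exists:
  assumes X: "X \<in> compact_operators"
  shows "\<exists>s v u. svd X s v u"
proof -
  let ?s = "\<lambda>n. norm ((deflate ^^ n) X)" and ?v = "\<lambda>n. top_right_vector ((deflate ^^ n) X)"
    and ?u = "\<lambda>n. top_left_vector ((deflate ^^ n) X)"
  note v = deflation_right_partial_orthonormal[OF X] and u = deflation_left_partial_orthonormal[OF X]
    and s = deflation_norm_c0[OF X]
  have "X = weighted_operator ?s ?v ?u"
  proof (rule blinfun_eqI)
    fix x
    have "(\<lambda>n. blinfun_apply ((deflate ^^ n) X) x) \<longlonglongrightarrow> 0"
    proof (rule Lim_null_comparison)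
      show "\<forall>\<^sub>F n in sequentially. norm (blinfun_apply ((deflate ^^ n) X) x) \<le> ?s n * norm x"
        by (simp add: norm_blinfun)
      show "(\<lambda>n. ?s n * norm x) \<longlonglongrightarrow> 0" using s unfolding c0_star_def by (auto intro: tendsto_mult_left_zero)
    qed
    then have "(\<lambda>n. blinfun_apply X x - blinfun_apply ((deflate ^^ n) X) x) \<longlonglongrightarrow> blinfun_apply X x - 0"
      by (intro tendsto_diff tendsto_const)
    moreover have "blinfun_apply X x - blinfun_apply ((deflate ^^ n) X) x = (\<Sum>i<n. ?s i *\<^sub>R cinner x (?v i) *\<^sub>C ?u i)" for n
      unfolding deflation_sum[OF X, symmetric] by simp
    ultimately have "(\<lambda>i. ?s i *\<^sub>R cinner x (?v i) *\<^sub>C ?u i) sums blinfun_apply X x"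
      unfolding sums_def by simp
    then show "blinfun_apply X x = blinfun_apply (weighted_operator ?s ?v ?u) x"
      using weighted_operator_sums[OF v u c0_star_le[OF s]] sums_unique2 by blast
  qed
  moreover have "?s n = 0 \<longleftrightarrow> ?v n = 0" for n
    using top_right_vector(1)[OF deflation_compact[OF X], of n] by (metis norm_eq_zero top_right_vector_zero zero_neq_one)
  moreover have "?s n = 0 \<longleftrightarrow> ?u n = 0" for n
    using norm_top_left[OF deflation_compact[OF X], of n]
    by (metis norm_eq_zero zero_neq_one blinfun.zero_left scaleR_zero_right top_left_vector_def)
  ultimately show ?thesis unfolding svd_def using v u s by blast
qed

section \<open>Singular values\<close>

lemma c0_star_finite_level:
  assumes "s \<in> c0_star" "t > 0"
  shows "finite {n. s n \<ge> t}"
proof -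
  have "\<forall>\<^sub>F n in sequentially. s n < t"
    using assms order_tendstoD(2) unfolding c0_star_def by blast
  then obtain N where "\<And>n. n \<ge> N \<Longrightarrow> s n < t" unfolding eventually_sequentially by blast
  then have "{n. s n \<ge> t} \<subseteq> {..<N}" by (auto simp: not_le[symmetric])
  then show ?thesis using finite_subset by blast
qed

text \<open>From \<open>n\<close> on, \<open>s'\<close> stays below the value \<open>s n\<close>, so
  it can attain that value only before \<open>n\<close>, where the sequences agree; \<open>s\<close>
  attains it at \<open>n\<close> in addition. This gives the uniqueness in the definition of
  \<open>s_numbers\<close>.\<close>

lemma c0_star_first_difference:
  assumes s: "s \<in> c0_star" and s': "s' \<in> c0_star" and eq: "\<forall>k<n. s k = s' k" and lt: "s' n < s n"
  shows "s n > 0" "card {k. s' k = s n} < card {k. s k = s n}"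
proof -
  have "s' n \<ge> 0" using s' unfolding c0_star_def by auto
  then show pos: "s n > 0" using lt by simp
  have "s' k < s n" if "k \<ge> n" for k
    using s' that lt unfolding c0_star_def by (auto simp: decseq_def intro: le_less_trans)
  then have "{k. s' k = s n} \<subseteq> {k. s k = s n}" using eq by (auto) (metis less_irrefl not_le)
  moreover have "n \<in> {k. s k = s n} - {k. s' k = s n}" using lt by auto
  ultimately have "{k. s' k = s n} \<subset> {k. s k = s n}" by blast
  moreover have "finite {k. s k = s n}" by (rule finite_subset[OF _ c0_star_finite_level[OF s pos]]) auto
  ultimately show "card {k. s' k = s n} < card {k. s k = s n}" by (simp add: psubset_card_mono)
qed

lemma c0_star_eqI:
  assumes s: "s \<in> c0_star" and s': "s' \<in> c0_star"
    and card: "\<And>t. t > 0 \<Longrightarrow> card {n. s n = t} = card {n. s' n = t}"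
  shows "s = s'"
proof (rule ccontr)
  assume "s \<noteq> s'"
  then obtain n where n: "s n \<noteq> s' n" "\<forall>k<n. s k = s' k"
    using exists_least_iff[of "\<lambda>n. s n \<noteq> s' n"] by blast
  then consider "s' n < s n" | "s n < s' n" by linarith
  then show False
  proof cases
    case 1
    then show False using c0_star_first_difference[OF s s' n(2)] card[of "s n"] by simp
  next
    case 2
    moreover have "\<forall>k<n. s' k = s k" using n(2) by simp
    ultimately show False using c0_star_first_difference[OF s' s] card[of "s' n"] by (metis less_irrefl)
  qed
qed

lemma svdD:
  assumes "svd X s v u"
  shows "s \<in> c0_star" "partial_orthonormal v" "partial_orthonormal u" "\<forall>n. \<bar>s n\<bar> \<le> s 0"
    "X = weighted_operator s v u" "s n = 0 \<longleftrightarrow> v n = 0" "s n = 0 \<longleftrightarrow> u n = 0" "s n \<ge> 0"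
proof -
  show "s \<in> c0_star" using assms unfolding svd_def by blast
  then show "\<forall>n. \<bar>s n\<bar> \<le> s 0" "s n \<ge> 0" using c0_star_le unfolding c0_star_def by auto
qed (use assms in \<open>auto simp: svd_def\<close>)

lemma weighted_operator_apply_right:
  assumes "partial_orthonormal v" "partial_orthonormal u" "\<forall>n. \<bar>s n\<bar> \<le> B"
  shows "blinfun_apply (weighted_operator s v u) (v k) = (if v k = 0 then 0 else s k *\<^sub>R u k)"
proof -
  have "(\<lambda>n. s n *\<^sub>R cinner (v k) (v n) *\<^sub>C u n) = (\<lambda>n. if n = k then (if v k = 0 then 0 else s k *\<^sub>R u k) else 0)"
    by (auto simp: fun_eq_iff cinner_partial_orthonormal[OF assms(1)] scaleC_one)
  then show ?thesis
    using weighted_operator_sums[OF assms, of "v k"] sums_single[of k "\<lambda>_. if v k = 0 then 0 else s k *\<^sub>R u k"]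
    by (simp only: sums_unique2)
qed

lemma independent_partial_orthonormal:
  assumes v: "partial_orthonormal v" and A: "finite A" "\<And>n. n \<in> A \<Longrightarrow> v n \<noteq> 0"
  shows "inj_on v A" "complex_vector.independent (v ` A)"
proof -
  show inj: "inj_on v A"
  proof (rule inj_onI, rule ccontr)
    fix i j assume ij: "i \<in> A" "j \<in> A" "v i = v j" "i \<noteq> j"
    then have "cinner (v i) (v i) = 0" using v unfolding partial_orthonormal_def by metis
    then show False using A(2)[OF ij(1)] by (simp add: cinner_self)
  qed
  show "complex_vector.independent (v ` A)"
  proof (rule complex_vector.independent_if_scalars_zero)
    show "finite (v ` A)" using A by simp
    fix f x assume f: "(\<Sum>x\<in>v ` A. f x *\<^sub>C x) = 0" and "x \<in> v ` A"
    then obtain n where n: "n \<in> A" "x = v n" by blast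
    have "0 = cinner (\<Sum>i\<in>A. f (v i) *\<^sub>C v i) (v n)"
      using f by (simp add: sum.reindex[OF inj])
    also have "\<dots> = (\<Sum>i\<in>A. if i = n then f (v n) else 0)"
      unfolding cinner_sum_left
      by (intro sum.cong) (auto simp: cinner_scaleC_left cinner_partial_orthonormal[OF v] A(2))
    also have "\<dots> = f (v n)" using n A(1) by simp
    finally show "f x = 0" using n by simp
  qed
qed

text \<open>X*X is diagonal in the family \<open>v\<close> with entries \<open>s n * s n\<close>.
  Comparing coefficients, an eigenvector for \<open>t\<^sup>2\<close> is orthogonal to every
  \<open>v n\<close> with \<open>s n\<close> different from \<open>t\<close>.\<close>

lemma svd_eigenspace:
  assumes svd: "svd X s v u" and t: "t > 0"
  shows "complex_vector.dim {x. blinfun_apply (hilbert_adjoint X o\<^sub>L X) x = t\<^sup>2 *\<^sub>R x} = card {n. s n = t}"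
proof -
  note D = svdD[OF svd]
  define A where "A = {n. s n = t}"
  have finA: "finite A" unfolding A_def by (rule finite_subset[OF _ c0_star_finite_level[OF D(1) t]]) auto
  have vA: "v n \<noteq> 0" if "n \<in> A" for n using that t D(6)[of n] by (auto simp: A_def)
  let ?r = "\<lambda>n. s n * s n"
  have b: "\<forall>n. \<bar>s n * s n\<bar> \<le> s 0 * s 0"
  proof
    fix n show "\<bar>s n * s n\<bar> \<le> s 0 * s 0" using D(4)[rule_format, of n] D(8)[of n] by (simp add: mult_mono)
  qed
  have T: "hilbert_adjoint X o\<^sub>L X = weighted_operator ?r v v"
    unfolding D(5) hilbert_adjoint_weighted_operator[OF D(2-4)]
    by (rule weighted_operator_compose[OF D(3,2,2,4,4)]) (use D(7) in auto)
  let ?T = "weighted_operator ?r v v"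
  let ?E = "{x. blinfun_apply ?T x = t\<^sup>2 *\<^sub>R x}"
  have "?E = complex_vector.span (v ` A)"
  proof
    have "complex_vector.subspace ?E"
      unfolding complex_vector.subspace_def
      using bounded_operators_scaleC[OF weighted_operator_bounded[OF D(2,2) b]]
      by (auto simp: blinfun.add_right scaleC_add_right scaleR_scaleC scaleC_scaleC mult.commute)
    moreover have "v ` A \<subseteq> ?E"
      using weighted_operator_apply_right[OF D(2,2) b] by (auto simp: A_def power2_eq_square)
    ultimately show "complex_vector.span (v ` A) \<subseteq> ?E" by (intro complex_vector.span_minimal)
  next
    show "?E \<subseteq> complex_vector.span (v ` A)"
    proof
      fix x assume "x \<in> ?E"
      then have x: "blinfun_apply ?T x = t\<^sup>2 *\<^sub>R x" by simp
      have off: "cinner x (v n) = 0" if "n \<notin> A" for n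
      proof (cases "v n = 0")
        case False
        then have "of_real (t\<^sup>2) * cinner x (v n) = of_real (s n * s n) * cinner x (v n)"
          using cinner_weighted_operator[OF D(2,2) b, of x n] x by (simp add: cinner_scaleR_left)
        moreover have "t\<^sup>2 \<noteq> s n * s n"
          using that t D(8)[of n] unfolding A_def by (metis (mono_tags, lifting) less_imp_le mem_Collect_eq power2_eq_imp_eq power2_eq_square)
        ultimately show ?thesis by (metis mult_cancel_right of_real_eq_iff)
      qed simp
      \<comment> \<open>The family \<open>v\<close> need not span the space, so \<open>x\<close> is
        not expanded directly. Its image is a finite combination of vectors \<open>v n\<close>, and
        \<open>t > 0\<close> allows division by \<open>t\<^sup>2\<close>.\<close>
      have "(\<lambda>n. ?r n *\<^sub>R cinner x (v n) *\<^sub>C v n) sums (\<Sum>n\<in>A. ?r n *\<^sub>R cinner x (v n) *\<^sub>C v n)"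
        by (rule sums_finite[OF finA]) (simp add: off)
      then have "t\<^sup>2 *\<^sub>R x = (\<Sum>n\<in>A. ?r n *\<^sub>R cinner x (v n) *\<^sub>C v n)"
        using weighted_operator_sums[OF D(2,2) b, of x] x by (simp add: sums_unique2)
      also have "\<dots> \<in> complex_vector.span (v ` A)"
        unfolding scaleR_scaleC
        by (intro complex_vector.span_sum complex_vector.span_scale complex_vector.span_base) auto
      finally have "complex_of_real (1 / t\<^sup>2) *\<^sub>C (t\<^sup>2 *\<^sub>R x) \<in> complex_vector.span (v ` A)"
        by (rule complex_vector.span_scale)
      moreover have "complex_of_real (1 / t\<^sup>2) *\<^sub>C (t\<^sup>2 *\<^sub>R x) = x"
        unfolding scaleR_scaleC[symmetric] using t by simp
      ultimately show "x \<in> complex_vector.span (v ` A)" by simp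
    qed
  qed
  then have "complex_vector.dim ?E = card (v ` A)"
    using complex_vector.dim_span_eq_card_independent[OF independent_partial_orthonormal(2)[OF D(2) finA vA]] by simp
  also have "\<dots> = card A" by (rule card_image[OF independent_partial_orthonormal(1)[OF D(2) finA vA]])
  finally show ?thesis unfolding T A_def .
qed

lemma svd_s_numbers:
  assumes "svd X s v u"
  shows "s_numbers X = s"
  unfolding s_numbers_def
proof (rule the_equality)
  show "s \<in> c0_star \<and> (\<forall>t>0. card {n. s n = t} =
        complex_vector.dim {x. blinfun_apply (hilbert_adjoint X o\<^sub>L X) x = t\<^sup>2 *\<^sub>R x})"
    using svd_eigenspace[OF assms] svdD(1)[OF assms] by simp
next
  fix s' assume "s' \<in> c0_star \<and> (\<forall>t>0. card {n. s' n = t} =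
        complex_vector.dim {x. blinfun_apply (hilbert_adjoint X o\<^sub>L X) x = t\<^sup>2 *\<^sub>R x})"
  then show "s' = s" using svd_eigenspace[OF assms] svdD(1)[OF assms] by (intro c0_star_eqI) auto
qed

lemma svd_s_numbers_exists:
  assumes "X \<in> compact_operators"
  obtains v u where "svd X (s_numbers X) v u"
  using svd_exists[OF assms] svd_s_numbers by metis

lemma s_numbers_c0_star: "X \<in> compact_operators \<Longrightarrow> s_numbers X \<in> c0_star"
  using svd_s_numbers_exists svdD(1) by metis

section \<open>Min-max estimates for singular values\<close>

lemma homogeneous_system:
  fixes a :: "'i \<Rightarrow> 'j \<Rightarrow> complex"
  assumes "finite I" "finite J" "card I < card J"
  shows "\<exists>c. (\<exists>j\<in>J. c j \<noteq> 0) \<and> (\<forall>i\<in>I. (\<Sum>j\<in>J. a i j * c j) = 0)"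
  using assms
proof (induction I arbitrary: J a rule: finite_induct)
  case empty
  then obtain j where "j \<in> J" by fastforce
  then show ?case by (intro exI[of _ "\<lambda>_. 1"]) auto
next
  case (insert i0 I)
  show ?case
  proof (cases "\<forall>j\<in>J. a i0 j = 0")
    case True
    have "card I < card J" using insert by simp
    then obtain c where "\<exists>j\<in>J. c j \<noteq> 0" "\<forall>i\<in>I. (\<Sum>j\<in>J. a i j * c j) = 0"
      using insert.IH[of J a] insert.prems by blast
    then show ?thesis using True by (intro exI[of _ c]) auto
  next
    case False
    then obtain p where p: "p \<in> J" "a i0 p \<noteq> 0" by blast
    define J' where "J' = J - {p}"
    \<comment> \<open>Elimination of the unknown \<open>p\<close> by means of equation
      \<open>i0\<close>; below, \<open>d\<close> restores that unknown from the solution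
      \<open>c\<close> of the reduced system.\<close>
    define a' where "a' i j = a i j - a i p * a i0 j / a i0 p" for i j
    have J: "J = insert p J'" "p \<notin> J'" "finite J'" using p insert.prems by (auto simp: J'_def)
    have "card I < card J'" using insert J by simp
    then obtain c where c: "\<exists>j\<in>J'. c j \<noteq> 0" "\<forall>i\<in>I. (\<Sum>j\<in>J'. a' i j * c j) = 0"
      using insert.IH[of J' a'] J by blast
    define d where "d j = (if j = p then - (\<Sum>j\<in>J'. a i0 j * c j) / a i0 p else c j)" for j
    have sum: "(\<Sum>j\<in>J. a i j * d j) = (\<Sum>j\<in>J'. a' i j * c j)" for i
    proof -
      have "(\<Sum>j\<in>J'. a i j * d j) = (\<Sum>j\<in>J'. a i j * c j)"
        using J by (intro sum.cong) (auto simp: d_def)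
      then have "(\<Sum>j\<in>J. a i j * d j) = (\<Sum>j\<in>J'. a i j * c j) - a i p * (\<Sum>j\<in>J'. a i0 j * c j) / a i0 p"
        using J by (simp add: d_def)
      also have "\<dots> = (\<Sum>j\<in>J'. a' i j * c j)"
        by (simp add: a'_def algebra_simps sum_subtractf sum_distrib_left sum_divide_distrib)
      finally show ?thesis .
    qed
    show ?thesis
    proof (intro exI[of _ d] conjI ballI)
      show "\<exists>j\<in>J. d j \<noteq> 0" using c(1) J unfolding d_def by (metis insertCI)
      fix i assume i: "i \<in> insert i0 I"
      have "a' i0 j = 0" for j using p by (simp add: a'_def)
      then show "(\<Sum>j\<in>J. a i j * d j) = 0" using i c(2) sum[of i] by auto
    qed
  qed
qed

text \<open>Orthogonality to the first \<open>m\<close> right vectors removes the first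
  \<open>m\<close> terms of the series, and the remaining weights are at most \<open>s m\<close>.
  This is the upper half of the min-max principle.\<close>

lemma svd_norm_le:
  assumes svd: "svd X s v u" and x: "\<And>i. i < m \<Longrightarrow> cinner x (v i) = 0"
  shows "norm (blinfun_apply X x) \<le> s m * norm x"
proof -
  note D = svdD[OF svd]
  have b: "\<forall>n. \<bar>if n < m then 0 else s n\<bar> \<le> s m"
    using D(1) unfolding c0_star_def by (auto simp: decseq_def)
  have "(\<lambda>n. s n *\<^sub>R cinner x (v n) *\<^sub>C u n) = (\<lambda>n. (if n < m then 0 else s n) *\<^sub>R cinner x (v n) *\<^sub>C u n)"
    using x by auto
  then have "blinfun_apply X x = blinfun_apply (weighted_operator (\<lambda>n. if n < m then 0 else s n) v u) x"
    unfolding D(5) weighted_operator_apply[OF D(2-4)] weighted_operator_apply[OF D(2,3) b] by simp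
  then show ?thesis using norm_weighted_operator_le[OF D(2,3) b] by simp
qed

text \<open>The lower half of the min-max principle: on the span of the first \<open>k + 1\<close>
  right vectors \<open>Z\<close> expands by at least \<open>s k\<close>, and \<open>k\<close> linear
  functionals have a common nonzero zero there. General functionals, rather than inner products with
  fixed vectors, also cover the constraints on \<open>A x\<close> that arise for a product
  \<open>X A\<close>.\<close>

lemma svd_norm_ge:
  assumes svd: "svd Z s v u" and pos: "s k > 0"
    and f: "\<And>i x y. f i (x + y) = f i x + f i y" "\<And>i c x. f i (c *\<^sub>C x) = (c::complex) * f i x"
  shows "\<exists>x. x \<noteq> 0 \<and> (\<forall>i<k. f i x = 0) \<and> s k * norm x \<le> norm (blinfun_apply Z x)"
proof -
  note D = svdD[OF svd]
  have f0: "f i 0 = 0" for i using f(2)[of i 0 0] by simp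
  have fsum: "f i (\<Sum>j\<in>A. c j *\<^sub>C v j) = (\<Sum>j\<in>A. f i (v j) * c j)" if "finite A" for i A c
    using that by (induction A rule: finite_induct) (auto simp: f f0)
  obtain c where c: "\<exists>j\<in>{..k}. c j \<noteq> 0" "\<forall>i\<in>{..<k}. (\<Sum>j\<in>{..k}. f i (v j) * c j) = 0"
    using homogeneous_system[of "{..<k}" "{..k}" "\<lambda>i j. f i (v j)"] by auto
  define x where "x = (\<Sum>j\<le>k. c j *\<^sub>C v j)"
  have ge: "s j \<ge> s k" if "j \<le> k" for j using D(1) that unfolding c0_star_def by (auto simp: decseq_def)
  then have nz: "norm (v j) = 1" "norm (u j) = 1" if "j \<le> k" for j
    using D(2,3) D(6,7)[of j] pos that unfolding partial_orthonormal_def by force+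
  have norm_x: "(norm x)\<^sup>2 = (\<Sum>j\<le>k. (cmod (c j))\<^sup>2)"
    unfolding x_def norm_sum_orthogonal_sq[OF D(2) finite_atMost] by (intro sum.cong) (auto simp: nz)
  have "blinfun_apply Z (c j *\<^sub>C v j) = (of_real (s j) * c j) *\<^sub>C u j" if "j \<le> k" for j
  proof -
    have "v j \<noteq> 0" using nz(1)[OF that] by auto
    then show ?thesis
      unfolding D(5) bounded_operators_scaleC[OF weighted_operator_bounded[OF D(2-4)]]
      by (simp add: weighted_operator_apply_right[OF D(2-4)] scaleR_scaleC scaleC_scaleC mult.commute)
  qed
  then have "blinfun_apply Z x = (\<Sum>j\<le>k. (of_real (s j) * c j) *\<^sub>C u j)"
    unfolding x_def blinfun.sum_right by (intro sum.cong) auto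
  then have "(norm (blinfun_apply Z x))\<^sup>2 = (\<Sum>j\<le>k. (s j)\<^sup>2 * (cmod (c j))\<^sup>2)"
    unfolding norm_sum_orthogonal_sq[OF D(3) finite_atMost, of "\<lambda>j. of_real (s j) * c j", symmetric]
    by (simp only:) (subst norm_sum_orthogonal_sq[OF D(3) finite_atMost], intro sum.cong, auto simp: nz norm_mult power_mult_distrib)
  also have "\<dots> \<ge> (\<Sum>j\<le>k. (s k)\<^sup>2 * (cmod (c j))\<^sup>2)"
    using ge pos by (intro sum_mono mult_right_mono power_mono) auto
  finally have "(s k * norm x)\<^sup>2 \<le> (norm (blinfun_apply Z x))\<^sup>2"
    unfolding power_mult_distrib norm_x by (simp add: sum_distrib_left)
  then have "s k * norm x \<le> norm (blinfun_apply Z x)" by (rule power2_le_imp_le) simp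
  moreover have "x \<noteq> 0"
  proof
    assume "x = 0"
    then have "(\<Sum>j\<le>k. (cmod (c j))\<^sup>2) = 0" using norm_x by simp
    then show False using c(1) by (simp add: sum_nonneg_eq_0_iff)
  qed
  moreover have "\<forall>i<k. f i x = 0" using c(2) fsum[of "{..k}"] by (simp add: x_def)
  ultimately show ?thesis by blast
qed

lemma s_numbers_add:
  assumes "X \<in> compact_operators" "Y \<in> compact_operators"
  shows "s_numbers (X + Y) (m + n) \<le> s_numbers X m + s_numbers Y n"
proof -
  obtain v u where X: "svd X (s_numbers X) v u" using svd_s_numbers_exists[OF assms(1)] .
  obtain v' u' where Y: "svd Y (s_numbers Y) v' u'" using svd_s_numbers_exists[OF assms(2)] .
  obtain w w' where Z: "svd (X + Y) (s_numbers (X + Y)) w w'"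
    using svd_s_numbers_exists[OF compact_operators_add[OF assms]] .
  show ?thesis
  proof (cases "s_numbers (X + Y) (m + n) > 0")
    case True
    \<comment> \<open>The first \<open>m\<close> constraints make \<open>X\<close> small at
      \<open>x\<close>, the remaining \<open>n\<close> make \<open>Y\<close> small; together they
      are the \<open>m + n\<close> functionals that \<open>svd_norm_ge\<close> admits for
      \<open>X + Y\<close>.\<close>
    define f where "f i x = cinner x (if i < m then v i else v' (i - m))" for i x
    obtain x where x: "x \<noteq> 0" "\<forall>i<m+n. f i x = 0"
        "s_numbers (X + Y) (m + n) * norm x \<le> norm (blinfun_apply (X + Y) x)"
      using svd_norm_ge[OF Z True, of f] by (auto simp: f_def cinner_linear_simps)
    have "cinner x (v i) = 0" if "i < m" for i using x(2) that by (auto simp: f_def dest: spec[of _ i])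
    moreover have "cinner x (v' i) = 0" if "i < n" for i using x(2) that by (auto simp: f_def dest: spec[of _ "m + i"])
    ultimately have "norm (blinfun_apply X x) \<le> s_numbers X m * norm x" "norm (blinfun_apply Y x) \<le> s_numbers Y n * norm x"
      using svd_norm_le[OF X] svd_norm_le[OF Y] by auto
    then have "s_numbers (X + Y) (m + n) * norm x \<le> (s_numbers X m + s_numbers Y n) * norm x"
      using x(3) norm_triangle_ineq[of "blinfun_apply X x" "blinfun_apply Y x"]
      by (simp add: blinfun.add_left distrib_right)
    then show ?thesis using x(1) by simp
  qed (use svdD(8)[OF X, of m] svdD(8)[OF Y, of n] in auto)
qed

lemma s_numbers_compose_left:
  assumes "A \<in> bounded_operators" "X \<in> compact_operators"
  shows "s_numbers (A o\<^sub>L X) n \<le> norm A * s_numbers X n"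
proof -
  obtain v u where X: "svd X (s_numbers X) v u" using svd_s_numbers_exists[OF assms(2)] .
  obtain w w' where Z: "svd (A o\<^sub>L X) (s_numbers (A o\<^sub>L X)) w w'"
    using svd_s_numbers_exists[OF compact_operators_compose_left[OF assms]] .
  show ?thesis
  proof (cases "s_numbers (A o\<^sub>L X) n > 0")
    case True
    obtain x where x: "x \<noteq> 0" "\<forall>i<n. cinner x (v i) = 0"
        "s_numbers (A o\<^sub>L X) n * norm x \<le> norm (blinfun_apply (A o\<^sub>L X) x)"
      using svd_norm_ge[OF Z True, of "\<lambda>i x. cinner x (v i)"] by (auto simp: cinner_linear_simps)
    note x(3)
    also have "norm (blinfun_apply (A o\<^sub>L X) x) \<le> norm A * norm (blinfun_apply X x)" by (simp add: norm_blinfun)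
    also have "\<dots> \<le> norm A * (s_numbers X n * norm x)"
      using svd_norm_le[OF X] x(2) by (intro mult_left_mono) auto
    finally show ?thesis using x(1) by simp
  next
    case False
    moreover have "0 \<le> norm A * s_numbers X n" using svdD(8)[OF X] by simp
    ultimately show ?thesis by linarith
  qed
qed

lemma s_numbers_compose_right:
  assumes "A \<in> bounded_operators" "X \<in> compact_operators"
  shows "s_numbers (X o\<^sub>L A) n \<le> norm A * s_numbers X n"
proof -
  obtain v u where X: "svd X (s_numbers X) v u" using svd_s_numbers_exists[OF assms(2)] .
  obtain w w' where Z: "svd (X o\<^sub>L A) (s_numbers (X o\<^sub>L A)) w w'"
    using svd_s_numbers_exists[OF compact_operators_compose_right[OF assms]] .
  show ?thesis
  proof (cases "s_numbers (X o\<^sub>L A) n > 0")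
    case True
    obtain x where x: "x \<noteq> 0" "\<forall>i<n. cinner (blinfun_apply A x) (v i) = 0"
        "s_numbers (X o\<^sub>L A) n * norm x \<le> norm (blinfun_apply (X o\<^sub>L A) x)"
      using svd_norm_ge[OF Z True, of "\<lambda>i x. cinner (blinfun_apply A x) (v i)"]
      by (auto simp: cinner_linear_simps blinfun.add_right bounded_operators_scaleC[OF assms(1)])
    note x(3)
    also have "norm (blinfun_apply (X o\<^sub>L A) x) \<le> s_numbers X n * norm (blinfun_apply A x)"
      using svd_norm_le[OF X] x(2) by simp
    also have "\<dots> \<le> s_numbers X n * (norm A * norm x)"
      using svdD(8)[OF X] norm_blinfun by (intro mult_left_mono) auto
    finally show ?thesis using x(1) by (simp add: mult_ac)
  next
    case False
    moreover have "0 \<le> norm A * s_numbers X n" using svdD(8)[OF X] by simp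
    ultimately show ?thesis by linarith
  qed
qed

section \<open>Ideals and their characteristic sets\<close>

lemma operator_idealD:
  assumes "operator_ideal J"
  shows "X \<in> J \<Longrightarrow> X \<in> compact_operators" "0 \<in> J" "X \<in> J \<Longrightarrow> Y \<in> J \<Longrightarrow> X + Y \<in> J"
    "X \<in> J \<Longrightarrow> A \<in> bounded_operators \<Longrightarrow> A o\<^sub>L X \<in> J" "X \<in> J \<Longrightarrow> A \<in> bounded_operators \<Longrightarrow> X o\<^sub>L A \<in> J"
  using assms unfolding operator_ideal_def by blast+

text \<open>The sets of sequences that can be \<open>Sigma_set\<close> of an ideal. In indices from
  0, \<open>n div 2\<close> is the dilation D_2, and its iterates give the dilations by powers of
  two.\<close>

definition characteristic_set :: "(nat \<Rightarrow> real) set \<Rightarrow> bool" where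
  "characteristic_set C \<longleftrightarrow> C \<subseteq> c0_star \<and> (\<lambda>_. 0) \<in> C
     \<and> (\<forall>\<eta>\<in>C. \<forall>\<zeta>\<in>c0_star. \<forall>M. (\<forall>n. \<zeta> n \<le> M * \<eta> n) \<longrightarrow> \<zeta> \<in> C)
     \<and> (\<forall>\<eta>\<in>C. \<forall>\<zeta>\<in>C. (\<lambda>n. \<eta> n + \<zeta> n) \<in> C)
     \<and> (\<forall>\<eta>\<in>C. (\<lambda>n. \<eta> (n div 2)) \<in> C)"

definition ideal_of :: "(nat \<Rightarrow> real) set \<Rightarrow> ('a::complex_hilbert_space \<Rightarrow>\<^sub>L 'a) set" where
  "ideal_of C = {X \<in> compact_operators. s_numbers X \<in> C}"

lemma c0_star_add: "\<eta> \<in> c0_star \<Longrightarrow> \<zeta> \<in> c0_star \<Longrightarrow> (\<lambda>n. \<eta> n + \<zeta> n) \<in> c0_star"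
  unfolding c0_star_def decseq_def using tendsto_add[of \<eta> 0 sequentially \<zeta> 0] by (auto intro: add_mono)

lemma c0_star_zero: "(\<lambda>_. 0) \<in> c0_star"
  unfolding c0_star_def decseq_def by auto

lemma s_numbers_zero: "s_numbers (0 :: 'a::complex_hilbert_space \<Rightarrow>\<^sub>L 'a) = (\<lambda>_. 0)"
proof
  fix n
  have "s_numbers (0 o\<^sub>L 0 :: 'a \<Rightarrow>\<^sub>L 'a) n \<le> 0"
    using s_numbers_compose_left[of "0 :: 'a \<Rightarrow>\<^sub>L 'a" 0 n] bounded_operators_zero zero_compact_operator by simp
  moreover have "(0 o\<^sub>L 0 :: 'a \<Rightarrow>\<^sub>L 'a) = 0" by (rule blinfun_eqI) simp
  moreover have "s_numbers (0 :: 'a \<Rightarrow>\<^sub>L 'a) n \<ge> 0"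
    using s_numbers_c0_star[OF zero_compact_operator] unfolding c0_star_def by blast
  ultimately show "s_numbers (0 :: 'a \<Rightarrow>\<^sub>L 'a) n = 0" by simp
qed

lemma operator_ideal_ideal_of:
  assumes C: "characteristic_set C"
  shows "operator_ideal (ideal_of C :: ('a::complex_hilbert_space \<Rightarrow>\<^sub>L 'a) set)"
proof -
  have C0: "(\<lambda>_. 0) \<in> C"
    and Ch: "\<And>\<eta> \<zeta> M. \<eta> \<in> C \<Longrightarrow> \<zeta> \<in> c0_star \<Longrightarrow> (\<And>n. \<zeta> n \<le> M * \<eta> n) \<Longrightarrow> \<zeta> \<in> C"
    and Ca: "\<And>\<eta> \<zeta>. \<eta> \<in> C \<Longrightarrow> \<zeta> \<in> C \<Longrightarrow> (\<lambda>n. \<eta> n + \<zeta> n) \<in> C"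
    and Cd: "\<And>\<eta>. \<eta> \<in> C \<Longrightarrow> (\<lambda>n. \<eta> (n div 2)) \<in> C"
    using C unfolding characteristic_set_def by blast+
  show ?thesis
    unfolding operator_ideal_def
  proof (intro conjI ballI)
    show "ideal_of C \<subseteq> (compact_operators :: ('a \<Rightarrow>\<^sub>L 'a) set)" unfolding ideal_of_def by auto
    show "0 \<in> (ideal_of C :: ('a \<Rightarrow>\<^sub>L 'a) set)"
      unfolding ideal_of_def by (simp add: s_numbers_zero C0 zero_compact_operator)
  next
    fix X Y :: "'a \<Rightarrow>\<^sub>L 'a" assume XY: "X \<in> ideal_of C" "Y \<in> ideal_of C"
    then have c: "X \<in> compact_operators" "Y \<in> compact_operators" unfolding ideal_of_def by auto
    have "(\<lambda>n. s_numbers X (n div 2) + s_numbers Y (n div 2)) \<in> C"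
      using XY Ca[OF Cd Cd] unfolding ideal_of_def by simp
    moreover have "s_numbers (X + Y) \<in> c0_star" by (intro s_numbers_c0_star compact_operators_add c)
    \<comment> \<open>Ky Fan's inequality splits the index into two halves; this is where closure of
      \<open>C\<close> under the dilation by 2 enters.\<close>
    moreover have "s_numbers (X + Y) n \<le> 1 * (s_numbers X (n div 2) + s_numbers Y (n div 2))" for n
    proof -
      have "s_numbers (X + Y) n \<le> s_numbers (X + Y) (n div 2 + n div 2)"
        using \<open>s_numbers (X + Y) \<in> c0_star\<close> unfolding c0_star_def decseq_def by auto
      then show ?thesis using s_numbers_add[OF c, of "n div 2" "n div 2"] by simp
    qed
    ultimately have "s_numbers (X + Y) \<in> C" by (rule Ch)
    then show "X + Y \<in> ideal_of C" unfolding ideal_of_def using c compact_operators_add by simp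
  next
    fix X A :: "'a \<Rightarrow>\<^sub>L 'a" assume "X \<in> ideal_of C" and A: "A \<in> bounded_operators"
    then have X: "X \<in> compact_operators" "s_numbers X \<in> C" unfolding ideal_of_def by auto
    show "A o\<^sub>L X \<in> ideal_of C"
      unfolding ideal_of_def
      using Ch[OF X(2) s_numbers_c0_star[OF compact_operators_compose_left[OF A X(1)]] s_numbers_compose_left[OF A X(1)]]
        compact_operators_compose_left[OF A X(1)] by simp
    show "X o\<^sub>L A \<in> ideal_of C"
      unfolding ideal_of_def
      using Ch[OF X(2) s_numbers_c0_star[OF compact_operators_compose_right[OF A X(1)]] s_numbers_compose_right[OF A X(1)]]
        compact_operators_compose_right[OF A X(1)] by simp
  qed
qed

section \<open>Ideals and sequences matched through a fixed orthonormal basis\<close>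

context
  fixes e :: "nat \<Rightarrow> 'a::complex_hilbert_space"
  assumes e: "orthonormal_basis e"
begin

lemma basis_nonzero: "e n \<noteq> 0"
proof
  assume "e n = 0"
  then have "cinner (e n) (e n) = 0" by simp
  then show False using e unfolding orthonormal_basis_def by simp
qed

lemma basis_partial_orthonormal: "partial_orthonormal e"
  using e by (rule orthonormal_basis_partial_orthonormal)

lemma diag_operator_compact: "\<xi> \<in> c0_star \<Longrightarrow> diag_operator e \<xi> \<in> compact_operators"
  unfolding diag_operator_eq by (intro weighted_operator_compact basis_partial_orthonormal)

lemma s_numbers_diag_operator:
  assumes \<xi>: "\<xi> \<in> c0_star"
  shows "s_numbers (diag_operator e \<xi>) = \<xi>"
proof -
  \<comment> \<open>Basis vectors with weight zero are replaced by zero to meet the convention in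
    \<open>svd\<close>; the operator is unchanged.\<close>
  define v where "v n = (if \<xi> n = 0 then 0 else e n)" for n
  have v: "partial_orthonormal v" using basis_partial_orthonormal unfolding partial_orthonormal_def v_def by auto
  have "diag_operator e \<xi> = weighted_operator \<xi> v v"
    unfolding diag_operator_def weighted_operator_def
    by (intro arg_cong[where f=Blinfun] ext arg_cong[where f=suminf]) (simp add: v_def)
  then have "svd (diag_operator e \<xi>) \<xi> v v"
    unfolding svd_def using \<xi> v basis_nonzero by (auto simp: v_def)
  then show ?thesis by (rule svd_s_numbers)
qed

text \<open>Partial isometries carry the singular vectors of \<open>X\<close> to the basis and back.
  Each of the two operators is thus a product of the other with bounded operators, and membership in
  an ideal depends on the s-numbers alone.\<close>

lemma operator_ideal_iff_diag:
  assumes J: "operator_ideal J" and X: "X \<in> compact_operators"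
  shows "X \<in> J \<longleftrightarrow> diag_operator e (s_numbers X) \<in> J"
proof -
  obtain v u where "svd X (s_numbers X) v u" using svd_s_numbers_exists[OF X] .
  note D = svdD[OF this]
  have one: "\<forall>n::nat. \<bar>1::real\<bar> \<le> 1" by simp
  note E = basis_partial_orthonormal
  let ?s = "s_numbers X" and ?one = "\<lambda>n::nat. 1::real"
  have nz: "v n = 0 \<Longrightarrow> ?s n = 0" "u n = 0 \<Longrightarrow> ?s n = 0" for n using D(6,7) by blast+
  show ?thesis
  proof
    assume "X \<in> J"
    then have "weighted_operator ?s v u o\<^sub>L weighted_operator ?one e v \<in> J"
      unfolding D(5)[symmetric] by (rule operator_idealD(5)[OF J _ weighted_operator_bounded[OF E D(2) one]])
    also have "weighted_operator ?s v u o\<^sub>L weighted_operator ?one e v = weighted_operator ?s e u"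
      by (rule weighted_operator_compose[OF D(2,3) E D(4) one]) (auto simp: nz)
    finally have "weighted_operator ?one u e o\<^sub>L weighted_operator ?s e u \<in> J"
      by (rule operator_idealD(4)[OF J _ weighted_operator_bounded[OF D(3) E one]])
    also have "weighted_operator ?one u e o\<^sub>L weighted_operator ?s e u = weighted_operator ?s e e"
      by (rule weighted_operator_compose[OF D(3) E E one D(4)]) (auto simp: nz)
    finally show "diag_operator e ?s \<in> J" unfolding diag_operator_eq .
  next
    assume "diag_operator e ?s \<in> J"
    then have "weighted_operator ?s e e o\<^sub>L weighted_operator ?one v e \<in> J"
      unfolding diag_operator_eq by (rule operator_idealD(5)[OF J _ weighted_operator_bounded[OF D(2) E one]])
    also have "weighted_operator ?s e e o\<^sub>L weighted_operator ?one v e = weighted_operator ?s v e"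
      by (rule weighted_operator_compose[OF E E D(2) D(4) one]) (auto simp: basis_nonzero)
    finally have "weighted_operator ?one e u o\<^sub>L weighted_operator ?s v e \<in> J"
      by (rule operator_idealD(4)[OF J _ weighted_operator_bounded[OF E D(3) one]])
    also have "weighted_operator ?one e u o\<^sub>L weighted_operator ?s v e = weighted_operator ?s v u"
      by (rule weighted_operator_compose[OF E D(3) D(2) one D(4)]) (auto simp: basis_nonzero)
    finally show "X \<in> J" unfolding D(5)[symmetric] .
  qed
qed

lemma Sigma_set_eq:
  assumes J: "operator_ideal (J :: ('a \<Rightarrow>\<^sub>L 'a) set)"
  shows "Sigma_set J = {\<zeta> \<in> c0_star. diag_operator e \<zeta> \<in> J}"
proof
  show "Sigma_set J \<subseteq> {\<zeta> \<in> c0_star. diag_operator e \<zeta> \<in> J}"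
    unfolding Sigma_set_def using operator_ideal_iff_diag[OF J] operator_idealD(1)[OF J] s_numbers_c0_star by blast
  show "{\<zeta> \<in> c0_star. diag_operator e \<zeta> \<in> J} \<subseteq> Sigma_set J"
  proof
    fix \<zeta> assume "\<zeta> \<in> {\<zeta> \<in> c0_star. diag_operator e \<zeta> \<in> J}"
    then have "\<zeta> = s_numbers (diag_operator e \<zeta>)" "diag_operator e \<zeta> \<in> J" by (simp_all add: s_numbers_diag_operator)
    then show "\<zeta> \<in> Sigma_set J" unfolding Sigma_set_def by (rule image_eqI)
  qed
qed

lemma ideal_of_Sigma_set:
  assumes J: "operator_ideal (J :: ('a \<Rightarrow>\<^sub>L 'a) set)"
  shows "ideal_of (Sigma_set J) = J"
  unfolding ideal_of_def Sigma_set_eq[OF J]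
  using operator_ideal_iff_diag[OF J] operator_idealD(1)[OF J] s_numbers_c0_star by blast

lemma Sigma_set_ideal_of:
  assumes C: "characteristic_set C"
  shows "Sigma_set (ideal_of C :: ('a \<Rightarrow>\<^sub>L 'a) set) = C"
proof -
  have "C \<subseteq> c0_star" using C unfolding characteristic_set_def by blast
  then show ?thesis
    unfolding Sigma_set_eq[OF operator_ideal_ideal_of[OF C]]
    by (auto simp: ideal_of_def s_numbers_diag_operator diag_operator_compact)
qed

lemma operator_ideal_hereditary:
  assumes J: "operator_ideal J" and X: "diag_operator e \<eta> \<in> J"
    and \<eta>: "\<eta> \<in> c0_star" and \<zeta>: "\<zeta> \<in> c0_star" "\<And>n. \<zeta> n \<le> M * \<eta> n"
  shows "diag_operator e \<zeta> \<in> J"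
proof -
  note E = basis_partial_orthonormal
  have nonneg: "0 \<le> \<eta> n" "0 \<le> \<zeta> n" for n using \<eta> \<zeta>(1) unfolding c0_star_def by auto
  have b: "\<forall>n. \<bar>\<zeta> n / \<eta> n\<bar> \<le> \<bar>M\<bar>"
  proof
    fix n show "\<bar>\<zeta> n / \<eta> n\<bar> \<le> \<bar>M\<bar>"
    proof (cases "\<eta> n = 0")
      case False
      then have "\<eta> n > 0" using nonneg(1)[of n] by simp
      then have "\<zeta> n / \<eta> n \<le> M" using \<zeta>(2)[of n] by (simp add: divide_le_eq)
      then show ?thesis using \<open>\<eta> n > 0\<close> nonneg(2)[of n] by simp
    qed simp
  qed
  \<comment> \<open>A diagonal factor with bounded entries carries one operator to the other. Where
    \<eta> vanishes, the hypothesis forces \<zeta> to vanish, in agreement with division by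
    zero.\<close>
  have "\<zeta> n = \<eta> n * (\<zeta> n / \<eta> n)" for n using \<zeta>(2)[of n] nonneg(2)[of n] by (cases "\<eta> n = 0") auto
  then have "weighted_operator \<eta> e e o\<^sub>L weighted_operator (\<lambda>n. \<zeta> n / \<eta> n) e e = weighted_operator \<zeta> e e"
    using basis_nonzero by (intro weighted_operator_compose[OF E E E c0_star_le[OF \<eta>] b]) blast+
  then show ?thesis
    using operator_idealD(5)[OF J X weighted_operator_bounded[OF E E b]] by (simp add: diag_operator_eq)
qed

lemma diag_operator_add:
  assumes "\<eta> \<in> c0_star" "\<zeta> \<in> c0_star"
  shows "diag_operator e (\<lambda>n. \<eta> n + \<zeta> n) = diag_operator e \<eta> + diag_operator e \<zeta>"
proof (rule blinfun_eqI)
  fix x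
  note E = basis_partial_orthonormal
  have "(\<lambda>n. \<eta> n *\<^sub>R cinner x (e n) *\<^sub>C e n + \<zeta> n *\<^sub>R cinner x (e n) *\<^sub>C e n)
      sums (blinfun_apply (diag_operator e \<eta>) x + blinfun_apply (diag_operator e \<zeta>) x)"
    unfolding diag_operator_eq by (intro sums_add weighted_operator_sums[OF E E c0_star_le] assms)
  then show "blinfun_apply (diag_operator e (\<lambda>n. \<eta> n + \<zeta> n)) x = blinfun_apply (diag_operator e \<eta> + diag_operator e \<zeta>) x"
    using weighted_operator_sums[OF E E c0_star_le[OF c0_star_add[OF assms]], of x]
    by (simp add: diag_operator_eq scaleR_add_left sums_unique2 blinfun.add_left)
qed

end

section \<open>Arithmetic means and dilations of sequences\<close>

lemma arith_mean_nonneg: "\<eta> \<in> c0_star \<Longrightarrow> 0 \<le> arith_mean \<eta> n"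
  unfolding arith_mean_def c0_star_def by (auto intro!: divide_nonneg_nonneg sum_nonneg)

lemma arith_mean_mono:
  assumes "\<And>j. \<eta> j \<le> c * \<zeta> j"
  shows "arith_mean \<eta> n \<le> c * arith_mean \<zeta> n"
proof -
  have "(\<Sum>j\<le>n. \<eta> j) \<le> c * (\<Sum>j\<le>n. \<zeta> j)" unfolding sum_distrib_left by (intro sum_mono assms)
  then show ?thesis unfolding arith_mean_def by (simp add: divide_right_mono)
qed

lemma c0_star_le_arith_mean:
  assumes "\<eta> \<in> c0_star"
  shows "\<eta> n \<le> arith_mean \<eta> n"
proof -
  have "(\<Sum>j\<le>n. \<eta> n) \<le> (\<Sum>j\<le>n. \<eta> j)"
    using assms unfolding c0_star_def decseq_def by (intro sum_mono) auto
  then show ?thesis unfolding arith_mean_def by (simp add: pos_le_divide_eq mult.commute)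
qed

text \<open>The shorter sum is at most the longer one, and the denominator shrinks at most by the
  factor 2. Closure of \<open>am_set\<close> under the dilation by 2 follows.\<close>

lemma arith_mean_half:
  assumes "\<eta> \<in> c0_star"
  shows "arith_mean \<eta> (n div 2) \<le> 2 * arith_mean \<eta> n"
proof -
  have nonneg: "0 \<le> \<eta> j" for j using assms unfolding c0_star_def by auto
  have S: "(\<Sum>j\<le>n div 2. \<eta> j) \<le> (\<Sum>j\<le>n. \<eta> j)" by (intro sum_mono2) (auto simp: nonneg)
  have "n + 1 \<le> 2 * (n div 2 + 1)" by presburger
  then have d: "real (n + 1) \<le> 2 * real (n div 2 + 1)" by linarith
  have "arith_mean \<eta> (n div 2) \<le> (\<Sum>j\<le>n. \<eta> j) / real (n div 2 + 1)"
    unfolding arith_mean_def by (intro divide_right_mono S) simp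
  also have "\<dots> \<le> (\<Sum>j\<le>n. \<eta> j) / (real (n + 1) / 2)"
    using d by (intro divide_left_mono sum_nonneg nonneg) auto
  finally show ?thesis unfolding arith_mean_def by (simp add: mult.commute)
qed

text \<open>The first \<open>(n + 1) * m\<close> terms of the dilated sequence form blocks of
  \<open>m\<close> equal terms, one for each of the first \<open>n + 1\<close> terms of
  \<xi>.\<close>

lemma arith_mean_dilation:
  assumes "\<xi> \<in> c0_star" "m > 0"
  shows "arith_mean (\<lambda>j. \<xi> (j div m)) n \<le> real m * arith_mean \<xi> n"
proof -
  have nonneg: "0 \<le> \<xi> j" for j using assms unfolding c0_star_def by auto
  have "(\<Sum>j\<le>n. \<xi> (j div m)) \<le> (\<Sum>j<(n + 1) * m. \<xi> (j div m))"
  proof (intro sum_mono2)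
    have "n + 1 \<le> (n + 1) * m" using assms(2) mult_le_mono2[of 1 m "n + 1"] by simp
    then show "{..n} \<subseteq> {..<(n + 1) * m}" by auto
  qed (auto simp: nonneg)
  also have "\<dots> = (\<Sum>i<n+1. \<Sum>j=i*m..<i*m+m. \<xi> (j div m))" by (rule sum.nat_group[symmetric])
  also have "\<dots> = (\<Sum>i<n+1. real m * \<xi> i)"
  proof (intro sum.cong refl)
    fix i
    have "j div m = i" if "j \<in> {i*m..<i*m+m}" for j
      using that assms(2) by (auto intro!: div_nat_eqI simp: mult.commute)
    then have "(\<Sum>j=i*m..<i*m+m. \<xi> (j div m)) = (\<Sum>j=i*m..<i*m+m. \<xi> i)" by (intro sum.cong) auto
    then show "(\<Sum>j=i*m..<i*m+m. \<xi> (j div m)) = real m * \<xi> i" by simp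
  qed
  also have "\<dots> = real m * (\<Sum>i\<le>n. \<xi> i)" by (simp add: sum_distrib_left lessThan_Suc_atMost)
  finally show ?thesis unfolding arith_mean_def by (simp add: divide_right_mono)
qed

definition am_set :: "(nat \<Rightarrow> real) set \<Rightarrow> (nat \<Rightarrow> real) set" where
  "am_set C = {\<xi> \<in> c0_star. \<exists>\<eta>\<in>C. \<exists>M. \<forall>n. \<xi> n \<le> M * arith_mean \<eta> n}"

text \<open>In indices from 0, \<open>n div m\<close> is the dilation D_m: the ceiling of (n+1)/m,
  minus 1, equals \<open>n div m\<close>.\<close>

definition dilation_set :: "(nat \<Rightarrow> real) \<Rightarrow> (nat \<Rightarrow> real) set" where
  "dilation_set \<xi> = {\<zeta> \<in> c0_star. \<exists>M m. 0 < m \<and> (\<forall>n. \<zeta> n \<le> M * \<xi> (n div m))}"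

lemma c0_star_half: "\<zeta> \<in> c0_star \<Longrightarrow> (\<lambda>n. \<zeta> (n div 2)) \<in> c0_star"
proof -
  assume \<zeta>: "\<zeta> \<in> c0_star"
  have "filterlim (\<lambda>n::nat. n div 2) sequentially sequentially"
    unfolding filterlim_at_top eventually_sequentially
    by (metis div_le_mono nonzero_mult_div_cancel_left zero_neq_numeral)
  then have "(\<lambda>n. \<zeta> (n div 2)) \<longlonglongrightarrow> 0" using \<zeta> unfolding c0_star_def by (auto intro: filterlim_compose)
  then show ?thesis using \<zeta> unfolding c0_star_def decseq_def by (auto simp: div_le_mono)
qed

text \<open>The constants in the O-relations are arbitrary reals; passing to absolute values makes
  them usable as monotone factors.\<close>

lemma le_abs_mult: "a \<le> M * b \<Longrightarrow> 0 \<le> b \<Longrightarrow> a \<le> \<bar>M\<bar> * (b::real)"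
  by (meson abs_ge_self mult_right_mono order_trans)

lemma characteristic_set_dilation_set:
  assumes \<xi>: "\<xi> \<in> c0_star"
  shows "characteristic_set (dilation_set \<xi>)"
proof -
  have nonneg: "0 \<le> \<xi> j" for j using \<xi> unfolding c0_star_def by auto
  have abs: "\<exists>M m. 0 < m \<and> 0 \<le> M \<and> (\<forall>n. \<zeta> n \<le> M * \<xi> (n div m))" if \<zeta>: "\<zeta> \<in> dilation_set \<xi>" for \<zeta>
  proof -
    obtain M m where "0 < m" "\<forall>n. \<zeta> n \<le> M * \<xi> (n div m)" using \<zeta> unfolding dilation_set_def by blast
    moreover from this have "\<forall>n. \<zeta> n \<le> \<bar>M\<bar> * \<xi> (n div m)" using le_abs_mult nonneg by blast
    ultimately show ?thesis using abs_ge_zero by blast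
  qed
  show ?thesis
    unfolding characteristic_set_def
  proof (intro conjI ballI allI impI)
    show "dilation_set \<xi> \<subseteq> c0_star" unfolding dilation_set_def by auto
    show "(\<lambda>_. 0) \<in> dilation_set \<xi>" unfolding dilation_set_def using c0_star_zero by (auto intro!: exI[of _ "0::real"] exI[of _ "1::nat"])
  next
    fix \<eta> \<zeta> M assume "\<eta> \<in> dilation_set \<xi>" and \<zeta>: "\<zeta> \<in> c0_star" "\<forall>n. \<zeta> n \<le> M * \<eta> n"
    then obtain L m where L: "0 < m" "0 \<le> L" "\<forall>n. \<eta> n \<le> L * \<xi> (n div m)" "\<eta> \<in> c0_star"
      using abs unfolding dilation_set_def by blast
    have "\<zeta> n \<le> (\<bar>M\<bar> * L) * \<xi> (n div m)" for n
    proof -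
      have "\<zeta> n \<le> \<bar>M\<bar> * \<eta> n" using \<zeta>(2) L(4) le_abs_mult unfolding c0_star_def by blast
      also have "\<dots> \<le> \<bar>M\<bar> * (L * \<xi> (n div m))" using L(3) by (intro mult_left_mono) auto
      finally show ?thesis by (simp add: mult.assoc)
    qed
    then show "\<zeta> \<in> dilation_set \<xi>" unfolding dilation_set_def using \<zeta>(1) L(1) by blast
  next
    fix \<eta> \<zeta> assume A: "\<eta> \<in> dilation_set \<xi>" "\<zeta> \<in> dilation_set \<xi>"
    then have c0: "\<eta> \<in> c0_star" "\<zeta> \<in> c0_star" unfolding dilation_set_def by simp_all
    obtain L m where L: "0 < m" "0 \<le> L" "\<forall>n. \<eta> n \<le> L * \<xi> (n div m)" using abs[OF A(1)] by blast
    obtain L' m' where L': "0 < m'" "0 \<le> L'" "\<forall>n. \<zeta> n \<le> L' * \<xi> (n div m')" using abs[OF A(2)] by blast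
    \<comment> \<open>For nonincreasing \<xi> a larger dilation gives a larger sequence, so the
      larger of the two factors serves both summands.\<close>
    define k where "k = max m m'"
    have dec: "\<xi> (n div l) \<le> \<xi> (n div k)" if "0 < l" "l \<le> k" for n l
      using \<xi> div_le_mono2[OF that(1,2)] unfolding c0_star_def decseq_def by blast
    have "\<eta> n + \<zeta> n \<le> (L + L') * \<xi> (n div k)" for n
    proof -
      have "L * \<xi> (n div m) \<le> L * \<xi> (n div k)" using L dec[of m n] by (intro mult_left_mono) (auto simp: k_def)
      moreover have "L' * \<xi> (n div m') \<le> L' * \<xi> (n div k)" using L' dec[of m' n] by (intro mult_left_mono) (auto simp: k_def)
      ultimately show ?thesis using L(3)[rule_format, of n] L'(3)[rule_format, of n] by (simp add: distrib_right)
    qed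
    moreover have "0 < k" using L by (simp add: k_def)
    ultimately show "(\<lambda>n. \<eta> n + \<zeta> n) \<in> dilation_set \<xi>"
      unfolding dilation_set_def using c0_star_add[OF c0] by blast
  next
    fix \<eta> assume "\<eta> \<in> dilation_set \<xi>"
    then obtain L m where L: "0 < m" "\<forall>n. \<eta> n \<le> L * \<xi> (n div m)" "\<eta> \<in> c0_star"
      unfolding dilation_set_def by blast
    then have "\<forall>n. \<eta> (n div 2) \<le> L * \<xi> (n div (2 * m))" by (simp add: div_mult2_eq)
    then show "(\<lambda>n. \<eta> (n div 2)) \<in> dilation_set \<xi>"
      unfolding dilation_set_def using c0_star_half[OF L(3)] L(1) by (auto intro!: exI[of _ L] exI[of _ "2 * m"])
  qed
qed

section \<open>Arithmetic means and hats of principal ideals\<close>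

context
  fixes e :: "nat \<Rightarrow> 'a::complex_hilbert_space"
  assumes e: "orthonormal_basis e"
begin

lemma characteristic_set_am_set:
  assumes J: "operator_ideal (J :: ('a \<Rightarrow>\<^sub>L 'a) set)"
  shows "characteristic_set (am_set (Sigma_set J))"
proof -
  note \<Sigma> = Sigma_set_eq[OF e J]
  have "diag_operator e (\<lambda>_. 0) = 0"
    unfolding diag_operator_eq
    by (rule blinfun_eqI) (simp add: weighted_operator_apply[OF basis_partial_orthonormal[OF e] basis_partial_orthonormal[OF e], of _ 0])
  then have zero: "(\<lambda>_. 0) \<in> Sigma_set J" unfolding \<Sigma> using c0_star_zero operator_idealD(2)[OF J] by simp
  have abs: "\<exists>\<theta>\<in>Sigma_set J. \<exists>M\<ge>0. \<theta> \<in> c0_star \<and> (\<forall>n. \<zeta> n \<le> M * arith_mean \<theta> n)" if \<zeta>: "\<zeta> \<in> am_set (Sigma_set J)" for \<zeta>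
  proof -
    obtain \<theta> M where \<theta>: "\<theta> \<in> Sigma_set J" "\<forall>n. \<zeta> n \<le> M * arith_mean \<theta> n" using \<zeta> unfolding am_set_def by blast
    then have "\<theta> \<in> c0_star" unfolding \<Sigma> by simp
    moreover have "\<forall>n. \<zeta> n \<le> \<bar>M\<bar> * arith_mean \<theta> n" using \<theta> le_abs_mult arith_mean_nonneg[OF \<open>\<theta> \<in> c0_star\<close>] by blast
    ultimately show ?thesis using \<theta>(1) abs_ge_zero by blast
  qed
  have c0: "\<zeta> \<in> c0_star" if "\<zeta> \<in> am_set (Sigma_set J)" for \<zeta> using that unfolding am_set_def by simp
  show ?thesis
    unfolding characteristic_set_def
  proof (intro conjI ballI allI impI)
    show "am_set (Sigma_set J) \<subseteq> c0_star" using c0 by blast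
    show "(\<lambda>_. 0) \<in> am_set (Sigma_set J)"
      unfolding am_set_def using c0_star_zero zero by (auto intro!: bexI[OF _ zero] exI[of _ 0])
  next
    fix \<eta> \<zeta> M assume "\<eta> \<in> am_set (Sigma_set J)" and \<zeta>: "\<zeta> \<in> c0_star" "\<forall>n. \<zeta> n \<le> M * \<eta> n"
    then obtain \<theta> L where \<theta>: "\<theta> \<in> Sigma_set J" "\<forall>n. \<eta> n \<le> L * arith_mean \<theta> n" "\<eta> \<in> c0_star" using abs c0 by blast
    have "\<zeta> n \<le> (\<bar>M\<bar> * L) * arith_mean \<theta> n" for n
    proof -
      have "\<zeta> n \<le> \<bar>M\<bar> * \<eta> n" using \<zeta>(2) \<theta>(3) le_abs_mult unfolding c0_star_def by blast
      also have "\<dots> \<le> \<bar>M\<bar> * (L * arith_mean \<theta> n)" using \<theta>(2) by (intro mult_left_mono) auto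
      finally show ?thesis by (simp add: mult.assoc)
    qed
    then show "\<zeta> \<in> am_set (Sigma_set J)" unfolding am_set_def using \<zeta>(1) \<theta>(1) by blast
  next
    fix \<eta> \<zeta> assume A: "\<eta> \<in> am_set (Sigma_set J)" "\<zeta> \<in> am_set (Sigma_set J)"
    obtain \<theta> L where \<theta>: "\<theta> \<in> Sigma_set J" "L \<ge> 0" "\<theta> \<in> c0_star" "\<forall>n. \<eta> n \<le> L * arith_mean \<theta> n" using abs[OF A(1)] by blast
    obtain \<theta>' L' where \<theta>': "\<theta>' \<in> Sigma_set J" "L' \<ge> 0" "\<theta>' \<in> c0_star" "\<forall>n. \<zeta> n \<le> L' * arith_mean \<theta>' n" using abs[OF A(2)] by blast
    have "(\<lambda>n. \<theta> n + \<theta>' n) \<in> Sigma_set J"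
      using \<theta>(1) \<theta>'(1) operator_idealD(3)[OF J] diag_operator_add[OF e \<theta>(3) \<theta>'(3)] c0_star_add[OF \<theta>(3) \<theta>'(3)] unfolding \<Sigma> by simp
    moreover have "\<eta> n + \<zeta> n \<le> (L + L') * arith_mean (\<lambda>n. \<theta> n + \<theta>' n) n" for n
    proof -
      have "arith_mean (\<lambda>n. \<theta> n + \<theta>' n) n = arith_mean \<theta> n + arith_mean \<theta>' n"
        unfolding arith_mean_def by (simp add: sum.distrib add_divide_distrib)
      moreover have "0 \<le> L * arith_mean \<theta>' n" "0 \<le> L' * arith_mean \<theta> n"
        using \<theta>(2) \<theta>'(2) arith_mean_nonneg[OF \<theta>(3)] arith_mean_nonneg[OF \<theta>'(3)] by simp_all
      ultimately show ?thesis using \<theta>(4)[rule_format, of n] \<theta>'(4)[rule_format, of n] by (simp add: algebra_simps)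
    qed
    ultimately show "(\<lambda>n. \<eta> n + \<zeta> n) \<in> am_set (Sigma_set J)"
      unfolding am_set_def using c0_star_add[OF c0[OF A(1)] c0[OF A(2)]] by blast
  next
    fix \<eta> assume A: "\<eta> \<in> am_set (Sigma_set J)"
    obtain \<theta> L where \<theta>: "\<theta> \<in> Sigma_set J" "L \<ge> 0" "\<theta> \<in> c0_star" "\<forall>n. \<eta> n \<le> L * arith_mean \<theta> n" using abs[OF A] by blast
    have "\<eta> (n div 2) \<le> (L * 2) * arith_mean \<theta> n" for n
      using \<theta>(4)[rule_format, of "n div 2"] mult_left_mono[OF arith_mean_half[OF \<theta>(3)] \<theta>(2), of n] by (simp add: mult.assoc)
    then show "(\<lambda>n. \<eta> (n div 2)) \<in> am_set (Sigma_set J)"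
      unfolding am_set_def using c0_star_half[OF c0[OF A]] \<theta>(1) by blast
  qed
qed

text \<open>The definite description has a value because the prescribed set is characteristic; it is
  unique because an ideal is recovered from its set of s-number sequences.\<close>

lemma am_ideal_eq:
  assumes J: "operator_ideal (J :: ('a \<Rightarrow>\<^sub>L 'a) set)"
  shows "am_ideal J = ideal_of (am_set (Sigma_set J))"
  unfolding am_ideal_def am_set_def[symmetric]
proof (rule the_equality)
  note C = characteristic_set_am_set[OF J]
  show "operator_ideal (ideal_of (am_set (Sigma_set J)) :: ('a \<Rightarrow>\<^sub>L 'a) set)
      \<and> Sigma_set (ideal_of (am_set (Sigma_set J)) :: ('a \<Rightarrow>\<^sub>L 'a) set) = am_set (Sigma_set J)"
    using operator_ideal_ideal_of[OF C] Sigma_set_ideal_of[OF e C] by blast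
  fix J' :: "('a \<Rightarrow>\<^sub>L 'a) set" assume "operator_ideal J' \<and> Sigma_set J' = am_set (Sigma_set J)"
  then show "J' = ideal_of (am_set (Sigma_set J))" using ideal_of_Sigma_set[OF e, of J'] by simp
qed

lemma principal_ideal_subset: "operator_ideal J \<Longrightarrow> diag_operator e \<xi> \<in> J \<Longrightarrow> principal_ideal e \<xi> \<subseteq> J"
  unfolding principal_ideal_def by blast

lemma diag_operator_in_principal_ideal: "diag_operator e \<xi> \<in> principal_ideal e \<xi>"
  unfolding principal_ideal_def by blast

lemma operator_ideal_principal_ideal:
  assumes "\<xi> \<in> c0_star"
  shows "operator_ideal (principal_ideal e \<xi>)"
  unfolding operator_ideal_def
proof (intro conjI ballI)
  show "principal_ideal e \<xi> \<subseteq> compact_operators"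
    by (rule principal_ideal_subset[OF operator_ideal_compact_operators diag_operator_compact[OF e assms]])
qed (auto simp: principal_ideal_def operator_idealD)

text \<open>The dilations of \<xi> define an ideal containing the diagonal operator of \<xi>, so it
  is one of the ideals whose intersection is the principal ideal.\<close>

lemma Sigma_set_principal_ideal_subset:
  assumes \<xi>: "\<xi> \<in> c0_star"
  shows "Sigma_set (principal_ideal e \<xi>) \<subseteq> dilation_set \<xi>"
proof -
  note C = characteristic_set_dilation_set[OF \<xi>]
  have "\<xi> \<in> dilation_set \<xi>" unfolding dilation_set_def using \<xi> by (auto intro!: exI[of _ 1])
  then have "diag_operator e \<xi> \<in> ideal_of (dilation_set \<xi>)"
    unfolding ideal_of_def using s_numbers_diag_operator[OF e \<xi>] diag_operator_compact[OF e \<xi>] by simp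
  then have "principal_ideal e \<xi> \<subseteq> ideal_of (dilation_set \<xi>)"
    by (rule principal_ideal_subset[OF operator_ideal_ideal_of[OF C]])
  then show ?thesis unfolding Sigma_set_def ideal_of_def by blast
qed

text \<open>Dilating \<xi> by \<open>m\<close> enlarges the means at most by the factor
  \<open>m\<close>. Hence the arithmetic mean of the ideal generated by \<xi> is controlled by
  \<xi>_a itself.\<close>

lemma arith_mean_Sigma_set_principal_ideal:
  assumes \<xi>: "\<xi> \<in> c0_star" and \<theta>: "\<theta> \<in> Sigma_set (principal_ideal e \<xi>)"
  shows "\<exists>M\<ge>0. \<forall>n. arith_mean \<theta> n \<le> M * arith_mean \<xi> n"
proof -
  obtain M m where M: "0 < m" "\<forall>n. \<theta> n \<le> M * \<xi> (n div m)"
    using Sigma_set_principal_ideal_subset[OF \<xi>] \<theta> unfolding dilation_set_def by blast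
  have "arith_mean \<theta> n \<le> (\<bar>M\<bar> * real m) * arith_mean \<xi> n" for n
  proof -
    have "\<theta> j \<le> \<bar>M\<bar> * \<xi> (j div m)" for j using M(2) le_abs_mult \<xi> unfolding c0_star_def by blast
    then have "arith_mean \<theta> n \<le> \<bar>M\<bar> * arith_mean (\<lambda>j. \<xi> (j div m)) n" by (rule arith_mean_mono)
    also have "\<dots> \<le> \<bar>M\<bar> * (real m * arith_mean \<xi> n)"
      by (intro mult_left_mono arith_mean_dilation \<xi> M) simp
    finally show ?thesis by (simp add: mult.assoc)
  qed
  then show ?thesis by (intro exI[of _ "\<bar>M\<bar> * real m"]) auto
qed

lemma am_set_principal_ideal:
  assumes \<xi>: "\<xi> \<in> c0_star" and \<zeta>: "\<zeta> \<in> am_set (Sigma_set (principal_ideal e \<xi>))"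
  shows "\<exists>M\<ge>0. \<forall>n. \<zeta> n \<le> M * arith_mean \<xi> n"
proof -
  obtain \<theta> L where \<theta>: "\<theta> \<in> Sigma_set (principal_ideal e \<xi>)" "\<forall>n. \<zeta> n \<le> L * arith_mean \<theta> n"
    using \<zeta> unfolding am_set_def by blast
  then have "\<theta> \<in> c0_star" unfolding Sigma_set_eq[OF e operator_ideal_principal_ideal[OF \<xi>]] by simp
  obtain M where M: "M \<ge> 0" "\<forall>n. arith_mean \<theta> n \<le> M * arith_mean \<xi> n"
    using arith_mean_Sigma_set_principal_ideal[OF \<xi> \<theta>(1)] by blast
  have "\<zeta> n \<le> (\<bar>L\<bar> * M) * arith_mean \<xi> n" for n
  proof -
    have "\<zeta> n \<le> \<bar>L\<bar> * arith_mean \<theta> n" using \<theta>(2) le_abs_mult arith_mean_nonneg[OF \<open>\<theta> \<in> c0_star\<close>] by blast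
    also have "\<dots> \<le> \<bar>L\<bar> * (M * arith_mean \<xi> n)" using M(2) by (intro mult_left_mono) auto
    finally show ?thesis by (simp add: mult.assoc)
  qed
  then show ?thesis using M(1) by (intro exI[of _ "\<bar>L\<bar> * M"]) auto
qed

text \<open>Domination of the means puts the ideal generated by \<eta> among those intersected in
  the hat. This turns the hypothesis on the hat into upper bounds for \<xi>.\<close>

lemma hat_ideal_principal_subset:
  assumes \<xi>: "\<xi> \<in> c0_star" and \<eta>: "\<eta> \<in> c0_star" and dom: "\<And>n. arith_mean \<xi> n \<le> c * arith_mean \<eta> n"
  shows "hat_ideal (principal_ideal e \<xi>) \<subseteq> principal_ideal e \<eta>"
proof -
  note I = operator_ideal_principal_ideal[OF \<xi>] and J = operator_ideal_principal_ideal[OF \<eta>]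
  have \<eta>J: "\<eta> \<in> Sigma_set (principal_ideal e \<eta>)"
    unfolding Sigma_set_eq[OF e J] using \<eta> diag_operator_in_principal_ideal by simp
  have "am_set (Sigma_set (principal_ideal e \<xi>)) \<subseteq> am_set (Sigma_set (principal_ideal e \<eta>))"
  proof
    fix \<zeta> assume \<zeta>: "\<zeta> \<in> am_set (Sigma_set (principal_ideal e \<xi>))"
    then obtain M where M: "M \<ge> 0" "\<forall>n. \<zeta> n \<le> M * arith_mean \<xi> n" using am_set_principal_ideal[OF \<xi>] by blast
    have "\<zeta> n \<le> (M * c) * arith_mean \<eta> n" for n
      using M(2)[rule_format, of n] mult_left_mono[OF dom M(1), of n] by (simp add: mult.assoc)
    then show "\<zeta> \<in> am_set (Sigma_set (principal_ideal e \<eta>))" using \<zeta> \<eta>J unfolding am_set_def by blast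
  qed
  then have "am_ideal (principal_ideal e \<xi>) \<subseteq> am_ideal (principal_ideal e \<eta>)"
    unfolding am_ideal_eq[OF I] am_ideal_eq[OF J] ideal_of_def by blast
  then show ?thesis unfolding hat_ideal_def using J by blast
qed

lemma am_ideal_principal_regular:
  assumes \<xi>: "\<xi> \<in> c0_star" and reg: "\<And>n. arith_mean \<xi> n \<le> C * \<xi> n"
  shows "am_ideal (principal_ideal e \<xi>) = principal_ideal e \<xi>"
proof -
  note I = operator_ideal_principal_ideal[OF \<xi>]
  note \<Sigma> = Sigma_set_eq[OF e I]
  have "am_set (Sigma_set (principal_ideal e \<xi>)) = Sigma_set (principal_ideal e \<xi>)"
  proof
    show "am_set (Sigma_set (principal_ideal e \<xi>)) \<subseteq> Sigma_set (principal_ideal e \<xi>)"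
    proof
      fix \<zeta> assume \<zeta>: "\<zeta> \<in> am_set (Sigma_set (principal_ideal e \<xi>))"
      then have c0: "\<zeta> \<in> c0_star" unfolding am_set_def by simp
      obtain M where M: "M \<ge> 0" "\<forall>n. \<zeta> n \<le> M * arith_mean \<xi> n" using am_set_principal_ideal[OF \<xi> \<zeta>] by blast
      have "\<zeta> n \<le> (M * C) * \<xi> n" for n
        using M(2)[rule_format, of n] mult_left_mono[OF reg M(1), of n] by (simp add: mult.assoc)
      then have "diag_operator e \<zeta> \<in> principal_ideal e \<xi>"
        by (rule operator_ideal_hereditary[OF e I diag_operator_in_principal_ideal \<xi> c0])
      then show "\<zeta> \<in> Sigma_set (principal_ideal e \<xi>)" unfolding \<Sigma> using c0 by simp
    qed
    show "Sigma_set (principal_ideal e \<xi>) \<subseteq> am_set (Sigma_set (principal_ideal e \<xi>))"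
    proof
      fix \<zeta> assume \<zeta>: "\<zeta> \<in> Sigma_set (principal_ideal e \<xi>)"
      then have c0: "\<zeta> \<in> c0_star" unfolding \<Sigma> by simp
      have "\<forall>n. \<zeta> n \<le> 1 * arith_mean \<zeta> n" using c0_star_le_arith_mean[OF c0] by simp
      then show "\<zeta> \<in> am_set (Sigma_set (principal_ideal e \<xi>))" unfolding am_set_def using \<zeta> c0 by blast
    qed
  qed
  then show ?thesis unfolding am_ideal_eq[OF I] by (simp add: ideal_of_Sigma_set[OF e I])
qed

end

section \<open>Finite rank operators\<close>

lemma Gram_Schmidt:
  assumes "finite B"
  shows "\<exists>O'. finite O' \<and> (\<forall>a\<in>O'. \<forall>b\<in>O'. cinner a b = (if a = b then 1 else 0))
    \<and> complex_vector.span B \<subseteq> complex_vector.span (O' :: 'a::complex_hilbert_space set)"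
  using assms
proof (induction B rule: finite_induct)
  case empty
  then show ?case by (intro exI[of _ "{}"]) auto
next
  case (insert x B)
  then obtain O' where O': "finite O'" "\<forall>a\<in>O'. \<forall>b\<in>O'. cinner a b = (if a = b then 1 else 0)"
    "complex_vector.span B \<subseteq> complex_vector.span O'" by blast
  have BO: "B \<subseteq> complex_vector.span O'" using O'(3) complex_vector.span_superset by blast
  define y where "y = (\<Sum>b\<in>O'. cinner x b *\<^sub>C b)"
  define z where "z = x - y"
  have y: "y \<in> complex_vector.span O'"
    unfolding y_def by (intro complex_vector.span_sum complex_vector.span_scale complex_vector.span_base)
  have zb: "cinner z b = 0" if "b \<in> O'" for b
  proof -
    have "cinner y b = (\<Sum>a\<in>O'. if a = b then cinner x b else 0)"
      unfolding y_def cinner_sum_left using O'(2) that by (intro sum.cong) (auto simp: cinner_scaleC_left)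
    then show ?thesis using that O'(1) by (simp add: z_def cinner_diff_left)
  qed
  show ?case
  proof (cases "z = 0")
    case True
    then have "insert x B \<subseteq> complex_vector.span O'" using y BO by (simp add: z_def)
    then have "complex_vector.span (insert x B) \<subseteq> complex_vector.span O'"
      by (intro complex_vector.span_minimal complex_vector.subspace_span)
    then show ?thesis using O' by blast
  next
    case False
    define w where "w = (1 / norm z) *\<^sub>R z"
    have ww: "cinner w w = 1" using False by (simp add: cinner_self w_def)
    have wb: "cinner w b = 0" if "b \<in> O'" for b using zb[OF that] by (simp add: w_def cinner_scaleR_left)
    then have bw: "cinner b w = 0" if "b \<in> O'" for b using that by (metis cinner_commute complex_cnj_zero)
    have "w \<notin> O'" using ww wb by fastforce
    have "x = of_real (norm z) *\<^sub>C w + y" using False by (simp add: w_def z_def flip: scaleR_scaleC)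
    moreover have "y \<in> complex_vector.span (insert w O')"
      using y complex_vector.span_mono[of O' "insert w O'"] by blast
    ultimately have "x \<in> complex_vector.span (insert w O')"
      by (simp add: complex_vector.span_add complex_vector.span_scale complex_vector.span_base)
    moreover have "B \<subseteq> complex_vector.span (insert w O')"
      using BO complex_vector.span_mono[of O' "insert w O'"] by blast
    ultimately have "complex_vector.span (insert x B) \<subseteq> complex_vector.span (insert w O')"
      by (intro complex_vector.span_minimal complex_vector.subspace_span) auto
    moreover have "\<forall>a\<in>insert w O'. \<forall>b\<in>insert w O'. cinner a b = (if a = b then 1 else 0)"
      using O'(2) ww wb bw \<open>w \<notin> O'\<close> by auto
    ultimately show ?thesis using O'(1) by (intro exI[of _ "insert w O'"]) auto
  qed
qed

text \<open>If P is the orthogonal projection onto a finite-dimensional space containing the range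
  of \<open>X\<close>, then P X = X, and P is a sum of rank-one projections.\<close>

lemma finite_rank_in_ideal:
  fixes J :: "('a::complex_hilbert_space \<Rightarrow>\<^sub>L 'a) set"
  assumes zero: "0 \<in> J" and add: "\<And>X Y. X \<in> J \<Longrightarrow> Y \<in> J \<Longrightarrow> X + Y \<in> J"
    and comp: "\<And>X A. X \<in> J \<Longrightarrow> A \<in> bounded_operators \<Longrightarrow> X o\<^sub>L A \<in> J"
    and rank_one: "\<And>b. norm b = 1 \<Longrightarrow> rank_one b b \<in> J"
  shows "finite_rank_operators \<subseteq> J"
proof
  fix X :: "'a \<Rightarrow>\<^sub>L 'a" assume "X \<in> finite_rank_operators"
  then obtain B where X: "X \<in> bounded_operators" and B: "finite B" "range (blinfun_apply X) \<subseteq> complex_vector.span B"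
    unfolding finite_rank_operators_def by blast
  obtain O' where O': "finite O'" "\<forall>a\<in>O'. \<forall>b\<in>O'. cinner a b = (if a = b then 1 else 0)"
    "complex_vector.span B \<subseteq> complex_vector.span (O' :: 'a set)" using Gram_Schmidt[OF B(1)] by blast
  \<comment> \<open>The fixed points of the projection: a subspace containing \<open>O'\<close>,
    hence containing its span and the range of \<open>X\<close>.\<close>
  let ?E = "{y. y = (\<Sum>b\<in>O'. cinner y b *\<^sub>C b)}"
  have "complex_vector.span O' \<subseteq> ?E"
  proof (rule complex_vector.span_minimal)
    show "O' \<subseteq> ?E"
    proof
      fix a assume "a \<in> O'"
      then have "(\<Sum>b\<in>O'. cinner a b *\<^sub>C b) = (\<Sum>b\<in>O'. if b = a then a else 0)"
        using O'(2) by (intro sum.cong) (auto simp: scaleC_one)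
      then show "a \<in> ?E" using \<open>a \<in> O'\<close> O'(1) by simp
    qed
    define P where "P y = (\<Sum>b\<in>O'. cinner y b *\<^sub>C b)" for y
    have "P (x + y) = P x + P y" for x y
      unfolding P_def by (simp add: cinner_add_left scaleC_add_left sum.distrib)
    moreover have "P (c *\<^sub>C x) = c *\<^sub>C P x" for x c
      unfolding P_def complex_vector.scale_sum_right by (simp add: cinner_scaleC_left)
    moreover have "P 0 = 0" unfolding P_def by simp
    ultimately show "complex_vector.subspace ?E"
      unfolding complex_vector.subspace_def P_def[symmetric] by auto
  qed
  then have "blinfun_apply X x = (\<Sum>b\<in>O'. cinner (blinfun_apply X x) b *\<^sub>C b)" for x using B(2) O'(3) by blast
  then have "X = (\<Sum>b\<in>O'. rank_one b b o\<^sub>L X)"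
    by (intro blinfun_eqI) (simp add: blinfun.sum_left)
  moreover have "(\<Sum>b\<in>O'. rank_one b b o\<^sub>L X) \<in> J"
  proof -
    have "rank_one b b o\<^sub>L X \<in> J" if "b \<in> O'" for b
    proof -
      have "cinner b b = 1" using O'(2) that by simp
      then have "(norm b)\<^sup>2 = 1" by (simp add: norm_sq_eq_cinner)
      then have "norm b = 1" by (metis norm_ge_zero one_power2 power2_eq_imp_eq zero_le_one)
      then show ?thesis by (intro comp rank_one X)
    qed
    note summand = this
    have "(\<Sum>b\<in>F. rank_one b b o\<^sub>L X) \<in> J" if "finite F" "F \<subseteq> O'" for F
      using that by (induction F rule: finite_induct) (auto simp: zero summand intro!: add)
    then show ?thesis using O'(1) by blast
  qed
  ultimately show "X \<in> J" by simp
qed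

lemma operator_ideal_finite_rank: "operator_ideal (finite_rank_operators :: ('a::complex_hilbert_space \<Rightarrow>\<^sub>L 'a) set)"
  unfolding operator_ideal_def
proof (intro conjI ballI)
  show "finite_rank_operators \<subseteq> (compact_operators :: ('a \<Rightarrow>\<^sub>L 'a) set)"
    by (intro finite_rank_in_ideal zero_compact_operator compact_operators_add compact_operators_compose_right rank_one_compact)
  show "(0 :: 'a \<Rightarrow>\<^sub>L 'a) \<in> finite_rank_operators"
    unfolding finite_rank_operators_def using bounded_operators_zero by (auto intro!: exI[of _ "{}"])
next
  fix X Y :: "'a \<Rightarrow>\<^sub>L 'a" assume "X \<in> finite_rank_operators" "Y \<in> finite_rank_operators"
  then obtain B B' where B: "X \<in> bounded_operators" "finite B" "range (blinfun_apply X) \<subseteq> complex_vector.span B"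
    "Y \<in> bounded_operators" "finite B'" "range (blinfun_apply Y) \<subseteq> complex_vector.span B'"
    unfolding finite_rank_operators_def by blast
  have "blinfun_apply (X + Y) x \<in> complex_vector.span (B \<union> B')" for x
  proof -
    have "blinfun_apply X x \<in> complex_vector.span (B \<union> B')" "blinfun_apply Y x \<in> complex_vector.span (B \<union> B')"
      using B(3,6) complex_vector.span_mono[of B "B \<union> B'"] complex_vector.span_mono[of B' "B \<union> B'"] by blast+
    then show ?thesis by (simp add: blinfun.add_left complex_vector.span_add)
  qed
  then show "X + Y \<in> finite_rank_operators"
    unfolding finite_rank_operators_def using bounded_operators_add[OF B(1,4)] B(2,5)
    by (auto intro!: exI[of _ "B \<union> B'"])
next
  fix X A :: "'a \<Rightarrow>\<^sub>L 'a" assume "X \<in> finite_rank_operators" and A: "A \<in> bounded_operators"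
  then obtain B where B: "X \<in> bounded_operators" "finite B" "range (blinfun_apply X) \<subseteq> complex_vector.span B"
    unfolding finite_rank_operators_def by blast
  have "complex_vector.span B \<subseteq> {x. blinfun_apply A x \<in> complex_vector.span (blinfun_apply A ` B)}"
    by (rule complex_vector.span_minimal)
      (auto simp: complex_vector.subspace_def complex_vector.span_base complex_vector.span_zero blinfun.add_right
        complex_vector.span_add complex_vector.span_scale bounded_operators_scaleC[OF A])
  then have "range (blinfun_apply (A o\<^sub>L X)) \<subseteq> complex_vector.span (blinfun_apply A ` B)" using B(3) by auto
  then show "A o\<^sub>L X \<in> finite_rank_operators"
    unfolding finite_rank_operators_def using bounded_operators_compose[OF A B(1)] B(2) by blast
  have "range (blinfun_apply (X o\<^sub>L A)) \<subseteq> complex_vector.span B" using B(3) by auto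
  then show "X o\<^sub>L A \<in> finite_rank_operators"
    unfolding finite_rank_operators_def using bounded_operators_compose[OF B(1) A] B(2) by blast
qed

lemma diag_operator_apply_basis:
  assumes e: "orthonormal_basis e" and \<xi>: "\<xi> \<in> c0_star"
  shows "blinfun_apply (diag_operator e \<xi>) (e n) = \<xi> n *\<^sub>R e n"
  unfolding diag_operator_eq
  using weighted_operator_apply_right[OF basis_partial_orthonormal[OF e] basis_partial_orthonormal[OF e] c0_star_le[OF \<xi>]]
  by (simp add: basis_nonzero[OF e])

lemma finite_rank_subset_principal_ideal:
  assumes e: "orthonormal_basis e" and \<xi>: "\<xi> \<in> c0_star" "\<xi> 0 > 0"
  shows "finite_rank_operators \<subseteq> principal_ideal e \<xi>"
proof (rule finite_rank_in_ideal)
  note I = operator_ideal_principal_ideal[OF e \<xi>(1)]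
  fix b :: 'a
  \<comment> \<open>The operator is routed through \<open>e 0\<close>, where the diagonal operator
    acts as multiplication by \<open>\<xi> 0\<close>; the factor \<open>1 / \<xi> 0\<close>
    compensates for this.\<close>
  have "rank_one b b = rank_one (e 0) ((1 / \<xi> 0) *\<^sub>R b) o\<^sub>L (diag_operator e \<xi> o\<^sub>L rank_one b (e 0))"
  proof (rule blinfun_eqI)
    fix x
    have "cinner (e 0) (e 0) = 1" using e unfolding orthonormal_basis_def by simp
    then have "cinner (blinfun_apply (diag_operator e \<xi>) (cinner x b *\<^sub>C e 0)) (e 0) = cinner x b * of_real (\<xi> 0)"
      unfolding bounded_operators_scaleC[OF compact_operator_bounded[OF diag_operator_compact[OF e \<xi>(1)]]]
        diag_operator_apply_basis[OF e \<xi>(1)] by (simp add: cinner_scaleC_left cinner_scaleR_left)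
    moreover have "(cinner x b * of_real (\<xi> 0)) *\<^sub>C (1 / \<xi> 0) *\<^sub>R b = cinner x b *\<^sub>C b"
      using \<xi>(2) unfolding scaleR_scaleC scaleC_scaleC by simp
    ultimately show "blinfun_apply (rank_one b b) x = blinfun_apply (rank_one (e 0) ((1 / \<xi> 0) *\<^sub>R b) o\<^sub>L (diag_operator e \<xi> o\<^sub>L rank_one b (e 0))) x"
      by simp
  qed
  then show "rank_one b b \<in> principal_ideal e \<xi>"
    using operator_idealD(4)[OF I operator_idealD(5)[OF I diag_operator_in_principal_ideal[OF e] rank_one_bounded] rank_one_bounded] by metis
qed (rule operator_idealD[OF operator_ideal_principal_ideal[OF e \<xi>(1)]]; assumption)+

lemma principal_ideal_delta_finite_rank:
  assumes e: "orthonormal_basis e"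
  shows "principal_ideal e (\<lambda>n. if n = 0 then 1 else 0) \<subseteq> finite_rank_operators"
proof (rule principal_ideal_subset[OF e operator_ideal_finite_rank])
  note E = basis_partial_orthonormal[OF e]
  have b: "\<forall>n::nat. \<bar>if n = 0 then 1 else 0\<bar> \<le> (1::real)" by simp
  have "blinfun_apply (diag_operator e (\<lambda>n. if n = 0 then 1 else 0)) x = cinner x (e 0) *\<^sub>C e 0" for x
  proof -
    have "(\<lambda>n. (if n = 0 then 1 else 0) *\<^sub>R cinner x (e n) *\<^sub>C e n) = (\<lambda>n. if n = 0 then cinner x (e 0) *\<^sub>C e 0 else 0)" by auto
    then show ?thesis
      using weighted_operator_sums[OF E E b, of x] sums_single[of 0 "\<lambda>_. cinner x (e 0) *\<^sub>C e 0"]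
      unfolding diag_operator_eq by (simp only: sums_unique2)
  qed
  then have "range (blinfun_apply (diag_operator e (\<lambda>n. if n = 0 then 1 else 0))) \<subseteq> complex_vector.span {e 0}"
    by (auto intro: complex_vector.span_scale complex_vector.span_base)
  then show "diag_operator e (\<lambda>n. if n = 0 then 1 else 0) \<in> finite_rank_operators"
    unfolding finite_rank_operators_def diag_operator_eq using weighted_operator_bounded[OF E E b] by blast
qed

section \<open>Domination of arithmetic means\<close>

lemma partial_average_antimono:
  fixes S :: "nat \<Rightarrow> real"
  assumes "\<xi> \<in> c0_star" "S = (\<lambda>n. \<Sum>j<n. \<xi> j)" "0 < m" "m \<le> n"
  shows "S n / real n \<le> S m / real m"
proof -
  have "S n = S m + (\<Sum>j=m..<n. \<xi> j)"
    using assms(4) unfolding assms(2) by (metis atLeast0LessThan sum.atLeastLessThan_concat zero_le)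
  also have "(\<Sum>j=m..<n. \<xi> j) \<le> (\<Sum>j=m..<n. \<xi> m)"
    using assms(1) unfolding c0_star_def decseq_def by (intro sum_mono) auto
  also have "\<dots> = real (n - m) * \<xi> m" by simp
  finally have 1: "S n \<le> S m + real (n - m) * \<xi> m" by simp
  have "(\<Sum>j<m. \<xi> m) \<le> S m"
    using assms(1) unfolding assms(2) c0_star_def decseq_def by (intro sum_mono) auto
  then have "real m * \<xi> m \<le> S m" by simp
  then have "real (n - m) * (real m * \<xi> m) \<le> real (n - m) * S m" by (intro mult_left_mono) auto
  with mult_left_mono[OF 1, of "real m"] have "real m * S n \<le> real m * S m + real (n - m) * S m"
    by (simp add: algebra_simps)
  also have "\<dots> = real n * S m" using assms(4) by (simp add: of_nat_diff algebra_simps)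
  finally show ?thesis using assms(3,4) by (simp add: divide_le_eq pos_le_divide_eq field_simps)
qed

lemma partial_average_tendsto_zero:
  assumes \<xi>: "\<xi> \<in> c0_star" and \<epsilon>: "\<epsilon> > 0"
  obtains K where "0 < K" "\<And>n. n \<ge> K \<Longrightarrow> (\<Sum>j<n. \<xi> j) < \<epsilon> * real n"
proof -
  have nonneg: "0 \<le> \<xi> j" for j using \<xi> unfolding c0_star_def by auto
  have "\<forall>\<^sub>F j in sequentially. \<xi> j < \<epsilon> / 2"
    using order_tendstoD(2)[of \<xi> 0 sequentially "\<epsilon> / 2"] \<xi> \<epsilon> unfolding c0_star_def by simp
  then obtain N where N: "\<And>j. j \<ge> N \<Longrightarrow> \<xi> j < \<epsilon> / 2" unfolding eventually_sequentially by blast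
  define A where "A = (\<Sum>j<N. \<xi> j)"
  obtain K where K: "real K > 2 * A / \<epsilon>" using reals_Archimedean2 by blast
  show thesis
  proof
    show "0 < max N (K + 1)" by simp
    fix n assume n: "n \<ge> max N (K + 1)"
    then have "(\<Sum>j<n. \<xi> j) = A + (\<Sum>j=N..<n. \<xi> j)"
      unfolding A_def by (metis atLeast0LessThan max.bounded_iff sum.atLeastLessThan_concat zero_le)
    also have "(\<Sum>j=N..<n. \<xi> j) \<le> (\<Sum>j=N..<n. \<epsilon> / 2)"
      using N by (intro sum_mono) (auto intro: less_imp_le)
    also have "\<dots> \<le> real n * (\<epsilon> / 2)" using \<epsilon> by (simp add: mult_right_mono)
    finally have "(\<Sum>j<n. \<xi> j) \<le> A + real n * (\<epsilon> / 2)" by simp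
    moreover have "2 * A / \<epsilon> < real n" using K n by simp
    then have "A < real n * (\<epsilon> / 2)" using \<epsilon> by (simp add: field_simps)
    ultimately show "(\<Sum>j<n. \<xi> j) < \<epsilon> * real n" by (simp add: field_simps)
  qed
qed

lemma not_summable_partial_sums_unbounded:
  assumes "\<xi> \<in> c0_star" "\<not> summable \<xi>"
  obtains n where "(\<Sum>j<n. \<xi> j) > (B :: real)"
proof -
  have "\<exists>n. (\<Sum>j<n. \<xi> j) > B"
  proof (rule ccontr)
    assume "\<not> ?thesis"
    then have "(\<Sum>j\<le>n. \<xi> j) \<le> B" for n by (metis lessThan_Suc_atMost not_le)
    then have "summable \<xi>"
      using assms(1) unfolding c0_star_def by (intro bounded_imp_summable[of \<xi> B]) auto
    with assms(2) show False by simp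
  qed
  then show thesis using that by blast
qed

text \<open>Suppose the average over the first \<open>K\<close> terms exceeds \<open>\<xi>\<close> by a large factor \<open>R\<close> at \<open>K\<close>. Then the
  partial sum hardly grows up to \<open>N = R K\<close>, and the hypothesis at \<open>N\<close> makes \<open>\<xi>\<close> so small at the index
  \<open>q = O(S K)\<close> that half of \<open>S K\<close> is already attained there. This keeps the average over the first \<open>q\<close>
  terms away from zero, which is impossible for large \<open>K\<close>.\<close>
lemma regular_of_small_tail:
  fixes \<xi> :: "nat \<Rightarrow> real" and S :: "nat \<Rightarrow> real"
  assumes \<xi>: "\<xi> \<in> c0_star" and ns: "\<not> summable \<xi>" and S: "S = (\<lambda>n. \<Sum>j<n. \<xi> j)"
    and k: "0 < (k::nat)" and \<mu>: "\<mu> > 0"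
    and tail: "\<And>N. N > N0 \<Longrightarrow> \<xi> (k * nat \<lceil>S N / \<mu>\<rceil>) \<le> real k * S N / real N"
  shows "\<exists>C. \<forall>n. arith_mean \<xi> n \<le> C * \<xi> n"
proof -
  have nonneg: "0 \<le> \<xi> j" for j using \<xi> unfolding c0_star_def by auto
  have dec: "i \<le> j \<Longrightarrow> \<xi> j \<le> \<xi> i" for i j using \<xi> unfolding c0_star_def decseq_def by auto
  have mono: "m \<le> n \<Longrightarrow> S m \<le> S n" for m n unfolding S by (intro sum_mono2) (auto simp: nonneg)
  have step: "S n \<le> S m + real n * \<xi> m" for m n
  proof (cases "n \<le> m")
    case True
    then show ?thesis using mono[OF True] nonneg[of m] by (simp add: add_increasing2)
  next
    case False
    have "S n = S m + (\<Sum>j=m..<n. \<xi> j)"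
      using False unfolding S by (metis atLeast0LessThan nat_le_linear sum.atLeastLessThan_concat zero_le)
    also have "(\<Sum>j=m..<n. \<xi> j) \<le> (\<Sum>j=m..<n. \<xi> m)" using dec by (intro sum_mono) auto
    also have "\<dots> \<le> real n * \<xi> m" using nonneg by (simp add: mult_right_mono)
    finally show ?thesis by simp
  qed
  \<comment> \<open>The factor 4 turns \<open>k * S N / N\<close> with \<open>N = R * K\<close> and
    \<open>S N \<le> 2 * S K\<close> into \<open>S K / (2 * K)\<close>. Then
    \<open>K * \<xi> q\<close> is at most half of \<open>S K\<close>, and \<open>S q\<close> has to
    supply the other half.\<close>
  define R where "R = 4 * k"
  \<comment> \<open>As \<open>S N > 1\<close>, the index \<open>q\<close> is at most
    \<open>L * S N\<close>, hence at most \<open>2 * L * S K\<close>. The threshold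
    \<open>1 / (4 * L)\<close> for \<open>Q\<close> then yields \<open>S q < S K / 2\<close>, and
    \<open>S K > \<mu> * Q\<close> ensures \<open>q \<ge> Q\<close>.\<close>
  define L where "L = real k / \<mu> + real k"
  have "L > 0" unfolding L_def using k \<mu> by (simp add: add_pos_pos)
  obtain Q where Q: "0 < Q" "\<And>n. n \<ge> Q \<Longrightarrow> S n < (1 / (4 * L)) * real n"
    using partial_average_tendsto_zero[OF \<xi>, of "1 / (4 * L)"] \<open>L > 0\<close> unfolding S by auto
  obtain K1 where K1: "S K1 > max 1 (\<mu> * real Q)"
    using not_summable_partial_sums_unbounded[OF \<xi> ns] unfolding S by blast
  define K0 where "K0 = max K1 (N0 + 1)"
  \<comment> \<open>The index \<open>K - 1\<close> is the last one in the sum \<open>S K\<close>, so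
    that \<open>K = n + 1\<close> yields the bound for \<open>arith_mean \<xi> n\<close>.\<close>
  have main: "S K / real K \<le> real R * \<xi> (K - 1)" if K: "K \<ge> K0" for K
  proof (rule ccontr)
    assume "\<not> ?thesis"
    moreover have "real R * \<xi> K \<le> real R * \<xi> (K - 1)" using dec by (intro mult_left_mono) auto
    ultimately have big: "real R * \<xi> K < S K / real K" by simp
    have Kpos: "K > 0" "K > N0" using K by (auto simp: K0_def)
    define N where "N = R * K"
    have "K \<le> N" using k by (simp add: N_def R_def)
    have SK: "S K > 1" "S K > \<mu> * real Q" using K1 mono[of K1 K] K by (auto simp: K0_def)
    have "S N \<le> S K + real N * \<xi> K" by (rule step)
    also have "real N * \<xi> K = real K * (real R * \<xi> K)" by (simp add: N_def)
    also have "\<dots> \<le> S K" using big Kpos by (simp add: pos_less_divide_eq mult.commute less_imp_le)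
    finally have SN: "S N \<le> 2 * S K" by simp
    have SKN: "S K \<le> S N" by (rule mono) fact
    define q where "q = k * nat \<lceil>S N / \<mu>\<rceil>"
    have pos: "S N / \<mu> > 0" using SK SKN \<mu> by simp
    have q_ge: "q \<ge> Q"
    proof -
      have "real Q \<le> S N / \<mu>" using SK SKN \<mu> by (simp add: pos_le_divide_eq mult.commute)
      also have "\<dots> \<le> real (nat \<lceil>S N / \<mu>\<rceil>)" by linarith
      finally have "Q \<le> nat \<lceil>S N / \<mu>\<rceil>" by simp
      also have "\<dots> \<le> q" using mult_le_mono1[of 1 k "nat \<lceil>S N / \<mu>\<rceil>"] k by (simp only: q_def mult_1)
      finally show ?thesis .
    qed
    have q_le: "real q \<le> 2 * L * S K"
    proof -
      have "real (nat \<lceil>S N / \<mu>\<rceil>) \<le> S N / \<mu> + 1" using pos by linarith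
      then have "real q \<le> real k * (S N / \<mu> + 1)" unfolding q_def by (simp add: mult_left_mono)
      also have "\<dots> \<le> real k * (S N / \<mu> + S N)" using SK SKN by (intro mult_left_mono) auto
      also have "\<dots> = L * S N" by (simp add: L_def algebra_simps)
      also have "\<dots> \<le> L * (2 * S K)" using SN \<open>L > 0\<close> by simp
      finally show ?thesis by simp
    qed
    have "N > N0" using \<open>K \<le> N\<close> Kpos by simp
    have "\<xi> q \<le> real k * S N / real N" unfolding q_def by (rule tail) fact
    also have "\<dots> \<le> real k * (2 * S K) / real N" using SN by (intro divide_right_mono mult_left_mono) auto
    also have "\<dots> = S K / (2 * real K)" using k Kpos by (simp add: N_def R_def field_simps)
    finally have "real K * \<xi> q \<le> S K / 2" using Kpos by (simp add: field_simps)
    then have "S K / 2 \<le> S q" using step[of K q] by simp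
    moreover have "S q < (1 / (4 * L)) * real q" by (rule Q(2)[OF q_ge])
    moreover have "(1 / (4 * L)) * real q \<le> (1 / (4 * L)) * (2 * L * S K)"
      using q_le \<open>L > 0\<close> by (intro mult_left_mono) auto
    moreover have "(1 / (4 * L)) * (2 * L * S K) = S K / 2" using \<open>L > 0\<close> by simp
    ultimately show False by linarith
  qed
  have \<xi>pos: "\<xi> n > 0" for n
  proof (rule ccontr)
    assume "\<not> ?thesis"
    then have "\<xi> j = 0" if "j \<ge> n" for j using nonneg[of j] dec[OF that] by simp
    then have "summable \<xi>" by (intro summable_finite[of "{..<n}"]) auto
    with ns show False by simp
  qed
  \<comment> \<open>The finite sum covers the indices below \<open>K0\<close>; its quotients are
    legitimate because a nonsummable nonincreasing \<xi> has no zero.\<close>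
  define C where "C = real R + (\<Sum>i<K0. arith_mean \<xi> i / \<xi> i)"
  have ge0: "0 \<le> arith_mean \<xi> i / \<xi> i" for i using arith_mean_nonneg[OF \<xi>] nonneg by simp
  have "arith_mean \<xi> n \<le> C * \<xi> n" for n
  proof (cases "n < K0")
    case True
    have "arith_mean \<xi> n / \<xi> n \<le> (\<Sum>i<K0. arith_mean \<xi> i / \<xi> i)"
      using True ge0 by (intro member_le_sum) auto
    then have "arith_mean \<xi> n / \<xi> n \<le> C" by (simp add: C_def)
    then show ?thesis using \<xi>pos[of n] by (simp add: divide_le_eq)
  next
    case False
    have "arith_mean \<xi> n = S (n + 1) / real (n + 1)"
      unfolding arith_mean_def S by (simp add: lessThan_Suc_atMost)
    also have "\<dots> \<le> real R * \<xi> n" using main[of "n + 1"] False by simp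
    also have "\<dots> \<le> C * \<xi> n" unfolding C_def by (intro mult_right_mono nonneg) (auto intro!: sum_nonneg ge0)
    finally show ?thesis .
  qed
  then show ?thesis by blast
qed

text \<open>A step sequence: on \<open>[p k, p (k + 1))\<close> its value is \<open>S (N k) / N k\<close>, where \<open>N\<close> grows so fast that
  \<open>p (k + 1)\<close> steps of height \<open>S (N k) / N k\<close> already exhaust the sum \<open>S (N (k + 1))\<close>.\<close>
lemma irregular_dominating_sequence:
  fixes \<xi> :: "nat \<Rightarrow> real"
  assumes \<xi>: "\<xi> \<in> c0_star" and ns: "\<not> summable \<xi>" and irr: "\<not> (\<exists>C. \<forall>n. arith_mean \<xi> n \<le> C * \<xi> n)"
  shows "\<exists>\<eta>\<in>c0_star. (\<forall>n. arith_mean \<xi> n \<le> arith_mean \<eta> n) \<and> \<xi> \<notin> dilation_set \<eta>"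
proof -
  define S where "S = (\<lambda>n. \<Sum>j<n. \<xi> j)"
  define a where "a n = S n / real n" for n
  have nonneg: "0 \<le> \<xi> j" for j using \<xi> unfolding c0_star_def by auto
  have dec: "i \<le> j \<Longrightarrow> \<xi> j \<le> \<xi> i" for i j using \<xi> unfolding c0_star_def decseq_def by auto
  have mono: "m \<le> n \<Longrightarrow> S m \<le> S n" for m n unfolding S_def by (intro sum_mono2) (auto simp: nonneg)
  have "\<xi> 0 \<noteq> 0"
  proof
    assume "\<xi> 0 = 0"
    then have "\<xi> n = 0" for n using nonneg[of n] dec[of 0 n] by simp
    then have "\<xi> = (\<lambda>_. 0)" by (intro ext)
    then have "summable \<xi>" by (metis summable_zero)
    with ns show False by simp
  qed
  then have \<xi>0: "\<xi> 0 > 0" using nonneg[of 0] by simp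
  have Spos: "S n > 0" if "n \<ge> 1" for n using mono[OF that] \<xi>0 by (simp add: S_def)
  have apos: "a n > 0" if "n \<ge> 1" for n using Spos[OF that] that by (simp add: a_def)
  have adec: "a n \<le> a m" if "1 \<le> m" "m \<le> n" for m n
    unfolding a_def using partial_average_antimono[OF \<xi> S_def, of m n] that by simp
  \<comment> \<open>The factor \<open>Suc k\<close> stands both before the mean and in the index, so
    stage \<open>k\<close> rules out all constants and all dilations up to \<open>Suc k\<close>. The
    start \<open>N 0 = 1\<close> excludes the case \<open>n < N 0\<close> in the comparison of
    partial sums.\<close>
  have "\<exists>N::nat \<Rightarrow> nat. \<forall>k. (N k \<ge> 1 \<and> (k = 0 \<longrightarrow> N k = 1)) \<and> (N (Suc k) > N k \<and>
      real (Suc k) * a (N (Suc k)) < \<xi> (Suc k * nat \<lceil>S (N (Suc k)) / a (N k)\<rceil>))"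
  proof (rule dependent_nat_choice)
    show "\<exists>x::nat. x \<ge> 1 \<and> ((0::nat) = 0 \<longrightarrow> x = 1)" by blast
    fix x k :: nat assume "x \<ge> 1 \<and> (k = 0 \<longrightarrow> x = 1)"
    then have "x \<ge> 1" by simp
    \<comment> \<open>If no such \<open>N\<close> existed, the tail hypothesis of
      \<open>regular_of_small_tail\<close> would hold with \<mu> = \<open>a x\<close> and
      \<open>N0 = x\<close>.\<close>
    have "\<exists>N>x. real (Suc k) * S N / real N < \<xi> (Suc k * nat \<lceil>S N / a x\<rceil>)"
    proof (rule ccontr)
      assume "\<not> ?thesis"
      then have "\<xi> (Suc k * nat \<lceil>S N / a x\<rceil>) \<le> real (Suc k) * S N / real N" if "N > x" for N
        using that by (meson not_le)
      then show False
        using regular_of_small_tail[OF \<xi> ns S_def _ apos[OF \<open>x \<ge> 1\<close>], of "Suc k" x] irr by blast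
    qed
    then obtain y where y: "y > x" "real (Suc k) * S y / real y < \<xi> (Suc k * nat \<lceil>S y / a x\<rceil>)" by blast
    then show "\<exists>y. (y \<ge> 1 \<and> (Suc k = 0 \<longrightarrow> y = 1)) \<and> y > x \<and> real (Suc k) * a y < \<xi> (Suc k * nat \<lceil>S y / a x\<rceil>)"
      by (intro exI[of _ y]) (simp add: a_def[of y])
  qed
  then obtain N :: "nat \<Rightarrow> nat" where N1: "\<And>k. N k \<ge> 1" and N0: "N 0 = 1" and Ninc: "\<And>k. N (Suc k) > N k"
    and Nbig: "\<And>k. real (Suc k) * a (N (Suc k)) < \<xi> (Suc k * nat \<lceil>S (N (Suc k)) / a (N k)\<rceil>)" by blast
  have Nmono: "strict_mono N" using Ninc by (rule strict_mono_Suc_iff[THEN iffD2, rule_format])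
  define l where "l k = a (N k)" for k
  define p where "p k = (case k of 0 \<Rightarrow> 0 | Suc j \<Rightarrow> nat \<lceil>S (N (Suc j)) / l j\<rceil>)" for k
  have lpos: "l k > 0" for k unfolding l_def by (rule apos[OF N1])
  have ldec: "l j \<le> l i" if "i \<le> j" for i j
    unfolding l_def using N1 Nmono that by (intro adec) (auto simp: strict_mono_less_eq)
  have p_ge: "S (N (Suc j)) \<le> l j * real (p (Suc j))" for j
  proof -
    have "S (N (Suc j)) / l j \<le> real (p (Suc j))" by (simp add: p_def) linarith
    then show ?thesis using lpos[of j] by (simp add: divide_le_eq mult.commute)
  qed
  have pmono: "p i \<le> p j" if "i \<le> j" for i j
  proof (rule lift_Suc_mono_le[OF _ that])
    fix n
    show "p n \<le> p (Suc n)"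
    proof (cases n)
      case (Suc m)
      have "S (N (Suc m)) / l m \<le> S (N (Suc n)) / l n"
        using mono[of "N (Suc m)" "N (Suc n)"] Ninc[of "Suc m"] ldec[of m n] lpos Suc Spos[OF N1]
        by (intro frac_le) (auto intro: less_imp_le)
      then have "nat \<lceil>S (N (Suc m)) / l m\<rceil> \<le> nat \<lceil>S (N (Suc n)) / l n\<rceil>"
        by (intro nat_mono ceiling_mono)
      then show ?thesis by (simp only: Suc p_def nat.case)
    qed (simp add: p_def)
  qed
  have p_unbounded: "\<exists>k. n < p (Suc k)" for n
  proof -
    obtain M where M: "S M > l 0 * real n"
      using not_summable_partial_sums_unbounded[OF \<xi> ns] unfolding S_def by blast
    have "M \<le> N (Suc M)" using seq_suble[OF Nmono, of "Suc M"] by simp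
    then have "l 0 * real n < l M * real (p (Suc M))" using M mono p_ge[of M] by (meson less_le_trans order_trans)
    also have "\<dots> \<le> l 0 * real (p (Suc M))" using ldec[of 0 M] by (intro mult_right_mono) auto
    finally show ?thesis using lpos[of 0] by (intro exI[of _ M]) simp
  qed
  \<comment> \<open>The number of the step containing \<open>n\<close>. As \<open>p\<close> is only
    known to be nondecreasing, a step may be empty; the least index skips such steps.\<close>
  define \<kappa> where "\<kappa> n = (LEAST k. n < p (Suc k))" for n
  have \<kappa>: "n < p (Suc (\<kappa> n))" for n unfolding \<kappa>_def using p_unbounded by (rule LeastI_ex)
  have \<kappa>_le: "\<kappa> n \<le> k" if "n < p (Suc k)" for n k unfolding \<kappa>_def using that by (rule Least_le)
  have \<kappa>_ge: "k \<le> \<kappa> n" if "p k \<le> n" for n k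
    using \<kappa>[of n] that pmono[of "Suc (\<kappa> n)" k] by (meson not_less_eq_eq not_le order_trans)
  define \<eta> where "\<eta> n = l (\<kappa> n)" for n
  have \<eta>_ge: "l k \<le> \<eta> n" if "n < p (Suc k)" for n k unfolding \<eta>_def using \<kappa>_le[OF that] by (rule ldec)
  have \<eta>_le: "\<eta> n \<le> l k" if "p k \<le> n" for n k unfolding \<eta>_def using \<kappa>_ge[OF that] by (rule ldec)
  have \<eta>pos: "\<eta> n \<ge> 0" for n unfolding \<eta>_def using lpos less_imp_le by blast
  have "\<eta> \<in> c0_star"
  proof -
    have "decseq \<eta>"
    proof (rule decseq_SucI)
      fix n show "\<eta> (Suc n) \<le> \<eta> n" using \<eta>_ge[of "Suc n" "\<kappa> (Suc n)"] \<kappa>[of "Suc n"] \<eta>_ge[of n "\<kappa> (Suc n)"]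
        by (simp add: \<eta>_def)
    qed
    moreover have "\<eta> \<longlonglongrightarrow> 0"
    proof (rule LIMSEQ_I)
      fix \<epsilon> :: real assume "\<epsilon> > 0"
      then obtain K where K: "0 < K" "\<And>n. n \<ge> K \<Longrightarrow> S n < \<epsilon> * real n"
        using partial_average_tendsto_zero[OF \<xi>] unfolding S_def by blast
      have "K \<le> N K" by (rule seq_suble[OF Nmono])
      then have "l K < \<epsilon>" unfolding l_def a_def using K N1[of K] by (simp add: pos_divide_less_eq)
      then show "\<exists>no. \<forall>n\<ge>no. norm (\<eta> n - 0) < \<epsilon>"
        using \<eta>_le \<eta>pos by (intro exI[of _ "p K"]) (auto intro: le_less_trans)
    qed
    ultimately show ?thesis unfolding c0_star_def using \<eta>pos by simp
  qed
  have dom: "S n \<le> (\<Sum>j<n. \<eta> j)" if "n \<ge> 1" for n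
  proof -
    \<comment> \<open>The step holding the last of the first \<open>n\<close> terms, so all of them
      are at least \<open>l k\<close>. For \<open>n \<ge> N k\<close> this already exceeds the
      average of \<xi>; for \<open>n < N k\<close> the first \<open>p k\<close> terms alone have
      mass at least \<open>S (N k)\<close>.\<close>
    define k where "k = \<kappa> (n - 1)"
    have n_le: "n \<le> p (Suc k)" using \<kappa>[of "n - 1"] that by (simp add: k_def)
    have "(\<Sum>j<n. l k) \<le> (\<Sum>j<n. \<eta> j)" using n_le by (intro sum_mono \<eta>_ge) auto
    then have lin: "l k * real n \<le> (\<Sum>j<n. \<eta> j)" by (simp add: mult.commute)
    show ?thesis
    proof (cases "N k \<le> n")
      case True
      then have "S n / real n \<le> l k" unfolding l_def using adec[OF N1 True] by (simp add: a_def)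
      then have "S n \<le> l k * real n" using that by (simp add: divide_le_eq)
      with lin show ?thesis by simp
    next
      case False
      show ?thesis
      proof (cases k)
        case 0
        then show ?thesis using False N0 that by simp
      next
        case (Suc j)
        have "p k \<le> n - 1" using \<kappa>_le[of "n - 1" j] Suc by (metis k_def not_less_eq_eq not_le order_refl)
        then have "p (Suc j) \<le> n" using Suc by simp
        have "S n \<le> S (N (Suc j))" using False Suc by (intro mono) simp
        also have "\<dots> \<le> l j * real (p (Suc j))" by (rule p_ge)
        also have "\<dots> = (\<Sum>i<p (Suc j). l j)" by simp
        also have "\<dots> \<le> (\<Sum>i<p (Suc j). \<eta> i)" by (intro sum_mono \<eta>_ge) auto
        also have "\<dots> \<le> (\<Sum>i<n. \<eta> i)" using \<open>p (Suc j) \<le> n\<close> \<eta>pos by (intro sum_mono2) auto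
        finally show ?thesis .
      qed
    qed
  qed
  have "\<xi> \<notin> dilation_set \<eta>"
  proof
    assume "\<xi> \<in> dilation_set \<eta>"
    then obtain M m where M: "0 < m" "\<And>n. \<xi> n \<le> M * \<eta> (n div m)" unfolding dilation_set_def by blast
    obtain j where j: "real j \<ge> M" "j \<ge> m" using real_arch_simple[of "max M (real m)"] by auto
    \<comment> \<open>The index \<open>m * p (Suc j)\<close> is dilated back exactly to the start of
      step \<open>Suc j\<close>, where \<eta> has already dropped to at most
      \<open>l (Suc j)\<close>.\<close>
    have "real (Suc j) * l (Suc j) < \<xi> (Suc j * p (Suc j))"
      using Nbig[of j] by (simp add: l_def p_def)
    also have "\<dots> \<le> \<xi> (m * p (Suc j))" using j by (intro dec mult_le_mono1) simp
    also have "\<dots> \<le> M * \<eta> (p (Suc j))" using M(2)[of "m * p (Suc j)"] M(1) by simp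
    also have "\<dots> \<le> real (Suc j) * \<eta> (p (Suc j))" using j \<eta>pos by (intro mult_right_mono) auto
    also have "\<dots> \<le> real (Suc j) * l (Suc j)" using \<eta>_le[of "Suc j"] by (intro mult_left_mono) auto
    finally show False by simp
  qed
  moreover have "arith_mean \<xi> n \<le> arith_mean \<eta> n" for n
    using dom[of "n + 1"] unfolding arith_mean_def S_def by (simp add: lessThan_Suc_atMost divide_right_mono)
  ultimately show ?thesis using \<open>\<eta> \<in> c0_star\<close> by blast
qed

theorem proposition6p17:
  fixes e :: "nat \<Rightarrow> 'a::complex_hilbert_space"
    and \<xi> :: "nat \<Rightarrow> real"
  assumes "separable_space (euclidean :: 'a topology)"
    and "infinite_dimensional TYPE('a)"
    and "orthonormal_basis e"
    and "\<xi> \<in> c0_star"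
    and "\<xi> \<noteq> (\<lambda>_. 0)"
    and "finite_rank_operators \<noteq> principal_ideal e \<xi>"
    and "principal_ideal e \<xi> = hat_ideal (principal_ideal e \<xi>)"
  shows "principal_ideal e \<xi> = am_ideal (principal_ideal e \<xi>)"
proof -
  note e = assms(3) and \<xi> = assms(4)
  have nonneg: "0 \<le> \<xi> j" for j using \<xi> unfolding c0_star_def by auto
  have \<xi>0: "\<xi> 0 > 0"
  proof (rule ccontr)
    assume "\<not> ?thesis"
    then have "\<xi> n = 0" for n
      using nonneg[of n] \<xi> unfolding c0_star_def decseq_def by (metis (mono_tags, lifting) le0 le_less_trans mem_Collect_eq not_le order_antisym)
    then show False using assms(5) by auto
  qed
  have "\<not> summable \<xi>"
  proof
    assume sum: "summable \<xi>"
    let ?\<delta> = "\<lambda>n::nat. if n = 0 then 1 else 0 :: real"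
    have "?\<delta> \<longlonglongrightarrow> 0"
      by (rule tendsto_eventually) (auto simp: eventually_sequentially intro!: exI[of _ 1])
    then have \<delta>: "?\<delta> \<in> c0_star" unfolding c0_star_def decseq_def by auto
    \<comment> \<open>The means of \<open>?\<delta>\<close> are \<open>1 / (n + 1)\<close>, so this
      only compares a partial sum with the whole series.\<close>
    have "arith_mean \<xi> n \<le> suminf \<xi> * arith_mean ?\<delta> n" for n
      using sum_le_suminf[OF sum, of "{..n}"] nonneg unfolding arith_mean_def by (simp add: divide_right_mono)
    from hat_ideal_principal_subset[OF e \<xi> \<delta> this]
    have "principal_ideal e \<xi> \<subseteq> finite_rank_operators"
      using principal_ideal_delta_finite_rank[OF e] assms(7) by blast
    then show False using finite_rank_subset_principal_ideal[OF e \<xi> \<xi>0] assms(6) by blast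
  qed
  have "\<exists>C. \<forall>n. arith_mean \<xi> n \<le> C * \<xi> n"
  proof (rule ccontr)
    assume "\<not> ?thesis"
    from irregular_dominating_sequence[OF \<xi> \<open>\<not> summable \<xi>\<close> this]
    obtain \<eta> where \<eta>: "\<eta> \<in> c0_star" "\<And>n. arith_mean \<xi> n \<le> 1 * arith_mean \<eta> n" "\<xi> \<notin> dilation_set \<eta>" by auto
    have "diag_operator e \<xi> \<in> principal_ideal e \<eta>"
      using hat_ideal_principal_subset[OF e \<xi> \<eta>(1,2)] diag_operator_in_principal_ideal[OF e] assms(7) by blast
    then have "\<xi> \<in> Sigma_set (principal_ideal e \<eta>)"
      unfolding Sigma_set_eq[OF e operator_ideal_principal_ideal[OF e \<eta>(1)]] using \<xi> by simp
    then show False using Sigma_set_principal_ideal_subset[OF e \<eta>(1)] \<eta>(3) by blast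
  qed
  then obtain C where "\<And>n. arith_mean \<xi> n \<le> C * \<xi> n" by blast
  then show ?thesis by (rule am_ideal_principal_regular[OF e \<xi>, symmetric])
qed

end
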